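(* Let $T>0$ and let $(l_e,N_e,f_{pe})$ be a constant equilibrium, i.e. $F(l_e,N_e,f_{pe})=0$, with $0<f_{pe}<1$, $0<l_e<L$ and $N_e>0$. Then there exists $\varepsilon_0>0$ (depending on $T$) and a constant $C_{\varepsilon_0}$ (depending on $\varepsilon_0$ but independent of $\varepsilon$ and of the data below) such that the following holds for every $\varepsilon\in(0,\varepsilon_0]$. Let $l^0\in(0,L)$, $f_p^0\in H^2(0,1)$ and $F_{in},N\in W^{1,\infty}(0,T)$ with $\dfrac{F_{in}}{\rho_oV_{eff}N}\in H^2(0,T)$ satisfy the compatibility conditions $$\frac{F_{in}(0)}{\rho_o V_{eff}N(0)}=f_p^0(0),\qquad (f_p^0)_x(0)+\frac{l^0}{\zeta N(0)}\cdot\frac{F_{in}'(0)N(0)-F_{in}(0)N'(0)}{\rho_oV_{eff}N^2(0)}=0$$ (the last fraction being the value at $t=0$ of the derivative of $F_{in}/(\rho_oV_{eff}N)\in H^2(0,T)$) and the smallness condition $$\|f_p^0-f_{pe}\|_{H^2(0,1)}+\Big\|\frac{F_{in}}{\rho_oV_{eff}N}-f_{pe}\Big\|_{H^2(0,T)}+\|N-N_e\|_{W^{1,\infty}(0,T)}+|l^0-l_e|\le\varepsilon .$$ Then the Cauchy problem $$\begin{cases}\dot l(t)=F(l(t),N(t),f_p(t,1)),\quad t\in(0,T),\\ l(0)=l^0,\end{cases}$$ $$\begin{cases}\partial_tf_p(t,x)+\alpha_p(x,N(t),l(t),f_p(t,1))\,\partial_xf_p(t,x)=0,\quad (t,x)\in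 Q=(0,T)\times(0,1),\\ f_p(0,x)=f_p^0(x),\quad x\in(0,1),\\ f_p(t,0)=\dfrac{F_{in}(t)}{\rho_oV_{eff}N(t)},\quad t\in(0,T),\end{cases}$$ has a unique solution $(l,f_p)\in W^{1,\infty}(0,T)\times C^0([0,T];H^2(0,1))$, and $$\|f_p-f_{pe}\|_{C^0([0,T];H^2(0,1))}\le C_{\varepsilon_0}\,\varepsilon .$$
   Context: The physical parameters $L,\zeta,\rho_o,V_{eff},S_{eff},B,K_d$ are fixed positive constants. For $l\in(0,L)$, $N\in\mathbb{R}$, $f\in(0,1)$, $x\in[0,1]$ set $$F_d(l,N)=\frac{K_d\,\rho_oV_{eff}\,N\,(L-l)}{B\rho_o+K_d(L-l)},\qquad F(l,N,f)=\frac{F_d(l,N)-\rho_oV_{eff}N f}{\rho_oS_{eff}(1-f)},$$ $$\alpha_p(x,N,l,f)=\frac1l\big(\zeta N-xF(l,N,f)\big).$$ A solution $(l,f_p)$ is understood to take values for which these expressions make sense, i.e. $l(t)\in(0,L)$ and $f_p(t,1)\in(0,1)$. The equations hold almost everywhere; initial and boundary values are taken in the sense of the continuous representatives. "Independent of $\varepsilon$" allows the constants to depend on $T$, on the equilibrium and on the physical parameters. *)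

theory Defs
  imports "HOL-Probability.Essential_Supremum"
begin

section \<open>Sobolev spaces\<close>

text \<open>Test functions: compactly supported and continuously differentiable, the test class used
  by Brezis to define Sobolev spaces on intervals (it gives the same weak derivatives as smooth
  test functions).\<close>

definition C1c :: "'a::euclidean_space set \<Rightarrow> ('a \<Rightarrow> real) set" where
  "C1c \<Omega> = {\<phi>. (\<forall>x. \<phi> differentiable (at x))
      \<and> (\<forall>i\<in>Basis. continuous_on UNIV (\<lambda>x. frechet_derivative \<phi> (at x) i))
      \<and> compact (closure {x. \<phi> x \<noteq> 0}) \<and> closure {x. \<phi> x \<noteq> 0} \<subseteq> \<Omega>}"

text \<open>The function \<open>g\<close> is the weak derivative of \<open>f\<close> on \<open>\<Omega>\<close> in the direction \<open>i\<close>. Only bounded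
  \<open>\<Omega>\<close> and (at least) square integrable functions occur below, so integrability on all of \<open>\<Omega>\<close>
  rather than local integrability is no restriction; it prevents the integrals from degenerating
  to the default value \<open>0\<close>.\<close>

definition has_weak_deriv ::
  "'a::euclidean_space set \<Rightarrow> 'a \<Rightarrow> ('a \<Rightarrow> real) \<Rightarrow> ('a \<Rightarrow> real) \<Rightarrow> bool" where
  "has_weak_deriv \<Omega> i f g \<longleftrightarrow>
     integrable (lebesgue_on \<Omega>) f \<and> integrable (lebesgue_on \<Omega>) g \<and>
     (\<forall>\<phi>\<in>C1c \<Omega>.
        (\<integral>x. f x * frechet_derivative \<phi> (at x) i \<partial>lebesgue_on \<Omega>)
          = - (\<integral>x. g x * \<phi> x \<partial>lebesgue_on \<Omega>))"

text \<open>On an open set the weak derivative is unique only up to null sets; the operator picks some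
  representative, so only its almost everywhere class is meaningful.\<close>

definition weak_deriv :: "real set \<Rightarrow> (real \<Rightarrow> real) \<Rightarrow> real \<Rightarrow> real" where
  "weak_deriv I f = (SOME g. has_weak_deriv I 1 f g)"

definition L2 :: "real set \<Rightarrow> (real \<Rightarrow> real) set" where
  "L2 I = {f \<in> borel_measurable (lebesgue_on I). integrable (lebesgue_on I) (\<lambda>x. (f x)\<^sup>2)}"

definition Linf_norm :: "real set \<Rightarrow> (real \<Rightarrow> real) \<Rightarrow> real" where
  "Linf_norm I f = real_of_ereal (esssup (lebesgue_on I) (\<lambda>x. ereal \<bar>f x\<bar>))"

definition Linf :: "real set \<Rightarrow> (real \<Rightarrow> real) set" where
  "Linf I = {f \<in> borel_measurable (lebesgue_on I).
     esssup (lebesgue_on I) (\<lambda>x. ereal \<bar>f x\<bar>) < \<infinity>}"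

definition W1inf :: "real set \<Rightarrow> (real \<Rightarrow> real) set" where
  "W1inf I = {f \<in> Linf I. \<exists>f'\<in>Linf I. has_weak_deriv I 1 f f'}"

definition W1inf_norm :: "real set \<Rightarrow> (real \<Rightarrow> real) \<Rightarrow> real" where
  "W1inf_norm I f = Linf_norm I f + Linf_norm I (weak_deriv I f)"

definition H2 :: "real set \<Rightarrow> (real \<Rightarrow> real) set" where
  "H2 I = {f \<in> L2 I. \<exists>f'\<in>L2 I. \<exists>f''\<in>L2 I. has_weak_deriv I 1 f f' \<and> has_weak_deriv I 1 f' f''}"

definition H2_norm :: "real set \<Rightarrow> (real \<Rightarrow> real) \<Rightarrow> real" where
  "H2_norm I f = sqrt ((\<integral>x. (f x)\<^sup>2 \<partial>lebesgue_on I)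
     + (\<integral>x. (weak_deriv I f x)\<^sup>2 \<partial>lebesgue_on I)
     + (\<integral>x. (weak_deriv I (weak_deriv I f) x)\<^sup>2 \<partial>lebesgue_on I))"

text \<open>The representative of (the class of) \<open>u\<close> on the interval from \<open>a\<close> to \<open>b\<close> that is continuous up
  to the endpoints. It is unique on the closed interval, so its endpoint values are well defined.\<close>

definition cont_rep :: "real \<Rightarrow> real \<Rightarrow> (real \<Rightarrow> real) \<Rightarrow> real \<Rightarrow> real" where
  "cont_rep a b u =
     (SOME v. continuous_on {a..b} v \<and> (AE x in lebesgue_on {a<..<b}. v x = u x))"

text \<open>Elements of \<open>C\<^sup>0([0,T]; H\<^sup>2(0,1))\<close>, as functions of \<open>t\<close> with values in functions of \<open>x\<close>.\<close>

definition C0_H2 :: "real \<Rightarrow> (real \<Rightarrow> real \<Rightarrow> real) set" where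
  "C0_H2 T = {u. \<forall>t\<in>{0..T}. u t \<in> H2 {0<..<1} \<and>
     ((\<lambda>s. H2_norm {0<..<1} (\<lambda>x. u s x - u t x)) \<longlongrightarrow> 0) (at t within {0..T})}"

definition C0_H2_norm :: "real \<Rightarrow> (real \<Rightarrow> real \<Rightarrow> real) \<Rightarrow> real" where
  "C0_H2_norm T u = (SUP t\<in>{0..T}. H2_norm {0<..<1} (u t))"

section \<open>The extrusion model\<close>

definition F_d :: "real \<Rightarrow> real \<Rightarrow> real \<Rightarrow> real \<Rightarrow> real \<Rightarrow> real \<Rightarrow> real \<Rightarrow> real" where
  "F_d L \<rho>\<^sub>o V\<^sub>e\<^sub>f\<^sub>f B K\<^sub>d l N =
     K\<^sub>d * \<rho>\<^sub>o * V\<^sub>e\<^sub>f\<^sub>f * N * (L - l) / (B * \<rho>\<^sub>o + K\<^sub>d * (L - l))"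

definition F ::
  "real \<Rightarrow> real \<Rightarrow> real \<Rightarrow> real \<Rightarrow> real \<Rightarrow> real \<Rightarrow> real \<Rightarrow> real \<Rightarrow> real \<Rightarrow> real" where
  "F L \<rho>\<^sub>o V\<^sub>e\<^sub>f\<^sub>f S\<^sub>e\<^sub>f\<^sub>f B K\<^sub>d l N f =
     (F_d L \<rho>\<^sub>o V\<^sub>e\<^sub>f\<^sub>f B K\<^sub>d l N - \<rho>\<^sub>o * V\<^sub>e\<^sub>f\<^sub>f * N * f) / (\<rho>\<^sub>o * S\<^sub>e\<^sub>f\<^sub>f * (1 - f))"

definition \<alpha>\<^sub>p ::
  "real \<Rightarrow> real \<Rightarrow> real \<Rightarrow> real \<Rightarrow> real \<Rightarrow> real \<Rightarrow> real \<Rightarrow> real \<Rightarrow> real \<Rightarrow> real \<Rightarrow> real \<Rightarrow> real" where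
  "\<alpha>\<^sub>p L \<zeta> \<rho>\<^sub>o V\<^sub>e\<^sub>f\<^sub>f S\<^sub>e\<^sub>f\<^sub>f B K\<^sub>d x N l f =
     1 / l * (\<zeta> * N - x * F L \<rho>\<^sub>o V\<^sub>e\<^sub>f\<^sub>f S\<^sub>e\<^sub>f\<^sub>f B K\<^sub>d l N f)"

text \<open>Solutions \<open>(l, f\<^sub>p)\<close> of the Cauchy problem with initial data \<open>l\<^sup>0\<close>, \<open>f\<^sub>p\<^sup>0\<close> (here \<open>l0\<close>, \<open>fp0\<close>),
  input \<open>N\<close> and boundary datum \<open>g\<close> at \<open>x = 0\<close>. Sobolev functions are represented by their
  representatives that are continuous up to the boundary, so that pointwise values such as \<open>l 0\<close>
  and \<open>f\<^sub>p t 1\<close> make sense. The time derivative of \<open>f\<^sub>p\<close> is a weak one: almost everywhere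
  classical differentiability would admit spurious solutions with a singular part.\<close>

definition is_solution ::
  "real \<Rightarrow> real \<Rightarrow> real \<Rightarrow> real \<Rightarrow> real \<Rightarrow> real \<Rightarrow> real \<Rightarrow> real \<Rightarrow> real \<Rightarrow> (real \<Rightarrow> real)
     \<Rightarrow> (real \<Rightarrow> real) \<Rightarrow> (real \<Rightarrow> real) \<Rightarrow> (real \<Rightarrow> real) \<Rightarrow> (real \<Rightarrow> real \<Rightarrow> real) \<Rightarrow> bool" where
  "is_solution L \<zeta> \<rho>\<^sub>o V\<^sub>e\<^sub>f\<^sub>f S\<^sub>e\<^sub>f\<^sub>f B K\<^sub>d T l0 fp0 N g l f\<^sub>p \<longleftrightarrow>
     l \<in> W1inf {0<..<T} \<and> continuous_on {0..T} l \<and>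
     f\<^sub>p \<in> C0_H2 T \<and> (\<forall>t\<in>{0..T}. continuous_on {0..1} (f\<^sub>p t)) \<and>
     (\<forall>t\<in>{0..T}. 0 < l t \<and> l t < L \<and> 0 < f\<^sub>p t 1 \<and> f\<^sub>p t 1 < 1) \<and>
     (AE t in lebesgue_on {0<..<T}.
        weak_deriv {0<..<T} l t = F L \<rho>\<^sub>o V\<^sub>e\<^sub>f\<^sub>f S\<^sub>e\<^sub>f\<^sub>f B K\<^sub>d (l t) (N t) (f\<^sub>p t 1)) \<and>
     l 0 = l0 \<and>
     (\<exists>ft fx.
        has_weak_deriv ({0<..<T} \<times> {0<..<1}) (1, 0) (\<lambda>(t, x). f\<^sub>p t x) ft \<and>
        has_weak_deriv ({0<..<T} \<times> {0<..<1}) (0, 1) (\<lambda>(t, x). f\<^sub>p t x) fx \<and>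
        (AE (t, x) in lebesgue_on ({0<..<T} \<times> {0<..<1}).
           ft (t, x) + \<alpha>\<^sub>p L \<zeta> \<rho>\<^sub>o V\<^sub>e\<^sub>f\<^sub>f S\<^sub>e\<^sub>f\<^sub>f B K\<^sub>d x (N t) (l t) (f\<^sub>p t 1) * fx (t, x) = 0)) \<and>
     (\<forall>x\<in>{0<..<1}. f\<^sub>p 0 x = fp0 x) \<and>
     (\<forall>t\<in>{0<..<T}. f\<^sub>p t 0 = g t)"

end

theory Submission
  imports Defs
begin

text \<open>Since \<open>l' = F\<close>, the speed is \<open>\<alpha> = (\<zeta> N - x l') / l\<close>, so that \<open>(l x)' = \<zeta> N\<close> along every
  characteristic. Hence \<open>l t * x - M t\<close>, where \<open>M\<close> is the primitive of \<open>\<zeta> N\<close>, is constant along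
  characteristics, and the solutions of the transport equation are the travelling profiles
  \<open>f t x = \<phi> (l t * x - M t)\<close>. The profile is fixed by the data alone: \<open>\<phi> (l0 * x) = fp0 x\<close> on the right of
  \<open>0\<close> and \<open>\<phi> (- M t) = g t\<close> on the left. The two compatibility conditions state that \<open>\<phi>\<close> and its derivative
  match at \<open>0\<close>, so that \<open>\<phi>\<close> is of class \<open>H\<^sup>2\<close>, with a norm of order \<open>\<epsilon>\<close> after subtraction of the
  equilibrium (\<open>profile_exists\<close>).

  Inserting the representation into the first equation leaves a scalar ordinary differential equation
  \<open>l' = F(l, N, \<phi> (l - M))\<close>. It is solved by the Picard-Lindeloef theorem for a truncated right-hand side.
  As \<open>F\<close> is linear in \<open>N\<close> it vanishes at \<open>(l, f) = (le, fe)\<close> whatever the value of \<open>N\<close>, and Gronwall's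
  inequality gives \<open>\<bar>l - le\<bar> = O(\<epsilon>)\<close>; for small \<open>\<epsilon>\<close> the truncation is never active, and \<open>l' < \<zeta> N\<close>, so that
  the flow at \<open>x = 1\<close> is outgoing (\<open>trajectory_exists\<close>). The resulting travelling profile is continuous in
  time with values in \<open>H\<^sup>2\<close> because translations and dilations act continuously on \<open>L\<^sup>2\<close>
  (\<open>L2_affine_continuous\<close>), and its norm is read off from that of \<open>\<phi>\<close>.

  For uniqueness, a solution in \<open>C\<^sup>0([0, T]; H\<^sup>2)\<close> has a continuous \<open>x\<close> derivative, the equation then makes
  its weak time derivative continuous, and the solution is classical (\<open>solution_classical\<close>). It is
  therefore constant along characteristics, and equals the travelling profile as long as
  characteristics do not enter at \<open>x = 1\<close> (\<open>solution_representation\<close>). Up to that time \<open>l\<close> solves the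
  scalar equation above, for which solutions are unique; and since the constructed solution has
  strictly outgoing flow at \<open>x = 1\<close>, that time never comes (\<open>solution_unique\<close>).\<close>

section \<open>Test functions and the fundamental lemma\<close>

definition C1 :: "('a::euclidean_space \<Rightarrow> real) \<Rightarrow> bool" where
  "C1 \<phi> \<longleftrightarrow> (\<forall>x. \<phi> differentiable (at x)) \<and>
     (\<forall>i\<in>Basis. continuous_on UNIV (\<lambda>x. frechet_derivative \<phi> (at x) i))"

lemma C1_imp_continuous: "C1 \<phi> \<Longrightarrow> continuous_on S \<phi>"
  unfolding C1_def
  by (meson continuous_at_imp_continuous_on differentiable_imp_continuous_within)

lemma C1I:
  assumes "\<And>x. (\<phi> has_derivative D x) (at x)"
    and "\<And>i. i \<in> Basis \<Longrightarrow> continuous_on UNIV (\<lambda>x. D x i)"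
  shows "C1 \<phi>"
proof -
  have "frechet_derivative \<phi> (at x) = D x" for x
    by (rule frechet_derivative_at[OF assms(1), symmetric])
  then have "C1 \<phi> \<longleftrightarrow> (\<forall>x. \<phi> differentiable (at x)) \<and> (\<forall>i\<in>Basis. continuous_on UNIV (\<lambda>x. D x i))"
    by (simp add: C1_def)
  then show ?thesis
    using assms by (auto simp: differentiable_def)
qed

lemma C1_has_derivative:
  "C1 \<phi> \<Longrightarrow> (\<phi> has_derivative frechet_derivative \<phi> (at x)) (at x)"
  by (simp add: C1_def frechet_derivative_works[THEN iffD1])

lemma C1_mult:
  assumes "C1 f" "C1 g"
  shows "C1 (\<lambda>x. f x * g x)"
proof (rule C1I)
  show "((\<lambda>x. f x * g x) has_derivative
      (\<lambda>h. f x * frechet_derivative g (at x) h + frechet_derivative f (at x) h * g x)) (at x)" for x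
    by (rule has_derivative_mult[OF C1_has_derivative C1_has_derivative]) (use assms in auto)
  show "continuous_on UNIV
      (\<lambda>x. f x * frechet_derivative g (at x) i + frechet_derivative f (at x) i * g x)"
    if "i \<in> Basis" for i
    using assms that C1_imp_continuous[OF assms(1)] C1_imp_continuous[OF assms(2)]
    by (auto simp: C1_def intro!: continuous_intros)
qed

lemma C1_const: "C1 (\<lambda>x. c)"
  by (rule C1I[where D = "\<lambda>_ _. 0"]) auto

lemma C1_prod: "finite I \<Longrightarrow> (\<And>i. i \<in> I \<Longrightarrow> C1 (f i)) \<Longrightarrow> C1 (\<lambda>x. \<Prod>i\<in>I. f i x)"
  by (induction I rule: finite_induct) (auto intro: C1_mult C1_const)

lemma C1_compose_real:
  fixes h h' :: "real \<Rightarrow> real"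
  assumes "\<And>s. s \<in> range f \<Longrightarrow> (h has_real_derivative h' s) (at s)" and "continuous_on (range f) h'" and "C1 f"
  shows "C1 (\<lambda>x. h (f x))"
proof (rule C1I)
  show "((\<lambda>x. h (f x)) has_derivative (\<lambda>v. h' (f x) * frechet_derivative f (at x) v)) (at x)" for x
    using has_derivative_compose[OF C1_has_derivative[OF assms(3)], of h] assms(1)[of "f x"]
    by (auto simp: has_field_derivative_def mult.commute o_def)
  show "continuous_on UNIV (\<lambda>x. h' (f x) * frechet_derivative f (at x) i)" if "i \<in> Basis" for i
    using assms(3) that C1_imp_continuous[OF assms(3)]
    by (auto simp: C1_def intro!: continuous_intros continuous_on_compose2[OF assms(2)])
qed

lemma C1_inner: "C1 (\<lambda>x. x \<bullet> i)"
  by (rule C1I[where D = "\<lambda>_ h. h \<bullet> i"]) (auto intro!: derivative_eq_intros)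

text \<open>Squares of positive parts are the simplest functions that are continuously
  differentiable and vanish on a half line; products of them vanish exactly off a box.\<close>

lemma has_real_derivative_pos_square:
  "((\<lambda>s::real. (max 0 s)\<^sup>2) has_real_derivative 2 * max 0 s) (at s)"
proof (cases s "0::real" rule: linorder_cases)
  case less
  have "((\<lambda>s::real. (max 0 s)\<^sup>2) has_real_derivative 0) (at s)"
    by (rule has_field_derivative_transform_within_open[of "\<lambda>_. 0" _ _ "{..<0}"]) (use less in auto)
  then show ?thesis using less by simp
next
  case greater
  have "((\<lambda>s::real. (max 0 s)\<^sup>2) has_real_derivative 2 * s) (at s)"
    by (rule has_field_derivative_transform_within_open[of "\<lambda>s. s\<^sup>2" _ _ "{0<..}"])
      (use greater in \<open>auto intro!: derivative_eq_intros\<close>)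
  then show ?thesis using greater by simp
next
  case equal
  have "((\<lambda>h::real. max 0 h) \<longlongrightarrow> max 0 0) (at 0)"
    by (intro tendsto_intros)
  moreover have "(max 0 (0 + h))\<^sup>2 / h = max 0 h" for h :: real
    by (auto simp: max_def power2_eq_square)
  ultimately show ?thesis
    using equal by (simp add: DERIV_def)
qed

lemma has_real_derivative_pos_square' [derivative_intros]:
  assumes "(f has_real_derivative f') (at x)"
  shows "((\<lambda>s::real. (max 0 (f s))\<^sup>2) has_real_derivative 2 * max 0 (f x) * f') (at x)"
  using DERIV_chain2[OF has_real_derivative_pos_square assms] .

text \<open>Vanishes off a box slightly smaller than \<open>box a b\<close>, so that its support is a compact
  subset of \<open>box a b\<close>.\<close>

definition box_bump :: "'a::euclidean_space \<Rightarrow> 'a \<Rightarrow> nat \<Rightarrow> 'a \<Rightarrow> real" where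
  "box_bump a b n x = (\<Prod>i\<in>Basis. (max 0 (x \<bullet> i - (a \<bullet> i + 1 / Suc n)))\<^sup>2 *
     (max 0 (b \<bullet> i - 1 / Suc n - x \<bullet> i))\<^sup>2)"

lemma box_bump_nonneg: "0 \<le> box_bump a b n x"
  unfolding box_bump_def by (intro prod_nonneg) auto

lemma C1_box_bump: "C1 (box_bump a b n)"
proof -
  have 1: "C1 (\<lambda>x. (max 0 (x \<bullet> i - c))\<^sup>2)" for i :: 'a and c
    by (rule C1_compose_real[where h = "\<lambda>s. (max 0 (s - c))\<^sup>2" and h' = "\<lambda>s. 2 * max 0 (s - c)"])
      (auto intro!: derivative_eq_intros has_real_derivative_pos_square'
        continuous_intros C1_inner)
  have 2: "C1 (\<lambda>x. (max 0 (c - x \<bullet> i))\<^sup>2)" for i :: 'a and c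
    by (rule C1_compose_real[where h = "\<lambda>s. (max 0 (c - s))\<^sup>2" and h' = "\<lambda>s. - (2 * max 0 (c - s))"])
      (auto intro!: derivative_eq_intros has_real_derivative_pos_square'
        continuous_intros C1_inner)
  have "box_bump a b n = (\<lambda>x. \<Prod>i\<in>Basis. (max 0 (x \<bullet> i - (a \<bullet> i + 1 / Suc n)))\<^sup>2 *
     (max 0 (b \<bullet> i - 1 / Suc n - x \<bullet> i))\<^sup>2)"
    by (auto simp: box_bump_def)
  then show ?thesis
    by (simp only:) (intro C1_prod C1_mult 1 2, auto)
qed

lemma box_bump_support:
  "{x. box_bump a b n x \<noteq> 0} \<subseteq> cbox (a + (1 / Suc n) *\<^sub>R One) (b - (1 / Suc n) *\<^sub>R One)"
  by (auto simp: box_bump_def mem_box inner_simps max_def split: if_splits)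

lemma box_bump_pos:
  assumes "x \<in> box a b"
  shows "\<exists>c>0. \<forall>\<^sub>F n in sequentially. c \<le> box_bump a b n x"
proof -
  have "(\<lambda>n. box_bump a b n x) \<longlonglongrightarrow>
     (\<Prod>i\<in>Basis. (max 0 (x \<bullet> i - (a \<bullet> i + 0)))\<^sup>2 * (max 0 (b \<bullet> i - 0 - x \<bullet> i))\<^sup>2)" (is "_ \<longlonglongrightarrow> ?L")
    unfolding box_bump_def
    by (intro tendsto_intros LIMSEQ_Suc[OF lim_1_over_n])
  moreover have "?L > 0"
    using assms by (intro prod_pos) (auto simp: mem_box)
  ultimately have "\<forall>\<^sub>F n in sequentially. ?L / 2 < box_bump a b n x"
    by (intro order_tendstoD) auto
  then show ?thesis
    using \<open>?L > 0\<close> by (intro exI[of _ "?L/2"]) (auto elim: eventually_mono)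
qed

text \<open>With \<open>w\<^sub>n\<close> the bump on the box shrunk by \<open>1/(n+1)\<close>, the functions \<open>n w\<^sub>n / (1 + n w\<^sub>n)\<close>
  take values in \<open>[0, 1]\<close> and tend to \<open>1\<close> wherever \<open>w\<^sub>n\<close> stays bounded away from \<open>0\<close>, that is, at
  every point of the open box.\<close>

lemma indicator_box_limit_of_C1c:
  fixes a b :: "'a::euclidean_space"
  assumes "box a b \<subseteq> \<Omega>"
  obtains \<phi> :: "nat \<Rightarrow> 'a \<Rightarrow> real" where "\<And>n. \<phi> n \<in> C1c \<Omega>" "\<And>n x. 0 \<le> \<phi> n x \<and> \<phi> n x \<le> 1"
    "\<And>x. (\<lambda>n. \<phi> n x) \<longlonglongrightarrow> indicat_real (box a b) x"
proof
  define \<phi> where "\<phi> n x = real n * box_bump a b n x / (1 + real n * box_bump a b n x)" for n x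
  show "0 \<le> \<phi> n x \<and> \<phi> n x \<le> 1" for n x
    using box_bump_nonneg[of a b n x] by (auto simp: \<phi>_def divide_simps not_less add_nonneg_nonneg)
  have "C1 (\<phi> n)" for n
  proof -
    have "C1 (\<lambda>x. (\<lambda>s. real n * s / (1 + real n * s)) (box_bump a b n x))"
      by (rule C1_compose_real[where h' = "\<lambda>s. (real n * (1 + real n * s) - real n * s * real n) / (1 + real n * s)\<^sup>2"])
        (auto intro!: derivative_eq_intros continuous_intros C1_box_bump
          simp: add_nonneg_eq_0_iff box_bump_nonneg power2_eq_square)
    then show ?thesis by (simp add: \<phi>_def[abs_def])
  qed
  moreover have sub: "closure {x. \<phi> n x \<noteq> 0} \<subseteq> cbox (a + (1 / Suc n) *\<^sub>R One) (b - (1 / Suc n) *\<^sub>R One)" for n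
    by (rule closure_minimal) (use box_bump_support[of a b n] in \<open>auto simp: \<phi>_def\<close>)
  moreover have "cbox (a + (1 / Suc n) *\<^sub>R One) (b - (1 / Suc n) *\<^sub>R One) \<subseteq> box a b" for n
  proof
    fix x assume x: "x \<in> cbox (a + (1 / Suc n) *\<^sub>R One) (b - (1 / Suc n) *\<^sub>R One)"
    have "a \<bullet> i < x \<bullet> i \<and> x \<bullet> i < b \<bullet> i" if "i \<in> Basis" for i
    proof -
      have "a \<bullet> i + 1 / Suc n \<le> x \<bullet> i" "x \<bullet> i \<le> b \<bullet> i - 1 / Suc n"
        using x that by (auto simp: mem_box inner_simps)
      moreover have "0 < 1 / real (Suc n)" by simp
      ultimately show ?thesis by linarith
    qed
    then show "x \<in> box a b" by (auto simp: mem_box)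
  qed
  ultimately have "C1 (\<phi> n)" "bounded (closure {x. \<phi> n x \<noteq> 0})" "closure {x. \<phi> n x \<noteq> 0} \<subseteq> \<Omega>" for n
    using assms by (blast intro: bounded_subset[OF bounded_cbox])+
  then show "\<phi> n \<in> C1c \<Omega>" for n
    unfolding C1c_def C1_def by (auto simp: compact_eq_bounded_closed)
  show "(\<lambda>n. \<phi> n x) \<longlonglongrightarrow> indicat_real (box a b) x" for x
  proof (cases "x \<in> box a b")
    case True
    then obtain c where "c > 0" and c: "\<forall>\<^sub>F n in sequentially. c \<le> box_bump a b n x"
      using box_bump_pos by blast
    have "(\<lambda>n. 1 - 1 / (1 + real n * c)) \<longlonglongrightarrow> 1"
      using \<open>c > 0\<close> by real_asymp
    moreover have "\<forall>\<^sub>F n in sequentially. 1 - 1 / (1 + real n * c) \<le> \<phi> n x"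
      using c
    proof eventually_elim
      case (elim n)
      have "\<phi> n x = 1 - 1 / (1 + real n * box_bump a b n x)"
        using box_bump_nonneg[of a b n x] by (auto simp: \<phi>_def divide_simps add_nonneg_eq_0_iff)
      moreover have "1 / (1 + real n * box_bump a b n x) \<le> 1 / (1 + real n * c)"
        using elim \<open>c > 0\<close> by (intro divide_left_mono mult_pos_pos add_mono mult_left_mono add_pos_nonneg) auto
      ultimately show ?case by simp
    qed
    moreover have "\<forall>\<^sub>F n in sequentially. \<phi> n x \<le> 1"
      using \<open>\<And>n x. 0 \<le> \<phi> n x \<and> \<phi> n x \<le> 1\<close> by simp
    ultimately show ?thesis
      using True tendsto_sandwich[of "\<lambda>n. 1 - 1 / (1 + real n * c)" "\<lambda>n. \<phi> n x" sequentially "\<lambda>_. 1" 1]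
      by simp
  next
    case False
    then have "box_bump a b n x = 0" for n
      using box_bump_support[of a b n]
        \<open>cbox (a + (1 / Suc n) *\<^sub>R One) (b - (1 / Suc n) *\<^sub>R One) \<subseteq> box a b\<close> by auto
    then show ?thesis using False by (simp add: \<phi>_def)
  qed
qed

lemma C1c_continuous: "\<phi> \<in> C1c \<Omega> \<Longrightarrow> continuous_on S \<phi>"
  by (intro C1_imp_continuous) (auto simp: C1c_def C1_def)

lemma C1c_continuous_deriv: "\<phi> \<in> C1c \<Omega> \<Longrightarrow> i \<in> Basis \<Longrightarrow> continuous_on S (\<lambda>x. frechet_derivative \<phi> (at x) i)"
  by (auto simp: C1c_def intro: continuous_on_subset)

lemma C1c_outside: "\<phi> \<in> C1c \<Omega> \<Longrightarrow> x \<notin> \<Omega> \<Longrightarrow> \<phi> x = 0"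
  using closure_subset[of "{x. \<phi> x \<noteq> 0}"] by (auto simp: C1c_def)

lemma C1c_imp_measurable: "\<phi> \<in> C1c \<Omega> \<Longrightarrow> \<phi> \<in> borel_measurable (lebesgue_on S)"
  by (intro measurable_restrict_space1 measurable_completion)
    (auto intro!: borel_measurable_continuous_onI C1_imp_continuous simp: C1c_def C1_def)

lemma C1c_bounded:
  assumes "\<phi> \<in> C1c \<Omega>"
  obtains K where "\<And>x. \<bar>\<phi> x\<bar> \<le> K" "K \<ge> 0"
proof -
  let ?S = "closure {x. \<phi> x \<noteq> 0}"
  have "compact (\<phi> ` ?S)"
    using assms by (intro compact_continuous_image C1_imp_continuous) (auto simp: C1c_def C1_def)
  then obtain K where K: "\<And>x. x \<in> ?S \<Longrightarrow> norm (\<phi> x) \<le> K"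
    by (meson compact_imp_bounded bounded_iff imageI)
  have "\<bar>\<phi> x\<bar> \<le> max K 0" for x
    using K[of x] closure_subset[of "{x. \<phi> x \<noteq> 0}"] by (cases "\<phi> x = 0") auto
  then show ?thesis using that[of "max K 0"] by auto
qed

text \<open>The sets over which the integral vanishes form a Dynkin system, and the open boxes are
  an intersection-stable generator of the Borel sets.\<close>

lemma AE_zero_if_box_integrals_zero:
  fixes w :: "'a::euclidean_space \<Rightarrow> real"
  assumes w: "integrable lborel w" and out: "\<And>x. x \<notin> box c d \<Longrightarrow> w x = 0"
    and box: "\<And>a b. box a b \<subseteq> box c d \<Longrightarrow> set_lebesgue_integral lborel (box a b) w = 0"
  shows "AE x in lborel. w x = 0"
proof -
  have box': "set_lebesgue_integral lborel (box a b) w = 0" for a b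
  proof -
    obtain a' b' where ab: "box a b \<inter> box c d = box a' b'"
      by (rule that[OF box_Int_box])
    have "set_lebesgue_integral lborel (box a b) w = set_lebesgue_integral lborel (box a b \<inter> box c d) w"
      unfolding set_lebesgue_integral_def
      by (rule Bochner_Integration.integral_cong) (auto simp: out indicator_def)
    also have "\<dots> = 0" unfolding ab using ab by (intro box) auto
    finally show ?thesis .
  qed
  have UN: "(\<integral>x. w x \<partial>lborel) = 0"
  proof -
    have "(\<integral>x. w x \<partial>lborel) = set_lebesgue_integral lborel (box c d) w"
      unfolding set_lebesgue_integral_def
      by (rule Bochner_Integration.integral_cong) (auto simp: out indicator_def)
    then show ?thesis using box' by simp
  qed
  have int: "set_integrable lborel A w" if "A \<in> sets lborel" for A
    using that w unfolding set_integrable_def by (intro integrable_mult_indicator)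
  have boxes: "Int_stable (range (\<lambda>(a::'a, b). box a b))" "range (\<lambda>(a::'a, b). box a b) \<subseteq> Pow UNIV"
    unfolding Int_stable_def by (force simp: box_Int_box)+
  have "set_lebesgue_integral lborel A w = 0" if "A \<in> sigma_sets UNIV (range (\<lambda>(a, b). box a b))" for A
    using boxes(1) boxes(2) that
  proof (induction A rule: sigma_sets_induct_disjoint)
    case (basic A) then show ?case using box' by auto
  next
    case (compl A)
    then have A: "A \<in> sets lborel" by (simp add: borel_eq_box sets_measure_of_conv)
    have "(\<integral>x. w x \<partial>lborel) = set_lebesgue_integral lborel (A \<union> (UNIV - A)) w"
      by (simp add: set_lebesgue_integral_def Un_absorb1)
    also have "\<dots> = set_lebesgue_integral lborel A w + set_lebesgue_integral lborel (UNIV - A) w"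
      using A by (intro set_integral_Un int) auto
    finally show ?case using compl UN by simp
  next
    case (union A)
    then have A: "A i \<in> sets lborel" for i by (auto simp: borel_eq_box sets_measure_of_conv)
    have "set_lebesgue_integral lborel (\<Union>i. A i) w = (\<Sum>i. set_lebesgue_integral lborel (A i) w)"
      using A union by (intro lebesgue_integral_countable_add int) (auto simp: disjoint_family_on_def)
    then show ?case using union by simp
  qed (auto simp: set_lebesgue_integral_def)
  then have "set_lebesgue_integral lborel A w = 0" if "A \<in> sets lborel" for A
    using that by (simp add: borel_eq_box sets_measure_of_conv)
  then show ?thesis
    by (rule sigma_finite_measure.density_zero[OF sigma_finite_lborel w])
qed

text \<open>Testing against functions that approximate the indicator of a box shows that all
  integrals over boxes vanish.\<close>

lemma fundamental_lemma:
  fixes w :: "'a::euclidean_space \<Rightarrow> real"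
  assumes w: "integrable (lebesgue_on (box c d)) w"
    and test: "\<And>\<phi>. \<phi> \<in> C1c (box c d) \<Longrightarrow> (\<integral>x. w x * \<phi> x \<partial>lebesgue_on (box c d)) = 0"
  shows "AE x in lebesgue_on (box c d). w x = 0"
proof -
  let ?M = "lebesgue_on (box c d)"
  have box: "(\<integral>x. w x * indicator (box a b) x \<partial>?M) = 0" if "box a b \<subseteq> box c d" for a b
  proof -
    obtain \<phi> :: "nat \<Rightarrow> 'a \<Rightarrow> real" where \<phi>: "\<And>n. \<phi> n \<in> C1c (box c d)" "\<And>n x. 0 \<le> \<phi> n x \<and> \<phi> n x \<le> 1"
      "\<And>x. (\<lambda>n. \<phi> n x) \<longlonglongrightarrow> indicat_real (box a b) x"
      using indicator_box_limit_of_C1c \<open>box a b \<subseteq> box c d\<close> by blast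
    have "(\<lambda>n. \<integral>x. w x * \<phi> n x \<partial>?M) \<longlonglongrightarrow> (\<integral>x. w x * indicator (box a b) x \<partial>?M)"
    proof (rule integral_dominated_convergence[where w = "\<lambda>x. \<bar>w x\<bar>"])
      have [measurable]: "w \<in> borel_measurable ?M" using w by auto
      have [measurable]: "indicat_real (box a b) \<in> borel_measurable ?M"
        by (intro measurable_restrict_space1 measurable_completion) auto
      show "(\<lambda>x. w x * indicator (box a b) x) \<in> borel_measurable ?M" by measurable
      show "(\<lambda>x. w x * \<phi> n x) \<in> borel_measurable ?M" for n
        by (intro borel_measurable_times C1c_imp_measurable[OF \<phi>(1)]) auto
      show "integrable ?M (\<lambda>x. \<bar>w x\<bar>)" using w by auto
      show "AE x in ?M. norm (w x * \<phi> n x) \<le> \<bar>w x\<bar>" for n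
        using \<phi>(2)[of n] by (auto simp: abs_mult intro!: mult_left_le)
    qed (auto intro!: tendsto_intros \<phi>(3))
    then show ?thesis using test[OF \<phi>(1)] by (simp add: LIMSEQ_const_iff)
  qed
  let ?f = "\<lambda>x. indicator (box c d) x * w x"
  have f: "integrable lebesgue ?f"
    using w by (subst (asm) integrable_restrict_space) auto
  then obtain v where v[measurable]: "v \<in> borel_measurable lborel" and ae: "AE x in lborel. ?f x = v x"
    using completion_ex_borel_measurable_real[of ?f lborel] by auto
  let ?v = "\<lambda>x. indicator (box c d) x * v x"
  have ae2: "AE x in lborel. ?f x = ?v x" using ae by eventually_elim (auto simp: indicator_def)
  have vm[measurable]: "?v \<in> borel_measurable lborel" by measurable
  have "integrable lebesgue ?v"
    by (rule integrable_cong_AE_imp[OF f])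
      (auto intro!: measurable_completion vm AE_completion intro: eventually_mono[OF ae2])
  then have vi: "integrable lborel ?v" using integrable_completion[OF vm] by simp
  have "AE x in lborel. ?v x = 0"
  proof (rule AE_zero_if_box_integrals_zero[OF vi, of c d])
    fix a b assume ab: "box a b \<subseteq> box c d"
    have "set_lebesgue_integral lborel (box a b) ?v = (\<integral>x. indicator (box a b) x * ?v x \<partial>lebesgue)"
      unfolding set_lebesgue_integral_def by (subst integral_completion) auto
    also have "\<dots> = (\<integral>x. indicator (box c d) x *\<^sub>R (w x * indicator (box a b) x) \<partial>lebesgue)"
    proof (rule integral_cong_AE)
      show "(\<lambda>x. indicator (box a b) x * ?v x) \<in> borel_measurable lebesgue"
        by (intro measurable_completion) auto
      have "(\<lambda>x. indicator (box a b) x * ?f x) \<in> borel_measurable lebesgue"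
        by (intro borel_measurable_times borel_measurable_integrable[OF f]) (auto intro!: measurable_completion)
      then show "(\<lambda>x. indicator (box c d) x *\<^sub>R (w x * indicator (box a b) x)) \<in> borel_measurable lebesgue"
        by (simp add: mult_ac)
      show "AE x in lebesgue. indicator (box a b) x * ?v x = indicator (box c d) x *\<^sub>R (w x * indicator (box a b) x)"
        by (rule AE_completion) (use ae2 in eventually_elim, auto)
    qed
    also have "\<dots> = (\<integral>x. w x * indicator (box a b) x \<partial>?M)"
      by (subst integral_restrict_space) auto
    finally show "set_lebesgue_integral lborel (box a b) ?v = 0" using box[OF ab] by simp
  qed auto
  with ae2 have "AE x in lborel. ?f x = 0" by eventually_elim auto
  then have "AE x in lebesgue. ?f x = 0" by (rule AE_completion)
  then show ?thesis
    by (subst AE_restrict_space_iff) (auto elim: eventually_mono simp: indicator_def)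
qed

section \<open>Absolutely continuous functions on an interval\<close>

text \<open>\<open>f\<close> is absolutely continuous with density \<open>g\<close>. Carrying the density along as a parameter is
  convenient because every density below is explicit. The defining equation at \<open>x\<close> mentions
  \<open>f a\<close> again and therefore loops as a rewrite rule.\<close>

definition AC_on :: "real \<Rightarrow> real \<Rightarrow> (real \<Rightarrow> real) \<Rightarrow> (real \<Rightarrow> real) \<Rightarrow> bool" where
  "AC_on a b f g \<longleftrightarrow> g absolutely_integrable_on {a..b} \<and>
     (\<forall>x\<in>{a..b}. f x = f a + integral {a..x} g)"

lemma AC_on_abs_integrable: "AC_on a b f g \<Longrightarrow> g absolutely_integrable_on {a..b}"
  by (simp add: AC_on_def)

lemma AC_on_eq: "AC_on a b f g \<Longrightarrow> a \<le> x \<Longrightarrow> x \<le> b \<Longrightarrow> f x = f a + integral {a..x} g"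
  by (simp only: AC_on_def) (blast intro: atLeastAtMost_iff[THEN iffD2])

lemma AC_on_integrable: "AC_on a b f g \<Longrightarrow> a \<le> x \<Longrightarrow> y \<le> b \<Longrightarrow> g integrable_on {x..y}"
  using integrable_on_subinterval[OF set_lebesgue_integral_eq_integral(1)[OF AC_on_abs_integrable], of a b f g x y]
  by auto

lemma AC_on_diff:
  assumes "AC_on a b f g" "a \<le> x" "x \<le> y" "y \<le> b"
  shows "f y - f x = integral {x..y} g"
proof -
  have "integral {a..x} g + integral {x..y} g = integral {a..y} g"
    using assms by (intro Henstock_Kurzweil_Integration.integral_combine AC_on_integrable[OF assms(1)]) auto
  moreover have "f x = f a + integral {a..x} g" "f y = f a + integral {a..y} g"
    using assms by (auto intro!: AC_on_eq[OF assms(1)])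
  ultimately show ?thesis by simp
qed

lemma AC_on_subinterval:
  assumes "AC_on a b f g" "a \<le> c" "d \<le> b"
  shows "AC_on c d f g"
  unfolding AC_on_def
proof (intro conjI ballI)
  show "g absolutely_integrable_on {c..d}"
    using assms by (intro absolutely_integrable_on_subinterval[OF AC_on_abs_integrable]) auto
  show "f x = f c + integral {c..x} g" if "x \<in> {c..d}" for x
    using AC_on_diff[OF assms(1), of c x] that assms by auto
qed

lemma AC_on_continuous:
  assumes "AC_on a b f g" shows "continuous_on {a..b} f"
proof -
  have "continuous_on {a..b} (\<lambda>x. f a + integral {a..x} g)"
    using AC_on_integrable[OF assms] by (intro continuous_intros indefinite_integral_continuous_1) auto
  then show ?thesis
    by (rule continuous_on_eq) (auto intro!: AC_on_eq[OF assms, symmetric])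
qed

lemma abs_integrable_mult_continuous:
  fixes f g :: "real \<Rightarrow> real"
  assumes "continuous_on {a..b} f" "g absolutely_integrable_on {a..b}"
  shows "(\<lambda>x. f x * g x) absolutely_integrable_on {a..b}"
  using assms
  by (intro absolutely_integrable_bounded_measurable_product_real continuous_imp_measurable_on_sets_lebesgue
      compact_imp_bounded compact_continuous_image) auto

lemma AC_onI_C1:
  assumes "\<And>x. x \<in> {a..b} \<Longrightarrow> (f has_real_derivative g x) (at x within {a..b})"
    and "continuous_on {a..b} g"
  shows "AC_on a b f g"
  unfolding AC_on_def
proof (intro conjI ballI)
  show "g absolutely_integrable_on {a..b}"
    using assms(2) by (rule absolutely_integrable_continuous_real)
  fix x assume x: "x \<in> {a..b}"
  have "(g has_integral (f x - f a)) {a..x}"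
    using x by (intro fundamental_theorem_of_calculus)
      (auto simp flip: has_real_derivative_iff_has_vector_derivative intro: DERIV_subset[OF assms(1)])
  then show "f x = f a + integral {a..x} g" by (simp add: integral_unique)
qed

lemma sigma_finite_lebesgue: "sigma_finite_measure (lebesgue :: 'a::euclidean_space measure)"
proof
  obtain A :: "'a set set" where A: "countable A" "A \<subseteq> sets lborel" "\<Union> A = space lborel"
    "\<forall>a\<in>A. emeasure lborel a \<noteq> \<infinity>"
    using sigma_finite_measure.sigma_finite_countable[OF sigma_finite_lborel] by blast
  have "emeasure lebesgue a = emeasure lborel a" if "a \<in> A" for a
    using A(2) that by (subst emeasure_completion) (auto intro: main_part)
  then show "\<exists>A::'a set set. countable A \<and> A \<subseteq> sets lebesgue \<and> \<Union> A = space lebesgue \<and> (\<forall>a\<in>A. emeasure lebesgue a \<noteq> \<infinity>)"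
    using A by (intro exI[of _ A]) auto
qed

text \<open>Both sides integrate \<open>u s * v r\<close> over the half plane \<open>r \<le> s\<close>.\<close>

lemma integral_triangle_Fubini:
  fixes u v :: "real \<Rightarrow> real"
  assumes u: "integrable lebesgue u" and v: "integrable lebesgue v"
  shows "(\<integral>s. u s * (\<integral>r. indicat_real {..s} r * v r \<partial>lebesgue) \<partial>lebesgue) =
     (\<integral>r. v r * (\<integral>s. indicat_real {r..} s * u s \<partial>lebesgue) \<partial>lebesgue)"
proof -
  interpret L: sigma_finite_measure "lebesgue :: real measure" by (rule sigma_finite_lebesgue)
  interpret pair_sigma_finite "lebesgue :: real measure" "lebesgue :: real measure" ..
  let ?f = "\<lambda>r s. u s * (indicat_real {..s} r * v r)"
  have [measurable]: "u \<in> borel_measurable lebesgue" "v \<in> borel_measurable lebesgue"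
    using u v by auto
  have [measurable]: "(\<lambda>x::real. x) \<in> borel_measurable lebesgue"
    by (rule measurable_completion) auto
  have ind: "indicat_real {..s} r = (if r \<le> s then 1 else 0)" for r s :: real by (simp add: indicator_def)
  have int: "integrable (lebesgue \<Otimes>\<^sub>M lebesgue) (case_prod ?f)"
  proof (rule Bochner_Integration.integrable_bound)
    show "integrable (lebesgue \<Otimes>\<^sub>M lebesgue) (\<lambda>(r, s). u s * v r)"
      by (rule Fubini_integrable) (use u v in \<open>auto simp: abs_mult intro!: integrable_mult_left integrable_mult_right integrable_abs\<close>)
    show "case_prod ?f \<in> borel_measurable (lebesgue \<Otimes>\<^sub>M lebesgue)"
      unfolding ind by measurable
  qed (auto simp: indicator_def)
  have "(\<integral>s. (\<integral>r. ?f r s \<partial>lebesgue) \<partial>lebesgue) = (\<integral>r. (\<integral>s. ?f r s \<partial>lebesgue) \<partial>lebesgue)"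
    by (rule Fubini_integral[OF int])
  also have "(\<lambda>r. \<integral>s. ?f r s \<partial>lebesgue) = (\<lambda>r. \<integral>s. v r * (indicat_real {r..} s * u s) \<partial>lebesgue)"
    by (intro ext Bochner_Integration.integral_cong) (auto simp: indicator_def)
  finally show ?thesis by simp
qed

lemma integral_indicator_eq_integral:
  fixes f :: "real \<Rightarrow> real"
  assumes "f absolutely_integrable_on S"
  shows "(\<integral>x. indicat_real S x * f x \<partial>lebesgue) = integral S f"
  using set_lebesgue_integral_eq_integral(2)[OF assms] by (simp add: set_lebesgue_integral_def)

text \<open>The square \<open>[a, b]\<^sup>2\<close> is the union of the triangles \<open>r \<le> s\<close> and \<open>s \<le> r\<close>, which overlap
  in a null set.\<close>

lemma integral_by_parts_indefinite:
  fixes u v :: "real \<Rightarrow> real"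
  assumes u: "u absolutely_integrable_on {a..b}" and v: "v absolutely_integrable_on {a..b}"
  shows "integral {a..b} (\<lambda>s. u s * integral {a..s} v) + integral {a..b} (\<lambda>s. v s * integral {a..s} u)
    = integral {a..b} u * integral {a..b} v"
proof -
  let ?u = "\<lambda>x. indicat_real {a..b} x * u x" and ?v = "\<lambda>x. indicat_real {a..b} x * v x"
  have ui: "integrable lebesgue ?u" and vi: "integrable lebesgue ?v"
    using u v by (auto simp: set_integrable_def)
  have sub: "w absolutely_integrable_on {x..y}" if "w absolutely_integrable_on {a..b}" "a \<le> x" "y \<le> b" for w :: "real \<Rightarrow> real" and x y
    using absolutely_integrable_on_subinterval[OF that(1)] that(2,3) by auto
  have cont: "continuous_on {a..b} (\<lambda>s. integral {a..s} w)" if "w absolutely_integrable_on {a..b}" for w :: "real \<Rightarrow> real"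
    using that by (intro indefinite_integral_continuous_1) (auto dest: set_lebesgue_integral_eq_integral)
  have ai: "(\<lambda>s. w s * integral {a..s} z) absolutely_integrable_on {a..b}"
    if "w absolutely_integrable_on {a..b}" "z absolutely_integrable_on {a..b}" for w z :: "real \<Rightarrow> real"
    using abs_integrable_mult_continuous[OF cont[OF that(2)] that(1)] by (simp add: mult.commute)
  have "integral {a..b} (\<lambda>s. u s * integral {a..s} v) = (\<integral>s. ?u s * (\<integral>r. indicat_real {..s} r * ?v r \<partial>lebesgue) \<partial>lebesgue)"
  proof -
    have eq: "indicat_real {a..b} s * (u s * integral {a..s} v) = ?u s * (\<integral>r. indicat_real {..s} r * ?v r \<partial>lebesgue)" for s
    proof (cases "s \<in> {a..b}")
      case True
      then have "(\<lambda>r. indicat_real {..s} r * ?v r) = (\<lambda>r. indicat_real {a..s} r * v r)"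
        by (auto simp: indicator_def)
      then show ?thesis using True sub[OF v, of a s] by (simp add: integral_indicator_eq_integral)
    qed auto
    show ?thesis
      by (subst integral_indicator_eq_integral[symmetric, OF ai[OF u v]]) (simp only: eq)
  qed
  also have "\<dots> = (\<integral>r. ?v r * (\<integral>s. indicat_real {r..} s * ?u s \<partial>lebesgue) \<partial>lebesgue)"
    by (rule integral_triangle_Fubini[OF ui vi])
  also have "\<dots> = integral {a..b} (\<lambda>r. v r * (integral {a..b} u - integral {a..r} u))"
  proof -
    have eq: "?v r * (\<integral>s. indicat_real {r..} s * ?u s \<partial>lebesgue) =
       indicat_real {a..b} r * (v r * (integral {a..b} u - integral {a..r} u))" for r
    proof (cases "r \<in> {a..b}")
      case True
      then have "(\<lambda>s. indicat_real {r..} s * ?u s) = (\<lambda>s. indicat_real {r..b} s * u s)"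
        by (auto simp: indicator_def)
      moreover have "integral {a..r} u + integral {r..b} u = integral {a..b} u"
        using True u by (intro Henstock_Kurzweil_Integration.integral_combine) (auto dest: set_lebesgue_integral_eq_integral)
      ultimately show ?thesis using True sub[OF u, of r b] by (simp add: integral_indicator_eq_integral)
    qed auto
    have "(\<lambda>r. v r * (integral {a..b} u - integral {a..r} u)) absolutely_integrable_on {a..b}"
      using abs_integrable_mult_continuous[OF continuous_on_diff[OF continuous_on_const cont[OF u]] v]
      by (simp add: mult.commute)
    then show ?thesis
      by (subst integral_indicator_eq_integral[symmetric]) (simp_all only: eq)
  qed
  also have "\<dots> = integral {a..b} v * integral {a..b} u - integral {a..b} (\<lambda>r. v r * integral {a..r} u)"
  proof -
    have "integral {a..b} (\<lambda>r. v r * integral {a..b} u - v r * integral {a..r} u) =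
      integral {a..b} (\<lambda>r. v r * integral {a..b} u) - integral {a..b} (\<lambda>r. v r * integral {a..r} u)"
      using v ai[OF v u]
      by (intro Henstock_Kurzweil_Integration.integral_diff integrable_on_mult_left)
        (auto dest: set_lebesgue_integral_eq_integral)
    then show ?thesis by (simp add: right_diff_distrib)
  qed
  finally show ?thesis by simp
qed

text \<open>Writing both factors as indefinite integrals reduces the product rule to integration by
  parts for indefinite integrals.\<close>

lemma AC_on_mult:
  assumes f: "AC_on a b f f'" and h: "AC_on a b h h'"
  shows "AC_on a b (\<lambda>x. f x * h x) (\<lambda>x. f' x * h x + f x * h' x)"
  unfolding AC_on_def
proof (intro conjI ballI)
  have "(\<lambda>x. h x * f' x) absolutely_integrable_on {a..b}" "(\<lambda>x. f x * h' x) absolutely_integrable_on {a..b}"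
    by (intro abs_integrable_mult_continuous AC_on_continuous[OF f] AC_on_continuous[OF h]
        AC_on_abs_integrable[OF f] AC_on_abs_integrable[OF h])+
  then show "(\<lambda>x. f' x * h x + f x * h' x) absolutely_integrable_on {a..b}"
    by (intro set_integral_add) (auto simp: mult.commute)
  fix c assume c: "c \<in> {a..b}"
  have f: "AC_on a c f f'" and h: "AC_on a c h h'" using AC_on_subinterval f h c by auto
  note fa = AC_on_abs_integrable[OF f] and ha = AC_on_abs_integrable[OF h]
  have cont: "continuous_on {a..c} (\<lambda>s. integral {a..s} w)" if "w absolutely_integrable_on {a..c}" for w :: "real \<Rightarrow> real"
    using that by (intro indefinite_integral_continuous_1) (auto dest: set_lebesgue_integral_eq_integral)
  have ai: "(\<lambda>s. w s * integral {a..s} z) integrable_on {a..c}"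
    if "w absolutely_integrable_on {a..c}" "z absolutely_integrable_on {a..c}" for w z :: "real \<Rightarrow> real"
    using abs_integrable_mult_continuous[OF cont[OF that(2)] that(1)]
    by (auto simp: mult.commute dest: set_lebesgue_integral_eq_integral)
  have int: "f' integrable_on {a..c}" "h' integrable_on {a..c}"
    using fa ha by (auto dest: set_lebesgue_integral_eq_integral)
  have "integral {a..c} (\<lambda>x. f' x * h x + f x * h' x) =
     integral {a..c} (\<lambda>x. h a * f' x + f a * h' x + (f' x * integral {a..x} h' + h' x * integral {a..x} f'))"
  proof (rule Henstock_Kurzweil_Integration.integral_cong)
    fix x assume "x \<in> {a..c}"
    then have "f x = f a + integral {a..x} f'" "h x = h a + integral {a..x} h'"
      by (auto intro!: AC_on_eq[OF f] AC_on_eq[OF h])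
    then show "f' x * h x + f x * h' x = h a * f' x + f a * h' x + (f' x * integral {a..x} h' + h' x * integral {a..x} f')"
      by (simp add: algebra_simps)
  qed
  also have "\<dots> = h a * integral {a..c} f' + f a * integral {a..c} h' +
      (integral {a..c} (\<lambda>x. f' x * integral {a..x} h') + integral {a..c} (\<lambda>x. h' x * integral {a..x} f'))"
    using int ai[OF fa ha] ai[OF ha fa]
    by (simp add: Henstock_Kurzweil_Integration.integral_add integrable_add integrable_on_mult_right)
  also have "\<dots> = h a * integral {a..c} f' + f a * integral {a..c} h' + integral {a..c} f' * integral {a..c} h'"
    by (simp add: integral_by_parts_indefinite[OF fa ha])
  finally show "f c * h c = f a * h a + integral {a..c} (\<lambda>x. f' x * h x + f x * h' x)"
    using AC_on_eq[OF f, of c] AC_on_eq[OF h, of c] c by (simp add: algebra_simps)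
qed

lemma AC_on_const: "AC_on a b (\<lambda>_. c) (\<lambda>_. 0)"
  by (rule AC_onI_C1) auto

lemma AC_on_cmult: "AC_on a b f g \<Longrightarrow> AC_on a b (\<lambda>x. c * f x) (\<lambda>x. c * g x)"
  using AC_on_mult[OF AC_on_const[of a b c]] by simp

lemma AC_on_add:
  assumes "AC_on a b f f'" "AC_on a b h h'"
  shows "AC_on a b (\<lambda>x. f x + h x) (\<lambda>x. f' x + h' x)"
  unfolding AC_on_def
proof (intro conjI ballI)
  show "(\<lambda>x. f' x + h' x) absolutely_integrable_on {a..b}"
    using assms by (intro set_integral_add AC_on_abs_integrable)
  fix x assume x: "x \<in> {a..b}"
  then have "integral {a..x} (\<lambda>x. f' x + h' x) = integral {a..x} f' + integral {a..x} h'"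
    using AC_on_integrable assms by (intro Henstock_Kurzweil_Integration.integral_add) auto
  then show "f x + h x = f a + h a + integral {a..x} (\<lambda>x. f' x + h' x)"
    using AC_on_eq[OF assms(1), of x] AC_on_eq[OF assms(2), of x] x by auto
qed

lemma AC_on_minus:
  assumes "AC_on a b f f'" "AC_on a b h h'"
  shows "AC_on a b (\<lambda>x. f x - h x) (\<lambda>x. f' x - h' x)"
  using AC_on_add[OF assms(1) AC_on_cmult[OF assms(2), of "-1"]] by simp

lemma AC_onI_integral:
  assumes "g absolutely_integrable_on {a..b}"
  shows "AC_on a b (\<lambda>x. c + integral {a..x} g) g"
  using assms by (auto simp: AC_on_def)

lemma AC_on_cong:
  assumes "AC_on a b f g" "\<And>x. x \<in> {a..b} \<Longrightarrow> f x = f' x" "a \<le> b"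
  shows "AC_on a b f' g"
  using assms unfolding AC_on_def by (metis atLeastAtMost_iff order_refl)

lemma lebesgue_on_Ioo_integral:
  fixes f :: "real \<Rightarrow> real"
  assumes "integrable (lebesgue_on {a<..<b}) f"
  shows "(\<integral>x. f x \<partial>lebesgue_on {a<..<b}) = integral {a..b} f"
  using lebesgue_integral_eq_integral[OF assms] by (simp add: integral_open_interval_real)

lemma integrable_lebesgue_on_Ioo_iff:
  fixes f :: "real \<Rightarrow> real"
  shows "integrable (lebesgue_on {a<..<b}) f \<longleftrightarrow> f absolutely_integrable_on {a..b}"
  unfolding absolutely_integrable_on_Icc_iff_Ioo
  by (simp add: integrable_restrict_space set_integrable_def)

lemma AE_lebesgue_on_Ioo_imp_integral_eq:
  fixes f g :: "real \<Rightarrow> real"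
  assumes "AE x in lebesgue_on {a<..<b}. f x = g x" "a \<le> c" "d \<le> b"
  shows "integral {c..d} f = integral {c..d} g"
proof -
  have "AE x in lebesgue. x \<in> {a<..<b} \<longrightarrow> f x = g x"
    using assms(1) by (subst (asm) AE_restrict_space_iff) auto
  then obtain S where "S \<in> null_sets lebesgue" "\<And>x. x \<in> space lebesgue - S \<Longrightarrow> x \<in> {a<..<b} \<longrightarrow> f x = g x"
    by (elim AE_E3) blast
  then have S: "negligible S" "\<And>x. x \<notin> S \<Longrightarrow> x \<in> {a<..<b} \<Longrightarrow> f x = g x"
    by (auto simp: negligible_iff_null_sets)
  show ?thesis
    by (rule integral_spike[of "S \<union> {a, b}"]) (use S assms in \<open>force\<close>)+
qed

lemma C1c_real:
  fixes \<phi> :: "real \<Rightarrow> real"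
  assumes "\<phi> \<in> C1c \<Omega>"
  shows "(\<phi> has_real_derivative frechet_derivative \<phi> (at x) 1) (at x)"
    and "continuous_on S (\<lambda>x. frechet_derivative \<phi> (at x) 1)"
proof -
  show "(\<phi> has_real_derivative frechet_derivative \<phi> (at x) 1) (at x)"
  proof -
    obtain D where D: "(\<phi> has_real_derivative D) (at x)"
      using assms by (auto simp: C1c_def real_differentiable_def)
    then have "(*) D = frechet_derivative \<phi> (at x)"
      by (intro frechet_derivative_at) (simp add: has_field_derivative_def)
    from fun_cong[OF this, of 1] D show ?thesis by simp
  qed
  show "continuous_on S (\<lambda>x. frechet_derivative \<phi> (at x) 1)"
    using assms by (auto simp: C1c_def intro: continuous_on_subset)
qed

text \<open>The product rule with a test function, whose boundary values vanish.\<close>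

lemma AC_on_imp_weak_deriv:
  assumes f: "AC_on a b f g" and "a < b"
  shows "has_weak_deriv {a<..<b} 1 f g"
  unfolding has_weak_deriv_def
proof (intro conjI ballI)
  show fi: "integrable (lebesgue_on {a<..<b}) f"
    by (simp add: integrable_lebesgue_on_Ioo_iff absolutely_integrable_continuous_real AC_on_continuous[OF f])
  show "integrable (lebesgue_on {a<..<b}) g"
    by (simp add: integrable_lebesgue_on_Ioo_iff AC_on_abs_integrable[OF f])
  fix \<phi> :: "real \<Rightarrow> real" assume \<phi>: "\<phi> \<in> C1c {a<..<b}"
  let ?d = "\<lambda>x. frechet_derivative \<phi> (at x) 1"
  have "AC_on a b \<phi> ?d"
    using \<phi> by (intro AC_onI_C1) (auto intro: C1c_real DERIV_subset)
  note m = AC_on_mult[OF f this]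
  have 1: "(\<lambda>x. g x * \<phi> x) absolutely_integrable_on {a..b}"
    using abs_integrable_mult_continuous[OF _ AC_on_abs_integrable[OF f], of \<phi>] AC_on_continuous[OF \<open>AC_on a b \<phi> ?d\<close>]
    by (simp add: mult.commute)
  have 2: "(\<lambda>x. f x * ?d x) absolutely_integrable_on {a..b}"
    by (intro absolutely_integrable_continuous_real continuous_intros AC_on_continuous[OF f] C1c_real[OF \<phi>])
  have "f b * \<phi> b = f a * \<phi> a + integral {a..b} (\<lambda>x. g x * \<phi> x + f x * ?d x)"
    using AC_on_eq[OF m, of b] \<open>a < b\<close> by auto
  also have "integral {a..b} (\<lambda>x. g x * \<phi> x + f x * ?d x) = integral {a..b} (\<lambda>x. g x * \<phi> x) + integral {a..b} (\<lambda>x. f x * ?d x)"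
    using 1 2 by (intro Henstock_Kurzweil_Integration.integral_add) (auto dest: set_lebesgue_integral_eq_integral)
  finally have "integral {a..b} (\<lambda>x. f x * ?d x) = - integral {a..b} (\<lambda>x. g x * \<phi> x)"
    by (simp add: C1c_outside[OF \<phi>])
  then show "(\<integral>x. f x * ?d x \<partial>lebesgue_on {a<..<b}) = - (\<integral>x. g x * \<phi> x \<partial>lebesgue_on {a<..<b})"
    using 1 2 by (simp add: lebesgue_on_Ioo_integral integrable_lebesgue_on_Ioo_iff)
qed

lemma integrable_mult_C1c:
  assumes "integrable (lebesgue_on S) w" "\<phi> \<in> C1c \<Omega>"
  shows "integrable (lebesgue_on S) (\<lambda>x. w x * \<phi> x)"
proof -
  obtain K where K: "\<And>x. \<bar>\<phi> x\<bar> \<le> K" "K \<ge> 0" using C1c_bounded[OF assms(2)] by blast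
  show ?thesis
  proof (rule Bochner_Integration.integrable_bound)
    show "integrable (lebesgue_on S) (\<lambda>x. w x * K)" using assms(1) by auto
    show "AE x in lebesgue_on S. norm (w x * \<phi> x) \<le> norm (w x * K)"
      using K by (auto simp: abs_mult intro!: mult_left_mono)
    show "(\<lambda>x. w x * \<phi> x) \<in> borel_measurable (lebesgue_on S)"
      using assms C1c_imp_measurable by (intro borel_measurable_times) auto
  qed
qed

lemma weak_deriv_unique:
  fixes f :: "'a::euclidean_space \<Rightarrow> real"
  assumes g: "has_weak_deriv (box a b) i f g" and h: "has_weak_deriv (box a b) i f h"
  shows "AE x in lebesgue_on (box a b). g x = h x"
proof -
  have "AE x in lebesgue_on (box a b). g x - h x = 0"
  proof (rule fundamental_lemma)
    show "integrable (lebesgue_on (box a b)) (\<lambda>x. g x - h x)"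
      using g h by (auto simp: has_weak_deriv_def)
    fix \<phi> assume \<phi>: "\<phi> \<in> C1c (box a b)"
    have "(\<integral>x. (g x - h x) * \<phi> x \<partial>lebesgue_on (box a b)) =
       (\<integral>x. g x * \<phi> x \<partial>lebesgue_on (box a b)) - (\<integral>x. h x * \<phi> x \<partial>lebesgue_on (box a b))"
      unfolding left_diff_distrib
      using g h \<phi> by (intro Bochner_Integration.integral_diff integrable_mult_C1c) (auto simp: has_weak_deriv_def)
    also have "\<dots> = 0"
      using g h \<phi> unfolding has_weak_deriv_def by force
    finally show "(\<integral>x. (g x - h x) * \<phi> x \<partial>lebesgue_on (box a b)) = 0" .
  qed
  then show ?thesis by eventually_elim simp
qed

text \<open>The zero set is closed, so that it contains an open box as soon as it contains almost
  every point of it, and then also the closure of the box.\<close>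

lemma continuous_AE_zero_imp_zero:
  fixes h :: "'a::euclidean_space \<Rightarrow> real"
  assumes cont: "continuous_on (cbox a b) h" and ae: "AE x in lebesgue_on (box a b). h x = 0"
    and "box a b \<noteq> {}" and "x \<in> cbox a b"
  shows "h x = 0"
proof -
  let ?C = "cbox a b \<inter> h -` {0}"
  have C: "closed ?C"
    by (rule continuous_closed_preimage[OF cont]) auto
  have "AE x \<in> box a b in lebesgue. x \<in> ?C"
    using ae by (subst (asm) AE_restrict_space_iff) (auto elim!: eventually_mono intro: subsetD[OF box_subset_cbox])
  then have "box a b \<subseteq> ?C"
    using mem_closed_if_AE_lebesgue_open[OF open_box C] by blast
  then have "closure (box a b) \<subseteq> ?C" using C by (rule closure_minimal)
  then show ?thesis using assms(3,4) by (auto simp: closure_box)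
qed

lemma continuous_AE_eq_imp_eq:
  fixes f h :: "real \<Rightarrow> real"
  assumes "continuous_on {a..b} f" "continuous_on {a..b} h" "a < b"
    and "AE x in lebesgue_on {a<..<b}. f x = h x" "x \<in> {a..b}"
  shows "f x = h x"
  using continuous_AE_zero_imp_zero[of a b "\<lambda>x. f x - h x" x, unfolded box_real] assms
  by (auto intro!: continuous_intros)

section \<open>Weak derivatives in one variable\<close>

text \<open>A primitive that vanishes to the left of the support of \<open>\<psi>\<close> is constant to the right of
  it, with value the integral of \<open>\<psi>\<close>.\<close>

lemma C1c_primitive:
  fixes \<psi> :: "real \<Rightarrow> real"
  assumes \<psi>: "\<psi> \<in> C1c {a<..<b}" and int: "integral {a..b} \<psi> = 0" and "a < b"
  obtains \<Phi> where "\<Phi> \<in> C1c {a<..<b}" "\<And>x. frechet_derivative \<Phi> (at x) 1 = \<psi> x"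
proof -
  let ?S = "closure {x. \<psi> x \<noteq> 0}"
  have S: "compact ?S" "?S \<subseteq> {a<..<b}" using \<psi> by (auto simp: C1c_def)
  obtain c d where cd: "a < c" "c \<le> d" "d < b" "?S \<subseteq> {c..d}"
  proof (cases "?S = {}")
    case True then show ?thesis using that[of "(a + b) / 2" "(a + b) / 2"] \<open>a < b\<close> by auto
  next
    case False
    obtain c where "c \<in> ?S" "\<forall>x\<in>?S. c \<le> x"
      using compact_attains_inf[OF S(1) False] by blast
    moreover obtain d where "d \<in> ?S" "\<forall>x\<in>?S. x \<le> d"
      using compact_attains_sup[OF S(1) False] by blast
    ultimately have cd: "?S \<subseteq> {c..d}" "c \<in> ?S" "d \<in> ?S" by auto
    then have "a < c" "c \<le> d" "d < b" using subsetD[OF S(2)] by auto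
    then show ?thesis using that cd(1) by blast
  qed
  have out: "\<psi> x = 0" if "x \<notin> {c..d}" for x
    using that cd(4) closure_subset[of "{x. \<psi> x \<noteq> 0}"] by auto
  have cont: "continuous_on UNIV \<psi>"
    using \<psi> by (intro C1_imp_continuous) (auto simp: C1c_def C1_def)
  then obtain F where F: "\<And>x. (F has_real_derivative \<psi> x) (at x)"
    using einterval_antiderivative[of "-\<infinity>" "\<infinity>" \<psi>]
    by (auto simp: has_real_derivative_iff_has_vector_derivative continuous_on_eq_continuous_at)
  define \<Phi> where "\<Phi> x = F x - F a" for x
  have D: "(\<Phi> has_real_derivative \<psi> x) (at x)" for x
    unfolding \<Phi>_def by (auto intro!: derivative_eq_intros F)
  have "(\<psi> has_integral (F b - F a)) {a..b}"
    using \<open>a < b\<close> by (intro fundamental_theorem_of_calculus)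
      (auto simp flip: has_real_derivative_iff_has_vector_derivative intro: has_field_derivative_at_within F)
  then have Fb: "F b = F a" using int by (simp add: integral_unique)
  have z: "\<Phi> x = 0" if x: "x \<notin> {c..d}" for x
  proof -
    consider "x < c" | "x > d" using x by fastforce
    moreover have D': "(\<Phi> has_real_derivative 0) (at y within A)" if "y \<notin> {c..d}" for y A
      using D[of y] out[OF that] by (auto intro: has_field_derivative_at_within)
    ultimately show ?thesis
    proof cases
      case 1
      have "\<exists>k. \<forall>x\<in>{..<c}. \<Phi> x = k"
        by (rule has_field_derivative_zero_constant) (use D' in auto)
      then have "\<Phi> x = \<Phi> a" using 1 cd by auto
      then show ?thesis by (simp add: \<Phi>_def)
    next
      case 2
      have "\<exists>k. \<forall>x\<in>{d<..}. \<Phi> x = k"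
        by (rule has_field_derivative_zero_constant) (use D' in auto)
      then have "\<Phi> x = \<Phi> b" using 2 cd by auto
      then show ?thesis by (simp add: \<Phi>_def Fb)
    qed
  qed
  have fd: "frechet_derivative \<Phi> (at x) = (*) (\<psi> x)" for x
    using frechet_derivative_at[of \<Phi> "(*) (\<psi> x)" x] D[of x] by (simp add: has_field_derivative_def)
  have "closure {x. \<Phi> x \<noteq> 0} \<subseteq> {c..d}"
    by (rule closure_minimal) (use z in blast, simp)
  moreover from this have "compact (closure {x. \<Phi> x \<noteq> 0})"
    using bounded_subset[OF bounded_closed_interval[of c d]] by (simp add: compact_eq_bounded_closed)
  ultimately have "\<Phi> \<in> C1c {a<..<b}"
    using cd D cont unfolding C1c_def by (auto simp: real_differentiable_def fd)
  then show ?thesis using that fd by simp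
qed

lemma C1c_lincomb:
  assumes "f \<in> C1c \<Omega>" "g \<in> C1c \<Omega>" shows "(\<lambda>x. f x - c * g x) \<in> C1c \<Omega>"
proof -
  have C: "C1 f" "C1 g" using assms by (auto simp: C1c_def C1_def)
  have "C1 (\<lambda>x. f x - c * g x)"
  proof (rule C1I)
    show "((\<lambda>x. f x - c * g x) has_derivative
        (\<lambda>h. frechet_derivative f (at x) h - c * frechet_derivative g (at x) h)) (at x)" for x
      by (intro derivative_intros C1_has_derivative C)
    show "continuous_on UNIV (\<lambda>x. frechet_derivative f (at x) i - c * frechet_derivative g (at x) i)" if "i \<in> Basis" for i
      using C that by (auto simp: C1_def intro!: continuous_intros)
  qed
  moreover have "closure {x. f x - c * g x \<noteq> 0} \<subseteq> closure {x. f x \<noteq> 0} \<union> closure {x. g x \<noteq> 0}"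
    by (subst closure_Un[symmetric]) (rule closure_mono, auto)
  moreover from this have "compact (closure {x. f x - c * g x \<noteq> 0})"
    using assms unfolding C1c_def compact_eq_bounded_closed
    by (intro conjI closed_closure) (rule bounded_subset, rule bounded_Un[THEN iffD2], auto)
  ultimately show ?thesis
    using assms by (auto simp: C1c_def C1_def)
qed

text \<open>The argument of du Bois-Reymond: for a test function \<open>\<theta>\<close> of nonzero integral, every test
  function is the sum of a multiple of \<open>\<theta>\<close> and the derivative of a test function, and \<open>u\<close>
  annihilates the latter. Hence \<open>u\<close> minus a suitable constant annihilates all test functions.\<close>

lemma weak_deriv_zero_imp_const:
  fixes u :: "real \<Rightarrow> real"
  assumes u: "has_weak_deriv {a<..<b} 1 u (\<lambda>_. 0)" and "a < b"
  shows "\<exists>c. AE x in lebesgue_on {a<..<b}. u x = c"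
proof -
  let ?M = "lebesgue_on {a<..<b}"
  have ui: "integrable ?M u" using u by (simp add: has_weak_deriv_def)
  have one: "integrable ?M (\<lambda>x. 1::real)"
    by (simp add: integrable_lebesgue_on_Ioo_iff absolutely_integrable_continuous_real)
  \<comment> \<open>If all test functions had integral \<open>0\<close>, the fundamental lemma would give \<open>1 = 0\<close>.\<close>
  obtain \<theta> where \<theta>: "\<theta> \<in> C1c {a<..<b}" "(\<integral>x. \<theta> x \<partial>?M) \<noteq> 0"
  proof (rule ccontr)
    assume "\<not> thesis"
    then have "AE x in lebesgue_on (box a b). (1::real) = 0"
      using that one by (intro fundamental_lemma) auto
    from continuous_AE_zero_imp_zero[OF continuous_on_const this, of a] \<open>a < b\<close> show False by simp
  qed
  let ?i = "\<integral>x. \<theta> x \<partial>?M"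
  define c where "c = (\<integral>x. u x * \<theta> x \<partial>?M) / ?i"
  have "AE x in lebesgue_on (box a b). u x - c = 0"
  proof (rule fundamental_lemma)
    show "integrable (lebesgue_on (box a b)) (\<lambda>x. u x - c)"
      using ui integrable_mult_right[OF one, of c] by simp
    fix \<phi> :: "real \<Rightarrow> real" assume "\<phi> \<in> C1c (box a b)"
    then have \<phi>: "\<phi> \<in> C1c {a<..<b}" by simp
    let ?k = "(\<integral>x. \<phi> x \<partial>?M) / ?i"
    have pi: "integrable ?M \<phi>" "integrable ?M \<theta>"
      using integrable_mult_C1c[OF one \<phi>] integrable_mult_C1c[OF one \<theta>(1)] by simp_all
    note upi = integrable_mult_C1c[OF ui \<phi>] integrable_mult_C1c[OF ui \<theta>(1)]
    define \<psi> where "\<psi> x = \<phi> x - ?k * \<theta> x" for x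
    have \<psi>: "\<psi> \<in> C1c {a<..<b}" unfolding \<psi>_def by (rule C1c_lincomb[OF \<phi> \<theta>(1)])
    have "(\<integral>x. \<psi> x \<partial>?M) = 0"
      using pi \<theta>(2) by (simp add: \<psi>_def)
    moreover have "integrable ?M \<psi>" using pi unfolding \<psi>_def by auto
    ultimately have "integral {a..b} \<psi> = 0" by (simp add: lebesgue_on_Ioo_integral)
    then obtain \<Phi> where \<Phi>: "\<Phi> \<in> C1c {a<..<b}" "\<And>x. frechet_derivative \<Phi> (at x) 1 = \<psi> x"
      using C1c_primitive[OF \<psi> _ \<open>a < b\<close>] by blast
    have "(\<integral>x. u x * \<psi> x \<partial>?M) = 0"
      using u \<Phi> by (force simp: has_weak_deriv_def)
    moreover have "(\<integral>x. u x * \<psi> x \<partial>?M) = (\<integral>x. u x * \<phi> x - ?k * (u x * \<theta> x) \<partial>?M)"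
      by (simp add: \<psi>_def algebra_simps)
    ultimately have "(\<integral>x. u x * \<phi> x \<partial>?M) = ?k * (\<integral>x. u x * \<theta> x \<partial>?M)"
      using upi by simp
    then show "(\<integral>x. (u x - c) * \<phi> x \<partial>lebesgue_on (box a b)) = 0"
      using upi pi by (simp add: left_diff_distrib c_def)
  qed
  then have "AE x in lebesgue_on {a<..<b}. u x - c = 0" unfolding box_real .
  then have "AE x in lebesgue_on {a<..<b}. u x = c" by eventually_elim simp
  then show ?thesis ..
qed

lemma has_weak_deriv_diff:
  fixes f :: "'a::euclidean_space \<Rightarrow> real"
  assumes f: "has_weak_deriv \<Omega> i f f'" and g: "has_weak_deriv \<Omega> i g g'" and i: "i \<in> Basis"
  shows "has_weak_deriv \<Omega> i (\<lambda>x. f x - g x) (\<lambda>x. f' x - g' x)"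
  unfolding has_weak_deriv_def
proof (intro conjI ballI)
  show "integrable (lebesgue_on \<Omega>) (\<lambda>x. f x - g x)" "integrable (lebesgue_on \<Omega>) (\<lambda>x. f' x - g' x)"
    using f g by (auto simp: has_weak_deriv_def)
  fix \<phi> :: "'a \<Rightarrow> real" assume \<phi>: "\<phi> \<in> C1c \<Omega>"
  let ?d = "\<lambda>x. frechet_derivative \<phi> (at x) i"
  have dint: "integrable (lebesgue_on \<Omega>) (\<lambda>x. w x * ?d x)" if w: "integrable (lebesgue_on \<Omega>) w" for w
  proof -
    have c: "continuous_on UNIV ?d" using \<phi> i by (auto simp: C1c_def)
    let ?S = "closure {x. \<phi> x \<noteq> 0}"
    have "compact (?d ` ?S)"
      using \<phi> by (intro compact_continuous_image continuous_on_subset[OF c]) (auto simp: C1c_def)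
    then obtain K where K: "\<And>x. x \<in> ?S \<Longrightarrow> norm (?d x) \<le> K"
      by (meson compact_imp_bounded bounded_iff imageI)
    have z: "?d x = 0" if "x \<notin> ?S" for x
    proof -
      have "(\<phi> has_derivative (\<lambda>_. 0)) (at x)"
        by (rule has_derivative_transform_within_open[of "\<lambda>_. 0" _ _ _ "- ?S"])
          (use that closure_subset[of "{x. \<phi> x \<noteq> 0}"] in auto)
      from frechet_derivative_at[OF this] show ?thesis by metis
    qed
    have b: "\<bar>?d x\<bar> \<le> max K 0" for x
      using K[of x] z[of x] by (cases "x \<in> ?S") auto
    show ?thesis
    proof (rule Bochner_Integration.integrable_bound)
      show "integrable (lebesgue_on \<Omega>) (\<lambda>x. w x * max K 0)" using w by auto
      show "AE x in lebesgue_on \<Omega>. norm (w x * ?d x) \<le> norm (w x * max K 0)"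
        using b by (auto simp: abs_mult intro!: mult_left_mono)
      have "?d \<in> borel_measurable (lebesgue_on \<Omega>)"
        by (intro measurable_restrict_space1 measurable_completion) (use c in \<open>simp add: borel_measurable_continuous_onI\<close>)
      then show "(\<lambda>x. w x * ?d x) \<in> borel_measurable (lebesgue_on \<Omega>)"
        using w by (intro borel_measurable_times) auto
    qed
  qed
  show "(\<integral>x. (f x - g x) * ?d x \<partial>lebesgue_on \<Omega>) = - (\<integral>x. (f' x - g' x) * \<phi> x \<partial>lebesgue_on \<Omega>)"
    unfolding left_diff_distrib
    using f g \<phi> by (subst (1 2) Bochner_Integration.integral_diff)
      (auto simp: has_weak_deriv_def intro!: dint integrable_mult_C1c)
qed

text \<open>\<open>f\<close> and the primitive of \<open>g\<close> have the same weak derivative, hence differ by a constant.\<close>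

lemma has_weak_deriv_imp_AC:
  fixes f g :: "real \<Rightarrow> real"
  assumes fg: "has_weak_deriv {a<..<b} 1 f g" and "a < b"
  obtains h where "AC_on a b h g" "AE x in lebesgue_on {a<..<b}. f x = h x"
proof -
  have g: "g absolutely_integrable_on {a..b}"
    using fg by (simp add: has_weak_deriv_def integrable_lebesgue_on_Ioo_iff)
  let ?G = "\<lambda>x. integral {a..x} g"
  have "AC_on a b (\<lambda>x. 0 + ?G x) g" by (rule AC_onI_integral[OF g])
  then have "has_weak_deriv {a<..<b} 1 ?G g" using \<open>a < b\<close> by (simp add: AC_on_imp_weak_deriv)
  from has_weak_deriv_diff[OF fg this]
  have "has_weak_deriv {a<..<b} 1 (\<lambda>x. f x - ?G x) (\<lambda>_. 0)" by simp
  then obtain c where "AE x in lebesgue_on {a<..<b}. f x - ?G x = c"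
    using weak_deriv_zero_imp_const \<open>a < b\<close> by blast
  then have "AE x in lebesgue_on {a<..<b}. f x = c + ?G x"
    by eventually_elim (simp add: algebra_simps)
  then show ?thesis by (intro that[OF AC_onI_integral[OF g]])
qed

lemma has_weak_deriv_continuous_imp_AC:
  fixes f g :: "real \<Rightarrow> real"
  assumes fg: "has_weak_deriv {a<..<b} 1 f g" and "a < b" and "continuous_on {a..b} f"
  shows "AC_on a b f g"
proof -
  obtain h where h: "AC_on a b h g" "AE x in lebesgue_on {a<..<b}. f x = h x"
    using has_weak_deriv_imp_AC[OF assms(1,2)] .
  show ?thesis
    by (rule AC_on_cong[OF h(1)]) (use continuous_AE_eq_imp_eq[OF assms(3) AC_on_continuous[OF h(1)] assms(2) h(2)] assms(2) in auto)
qed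

lemma has_weak_deriv_weak_deriv:
  "has_weak_deriv I 1 f g \<Longrightarrow> has_weak_deriv I 1 f (weak_deriv I f)"
  unfolding weak_deriv_def by (rule someI[of "has_weak_deriv I 1 f"])

lemma weak_deriv_AE_eq:
  fixes f :: "real \<Rightarrow> real"
  assumes "has_weak_deriv {a<..<b} 1 f g"
  shows "AE x in lebesgue_on {a<..<b}. weak_deriv {a<..<b} f x = g x"
  using weak_deriv_unique[of a b 1 f "weak_deriv {a<..<b} f" g, unfolded box_real] has_weak_deriv_weak_deriv[OF assms] assms by blast

lemma has_weak_deriv_cong_AE:
  fixes f :: "'a::euclidean_space \<Rightarrow> real"
  assumes f: "has_weak_deriv \<Omega> i f g" and ae: "AE x in lebesgue_on \<Omega>. f x = f' x"
    and m: "f' \<in> borel_measurable (lebesgue_on \<Omega>)" and i: "i \<in> Basis"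
  shows "has_weak_deriv \<Omega> i f' g"
  unfolding has_weak_deriv_def
proof (intro conjI ballI)
  show "integrable (lebesgue_on \<Omega>) f'"
    using f m ae by (auto simp: has_weak_deriv_def intro: integrable_cong_AE_imp[of _ f])
  show "integrable (lebesgue_on \<Omega>) g" using f by (simp add: has_weak_deriv_def)
  fix \<phi> :: "'a \<Rightarrow> real" assume \<phi>: "\<phi> \<in> C1c \<Omega>"
  let ?d = "\<lambda>x. frechet_derivative \<phi> (at x) i"
  have "?d \<in> borel_measurable (lebesgue_on \<Omega>)"
    using \<phi> i by (intro measurable_restrict_space1 measurable_completion) (auto simp: C1c_def borel_measurable_continuous_onI)
  then have "(\<integral>x. f' x * ?d x \<partial>lebesgue_on \<Omega>) = (\<integral>x. f x * ?d x \<partial>lebesgue_on \<Omega>)"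
    using f m ae by (intro integral_cong_AE borel_measurable_times) (auto simp: has_weak_deriv_def elim: eventually_mono)
  then show "(\<integral>x. f' x * ?d x \<partial>lebesgue_on \<Omega>) = - (\<integral>x. g x * \<phi> x \<partial>lebesgue_on \<Omega>)"
    using f \<phi> by (simp add: has_weak_deriv_def)
qed

section \<open>The space H2 on an interval\<close>

text \<open>A function of class \<open>H\<^sup>2\<close> with its classical first derivative \<open>p\<close> and a density \<open>q\<close> of \<open>p\<close>. All
  computations with \<open>H\<^sup>2\<close> functions use such triples, which are free of the choices hidden in
  \<open>weak_deriv\<close>.\<close>

definition H2_triple :: "real \<Rightarrow> real \<Rightarrow> (real \<Rightarrow> real) \<Rightarrow> (real \<Rightarrow> real) \<Rightarrow> (real \<Rightarrow> real) \<Rightarrow> bool" where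
  "H2_triple a b f p q \<longleftrightarrow> (\<forall>x\<in>{a..b}. (f has_real_derivative p x) (at x within {a..b})) \<and>
     AC_on a b p q \<and> (\<lambda>x. (q x)\<^sup>2) integrable_on {a..b}"

lemma AC_on_continuous_imp_DERIV:
  assumes "AC_on a b f p" "continuous_on {a..b} p" "x \<in> {a..b}"
  shows "(f has_real_derivative p x) (at x within {a..b})"
proof -
  have "((\<lambda>u. f a + integral {a..u} p) has_real_derivative 0 + p x) (at x within {a..b})"
    unfolding has_real_derivative_iff_has_vector_derivative
    using assms by (intro derivative_intros integral_has_vector_derivative) auto
  then have D: "((\<lambda>u. f a + integral {a..u} p) has_real_derivative p x) (at x within {a..b})" by simp
  show ?thesis
    by (rule has_field_derivative_transform_within[OF D zero_less_one assms(3)])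
      (auto intro!: AC_on_eq[OF assms(1), symmetric])
qed

lemma AC_on_cong_AE:
  assumes "AC_on a b f p" "AE x in lebesgue_on {a<..<b}. p x = p' x" "p' absolutely_integrable_on {a..b}"
  shows "AC_on a b f p'"
  unfolding AC_on_def
proof (intro conjI ballI assms(3))
  fix x assume x: "x \<in> {a..b}"
  then have "integral {a..x} p = integral {a..x} p'"
    by (intro AE_lebesgue_on_Ioo_imp_integral_eq[OF assms(2)]) auto
  then show "f x = f a + integral {a..x} p'"
    using AC_on_eq[OF assms(1), of x] x by auto
qed

lemma H2_triple_AC1:
  assumes "H2_triple a b f p q"
  shows "AC_on a b f p"
  using assms AC_on_continuous by (auto simp: H2_triple_def intro: AC_onI_C1)

lemma continuous_imp_L2:
  assumes "continuous_on {a..b} f"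
  shows "f \<in> L2 {a<..<b}"
proof -
  have "integrable (lebesgue_on {a<..<b}) f"
    by (simp add: integrable_lebesgue_on_Ioo_iff absolutely_integrable_continuous_real assms)
  moreover have "integrable (lebesgue_on {a<..<b}) (\<lambda>x. (f x)\<^sup>2)"
    by (simp add: integrable_lebesgue_on_Ioo_iff absolutely_integrable_continuous_real assms continuous_on_power)
  ultimately show ?thesis unfolding L2_def by auto
qed

lemma H2_triple_integrable_sq:
  assumes "H2_triple a b f p q"
  shows "(\<lambda>x. (f x)\<^sup>2) integrable_on {a..b}" "(\<lambda>x. (p x)\<^sup>2) integrable_on {a..b}" "(\<lambda>x. (q x)\<^sup>2) integrable_on {a..b}"
proof -
  have "continuous_on {a..b} f" "continuous_on {a..b} p"
    using AC_on_continuous[OF H2_triple_AC1[OF assms]] AC_on_continuous assms by (auto simp: H2_triple_def)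
  then show "(\<lambda>x. (f x)\<^sup>2) integrable_on {a..b}" "(\<lambda>x. (p x)\<^sup>2) integrable_on {a..b}"
    by (auto intro!: integrable_continuous_real continuous_intros)
  show "(\<lambda>x. (q x)\<^sup>2) integrable_on {a..b}" using assms by (simp add: H2_triple_def)
qed

lemma H2_triple_imp_H2:
  assumes t: "H2_triple a b f p q" and "a < b"
  shows "f \<in> H2 {a<..<b}"
    and "H2_norm {a<..<b} f = sqrt (integral {a..b} (\<lambda>x. (f x)\<^sup>2) + integral {a..b} (\<lambda>x. (p x)\<^sup>2) + integral {a..b} (\<lambda>x. (q x)\<^sup>2))"
proof -
  let ?M = "lebesgue_on {a<..<b}"
  note ac = H2_triple_AC1[OF t]
  have ac2: "AC_on a b p q" using t by (simp add: H2_triple_def)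
  have sq: "(\<lambda>x. (q x)\<^sup>2) absolutely_integrable_on {a..b}"
    using t by (auto simp: H2_triple_def intro: nonnegative_absolutely_integrable_1)
  have wd: "has_weak_deriv {a<..<b} 1 f p" "has_weak_deriv {a<..<b} 1 p q"
    using AC_on_imp_weak_deriv ac ac2 \<open>a < b\<close> by auto
  have "q \<in> L2 {a<..<b}"
    using sq wd(2) by (auto simp: L2_def integrable_lebesgue_on_Ioo_iff has_weak_deriv_def)
      (metis integrable_lebesgue_on_Ioo_iff borel_measurable_integrable)
  then show "f \<in> H2 {a<..<b}"
    unfolding H2_def using wd continuous_imp_L2 AC_on_continuous ac ac2 by blast
  have e1: "AE x in ?M. weak_deriv {a<..<b} f x = p x" by (rule weak_deriv_AE_eq[OF wd(1)])
  have m: "weak_deriv {a<..<b} f \<in> borel_measurable ?M"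
    using has_weak_deriv_weak_deriv[OF wd(1)] by (auto simp: has_weak_deriv_def)
  have wd2: "has_weak_deriv {a<..<b} 1 (weak_deriv {a<..<b} f) q"
    by (rule has_weak_deriv_cong_AE[OF wd(2) _ m]) (use e1 in \<open>auto elim: eventually_mono\<close>)
  have e2: "AE x in ?M. weak_deriv {a<..<b} (weak_deriv {a<..<b} f) x = q x"
    by (rule weak_deriv_AE_eq[OF wd2])
  have m2: "weak_deriv {a<..<b} (weak_deriv {a<..<b} f) \<in> borel_measurable ?M"
    using has_weak_deriv_weak_deriv[OF wd2] by (auto simp: has_weak_deriv_def)
  have pm: "p \<in> borel_measurable ?M" "q \<in> borel_measurable ?M"
    using wd by (auto simp: has_weak_deriv_def)
  have li: "(\<integral>x. (w x)\<^sup>2 \<partial>?M) = integral {a..b} (\<lambda>x. (w x)\<^sup>2)" if "(\<lambda>x. (w x)\<^sup>2) integrable_on {a..b}" for w :: "real \<Rightarrow> real"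
    by (rule lebesgue_on_Ioo_integral)
      (use that in \<open>auto simp: integrable_lebesgue_on_Ioo_iff intro: nonnegative_absolutely_integrable_1\<close>)
  have "(\<integral>x. (weak_deriv {a<..<b} f x)\<^sup>2 \<partial>?M) = (\<integral>x. (p x)\<^sup>2 \<partial>?M)"
    using m pm e1 by (intro integral_cong_AE) (auto elim: eventually_mono)
  moreover have "(\<integral>x. (weak_deriv {a<..<b} (weak_deriv {a<..<b} f) x)\<^sup>2 \<partial>?M) = (\<integral>x. (q x)\<^sup>2 \<partial>?M)"
    using m2 pm e2 by (intro integral_cong_AE) (auto elim: eventually_mono)
  ultimately show "H2_norm {a<..<b} f = sqrt (integral {a..b} (\<lambda>x. (f x)\<^sup>2) + integral {a..b} (\<lambda>x. (p x)\<^sup>2) + integral {a..b} (\<lambda>x. (q x)\<^sup>2))"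
    unfolding H2_norm_def using li H2_triple_integrable_sq[OF t] by simp
qed

lemma H2_imp_H2_triple:
  assumes f: "f \<in> H2 {a<..<b}" "continuous_on {a..b} f" and "a < b"
  obtains p q where "H2_triple a b f p q"
proof -
  obtain f' f'' where f': "f' \<in> L2 {a<..<b}" "f'' \<in> L2 {a<..<b}"
    "has_weak_deriv {a<..<b} 1 f f'" "has_weak_deriv {a<..<b} 1 f' f''"
    using f by (auto simp: H2_def)
  have 1: "AC_on a b f f'" using has_weak_deriv_continuous_imp_AC[OF f'(3) \<open>a < b\<close> f(2)] .
  obtain p where p: "AC_on a b p f''" "AE x in lebesgue_on {a<..<b}. f' x = p x"
    using has_weak_deriv_imp_AC[OF f'(4) \<open>a < b\<close>] .
  note pc = AC_on_continuous[OF p(1)]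
  have "AC_on a b f p"
    by (rule AC_on_cong_AE[OF 1 p(2)]) (simp add: absolutely_integrable_continuous_real pc)
  moreover have "(\<lambda>x. (f'' x)\<^sup>2) absolutely_integrable_on {a..b}"
    using f'(2) by (simp add: L2_def flip: integrable_lebesgue_on_Ioo_iff)
  ultimately have "H2_triple a b f p f''"
    using p pc AC_on_continuous_imp_DERIV unfolding H2_triple_def
    by (auto dest: set_lebesgue_integral_eq_integral)
  then show ?thesis by (rule that)
qed

lemma H2_triple_diff:
  assumes "H2_triple a b f p q" "H2_triple a b f' p' q'"
  shows "H2_triple a b (\<lambda>x. f x - f' x) (\<lambda>x. p x - p' x) (\<lambda>x. q x - q' x)"
  unfolding H2_triple_def
proof (intro conjI ballI)
  show "((\<lambda>x. f x - f' x) has_real_derivative p x - p' x) (at x within {a..b})" if "x \<in> {a..b}" for x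
    using assms that by (auto simp: H2_triple_def intro!: derivative_intros)
  show "AC_on a b (\<lambda>x. p x - p' x) (\<lambda>x. q x - q' x)"
    using assms by (auto simp: H2_triple_def intro: AC_on_minus)
  have m: "q \<in> borel_measurable (lebesgue_on {a..b})" "q' \<in> borel_measurable (lebesgue_on {a..b})"
    using assms AC_on_abs_integrable absolutely_integrable_imp_borel_measurable unfolding H2_triple_def
    by (metis lmeasurable_cbox box_real(2) fmeasurableD)+
  have "(\<lambda>x. (q x - q' x)\<^sup>2) absolutely_integrable_on {a..b}"
  proof (rule measurable_bounded_by_integrable_imp_absolutely_integrable)
    show "(\<lambda>x. 2 * (q x)\<^sup>2 + 2 * (q' x)\<^sup>2) integrable_on {a..b}"
      using assms by (auto simp: H2_triple_def intro!: integrable_add integrable_on_mult_right)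
    show "norm ((q x - q' x)\<^sup>2) \<le> 2 * (q x)\<^sup>2 + 2 * (q' x)\<^sup>2" for x
      using zero_le_power2[of "q x + q' x"] unfolding real_norm_def abs_of_nonneg[OF zero_le_power2]
      by (simp add: power2_eq_square algebra_simps)
  qed (use m in \<open>auto intro!: borel_measurable_power borel_measurable_diff\<close>)
  then show "(\<lambda>x. (q x - q' x)\<^sup>2) integrable_on {a..b}" by (rule set_lebesgue_integral_eq_integral)
qed

lemma H2_triple_const: "H2_triple a b (\<lambda>_. c) (\<lambda>_. 0) (\<lambda>_. 0)"
  by (simp add: H2_triple_def AC_on_const integrable_0)

text \<open>The Cauchy-Schwarz inequality against the constant \<open>1\<close>: integrate the square of \<open>\<bar>g\<bar> - m\<close>,
  where \<open>m\<close> is the mean of \<open>\<bar>g\<bar>\<close>.\<close>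

lemma integral_square_le:
  fixes g :: "real \<Rightarrow> real"
  assumes g: "g absolutely_integrable_on {a..b}" and g2: "(\<lambda>x. (g x)\<^sup>2) integrable_on {a..b}" and "a < b"
  shows "(integral {a..b} (\<lambda>x. \<bar>g x\<bar>))\<^sup>2 \<le> (b - a) * integral {a..b} (\<lambda>x. (g x)\<^sup>2)"
proof -
  let ?I = "integral {a..b} (\<lambda>x. \<bar>g x\<bar>)" and ?J = "integral {a..b} (\<lambda>x. (g x)\<^sup>2)"
  define m where "m = ?I / (b - a)"
  have gi: "(\<lambda>x. \<bar>g x\<bar>) integrable_on {a..b}"
    using g by (simp add: absolutely_integrable_on_def)
  have "((\<lambda>x. (g x)\<^sup>2 - 2 * m * \<bar>g x\<bar> + m\<^sup>2) has_integral (?J - 2 * m * ?I + m\<^sup>2 * (b - a))) {a..b}"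
    using has_integral_const_real[of "m\<^sup>2" a b] \<open>a < b\<close>
    by (intro has_integral_add has_integral_diff has_integral_mult_right integrable_integral gi g2)
      (simp add: mult.commute)
  then have "0 \<le> ?J - 2 * m * ?I + m\<^sup>2 * (b - a)"
  proof (rule has_integral_nonneg)
    show "0 \<le> (g x)\<^sup>2 - 2 * m * \<bar>g x\<bar> + m\<^sup>2" for x
      using zero_le_power2[of "\<bar>g x\<bar> - m"] by (simp add: power2_diff algebra_simps)
  qed
  also have "\<dots> = ?J - ?I\<^sup>2 / (b - a)"
  proof -
    have "m * (b - a) = ?I" using \<open>a < b\<close> by (simp add: m_def)
    then have "m\<^sup>2 * (b - a) = m * ?I" by (simp add: power2_eq_square)
    moreover have "m * ?I = ?I\<^sup>2 / (b - a)" by (simp add: m_def power2_eq_square)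
    ultimately show ?thesis by simp
  qed
  finally show ?thesis using \<open>a < b\<close> by (simp add: field_simps)
qed

text \<open>The Sobolev embedding: bound \<open>f x\<close> by \<open>f y\<close> and the oscillation of \<open>f\<close>, which the integral
  of \<open>\<bar>g\<bar>\<close> controls, and average over \<open>y\<close>.\<close>

lemma AC_on_sup_bound:
  assumes f: "AC_on a b f g" and g2: "(\<lambda>x. (g x)\<^sup>2) integrable_on {a..b}" and ab: "a < b" and x: "x \<in> {a..b}"
  shows "(f x)\<^sup>2 \<le> 2 / (b - a) * integral {a..b} (\<lambda>x. (f x)\<^sup>2) + 2 * (b - a) * integral {a..b} (\<lambda>x. (g x)\<^sup>2)"
proof -
  let ?J = "integral {a..b} (\<lambda>x. (g x)\<^sup>2)" and ?I = "integral {a..b} (\<lambda>x. \<bar>g x\<bar>)"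
  note ga = AC_on_abs_integrable[OF f]
  have gi: "(\<lambda>x. \<bar>g x\<bar>) integrable_on {a..b}"
    using ga by (simp add: absolutely_integrable_on_def)
  have osc': "\<bar>f y - f x\<bar> \<le> ?I" if "a \<le> x" "x \<le> y" "y \<le> b" for x y
  proof -
    have gi': "(\<lambda>x. \<bar>g x\<bar>) integrable_on {x..y}" using integrable_on_subinterval[OF gi] that by auto
    have "f y - f x = integral {x..y} g" by (rule AC_on_diff[OF f that])
    also have "\<bar>\<dots>\<bar> \<le> integral {x..y} (\<lambda>x. \<bar>g x\<bar>)"
      using integral_norm_bound_integral[OF AC_on_integrable[OF f that(1,3)] gi'] by simp
    also have "\<dots> \<le> ?I" using that gi' gi by (intro integral_subset_le) auto
    finally show ?thesis .
  qed
  have osc: "\<bar>f x - f y\<bar> \<le> ?I" if "y \<in> {a..b}" for y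
    using osc'[of x y] osc'[of y x] that x by (cases "x \<le> y") auto
  have pt: "(f x)\<^sup>2 \<le> 2 * (f y)\<^sup>2 + 2 * ((b - a) * ?J)" if "y \<in> {a..b}" for y
  proof -
    have "(f x)\<^sup>2 \<le> 2 * (f y)\<^sup>2 + 2 * (f x - f y)\<^sup>2"
      using zero_le_power2[of "f x - 2 * f y"] by (simp add: power2_eq_square algebra_simps)
    also have "(f x - f y)\<^sup>2 \<le> ?I\<^sup>2"
      using osc[OF that] by (metis abs_ge_zero power2_abs power_mono)
    also have "?I\<^sup>2 \<le> (b - a) * ?J" by (rule integral_square_le[OF ga g2 ab])
    finally show ?thesis by simp
  qed
  have f2: "(\<lambda>x. (f x)\<^sup>2) integrable_on {a..b}"
    by (intro integrable_continuous_real continuous_intros AC_on_continuous[OF f])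
  have "((\<lambda>y. (f x)\<^sup>2) has_integral (f x)\<^sup>2 * (b - a)) {a..b}"
    using has_integral_const_real[of "(f x)\<^sup>2" a b] ab by (simp add: mult.commute)
  moreover have "((\<lambda>y. 2 * (f y)\<^sup>2 + 2 * ((b - a) * ?J)) has_integral
      2 * integral {a..b} (\<lambda>x. (f x)\<^sup>2) + 2 * ((b - a) * ?J) * (b - a)) {a..b}"
    using has_integral_const_real[of "2 * ((b - a) * ?J)" a b] ab
    by (intro has_integral_add has_integral_mult_right integrable_integral f2) (simp add: mult.commute)
  ultimately have "(f x)\<^sup>2 * (b - a) \<le> 2 * integral {a..b} (\<lambda>x. (f x)\<^sup>2) + 2 * ((b - a) * ?J) * (b - a)"
    by (rule has_integral_le) (rule pt)
  then show ?thesis using ab by (simp add: field_simps)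
qed

lemma H2_triple_sup_bound:
  assumes t: "H2_triple a b f p q" and ab: "a < b" and x: "x \<in> {a..b}"
  shows "\<bar>f x\<bar> \<le> sqrt (2 / (b - a) + 2 * (b - a)) * H2_norm {a<..<b} f"
    and "\<bar>p x\<bar> \<le> sqrt (2 / (b - a) + 2 * (b - a)) * H2_norm {a<..<b} f"
proof -
  let ?i = "\<lambda>w. integral {a..b} (\<lambda>x. (w x)\<^sup>2)"
  let ?K = "2 / (b - a) + 2 * (b - a)"
  note sq = H2_triple_integrable_sq[OF t]
  have nn: "?i f \<ge> 0" "?i p \<ge> 0" "?i q \<ge> 0" using sq by (auto intro!: Henstock_Kurzweil_Integration.integral_nonneg)
  have kk: "2 / (b - a) \<ge> 0" "2 * (b - a) \<ge> 0" using ab by auto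
  have n: "H2_norm {a<..<b} f = sqrt (?i f + ?i p + ?i q)" by (rule H2_triple_imp_H2[OF t ab])
  have "?K * (?i f + ?i p + ?i q) - (2 / (b - a) * ?i f + 2 * (b - a) * ?i p)
     = 2 / (b - a) * (?i p + ?i q) + 2 * (b - a) * (?i f + ?i q)" by (simp add: algebra_simps)
  also have "\<dots> \<ge> 0" using nn kk by (intro add_nonneg_nonneg mult_nonneg_nonneg) auto
  finally have 1: "(f x)\<^sup>2 \<le> ?K * (?i f + ?i p + ?i q)"
    using AC_on_sup_bound[OF H2_triple_AC1[OF t] sq(2) ab x] by linarith
  have "?K * (?i f + ?i p + ?i q) - (2 / (b - a) * ?i p + 2 * (b - a) * ?i q)
     = 2 / (b - a) * (?i f + ?i q) + 2 * (b - a) * (?i f + ?i p)" by (simp add: algebra_simps)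
  also have "\<dots> \<ge> 0" using nn kk by (intro add_nonneg_nonneg mult_nonneg_nonneg) auto
  finally have 2: "(p x)\<^sup>2 \<le> ?K * (?i f + ?i p + ?i q)"
    using AC_on_sup_bound[of a b p q, OF _ sq(3) ab x] t by (simp add: H2_triple_def)
  show "\<bar>f x\<bar> \<le> sqrt ?K * H2_norm {a<..<b} f" "\<bar>p x\<bar> \<le> sqrt ?K * H2_norm {a<..<b} f"
    unfolding n real_sqrt_mult[symmetric] using 1 2 by (auto intro!: real_le_rsqrt)
qed

section \<open>Gronwall's inequality and the Picard-Lindeloef theorem\<close>

lemma integral_has_real_derivative_within:
  fixes f :: "real \<Rightarrow> real"
  assumes "continuous_on {a..b} f" "x \<in> {a..b}"
  shows "((\<lambda>u. integral {a..u} f) has_real_derivative f x) (at x within {a..b})"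
  using integral_has_vector_derivative[OF assms]
  by (simp add: has_real_derivative_iff_has_vector_derivative)

text \<open>The right-hand side \<open>W\<close> of the integral inequality satisfies \<open>W' = K u \<le> K W\<close>, so
  that \<open>W t * exp (- K t)\<close> decreases.\<close>

lemma gronwall:
  fixes u :: "real \<Rightarrow> real"
  assumes cont: "continuous_on {0..T} u" and K: "0 \<le> K"
    and le: "\<And>t. t \<in> {0..T} \<Longrightarrow> u t \<le> A + K * integral {0..t} u"
    and t: "t \<in> {0..T}"
  shows "u t \<le> A * exp (K * t)"
proof -
  define W where "W s = A + K * integral {0..s} u" for s
  have D: "(W has_real_derivative K * u s) (at s within {0..T})" if "s \<in> {0..T}" for s
    unfolding W_def
    using DERIV_add[OF DERIV_const DERIV_cmult[OF integral_has_real_derivative_within[OF cont that]], of A K]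
    by simp
  have "W t * exp (- K * t) \<le> W 0 * exp (- K * 0)"
  proof (rule DERIV_nonpos_imp_decreasing_open[of 0 t "\<lambda>s. W s * exp (- K * s)"])
    show "0 \<le> t" using t by simp
    have "continuous_on {0..T} W"
      using D by (meson DERIV_continuous continuous_on_eq_continuous_within)
    then show "continuous_on {0..t} (\<lambda>s. W s * exp (- K * s))"
      using t by (intro continuous_intros) (auto intro: continuous_on_subset)
    fix s assume s: "0 < s" "s < t"
    then have "(W has_real_derivative K * u s) (at s)"
      using D[of s] t by (auto simp: at_within_Icc_at)
    then have "((\<lambda>s. W s * exp (- K * s)) has_real_derivative K * (u s - W s) * exp (- K * s)) (at s)"
      by (auto intro!: derivative_eq_intros simp: algebra_simps)
    moreover have "K * (u s - W s) * exp (- K * s) \<le> 0"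
      using le[of s] s t K by (intro mult_nonpos_nonneg mult_nonneg_nonpos) (auto simp: W_def)
    ultimately show "\<exists>y. ((\<lambda>s. W s * exp (- K * s)) has_real_derivative y) (at s) \<and> y \<le> 0" by blast
  qed
  then have "W t * exp (- K * t) \<le> A" by (simp add: W_def)
  then have "W t \<le> A * exp (K * t)"
    by (simp add: exp_minus field_simps)
  then show ?thesis using le[OF t] by (simp add: W_def)
qed

text \<open>The integral equation is a fixed point problem for \<open>w t = exp (- \<kappa> t) * l t\<close>.
  For \<open>\<kappa> = 2 K + 1\<close> the exponential weight turns the integral operator into a contraction
  with constant \<open>1/2\<close> on the whole interval, so that no continuation argument is needed.
  Functions on \<open>[0, T]\<close> are extended by their boundary values to become bounded continuous
  functions on the line.\<close>

lemma picard_lindelof: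
  fixes G :: "real \<Rightarrow> real \<Rightarrow> real"
  assumes T: "0 < T" and K: "0 \<le> K"
    and cont: "continuous_on ({0..T} \<times> UNIV) (\<lambda>(t, u). G t u)"
    and lip: "\<And>t u v. t \<in> {0..T} \<Longrightarrow> \<bar>G t u - G t v\<bar> \<le> K * \<bar>u - v\<bar>"
  obtains l where "l 0 = l0" "\<And>t. t \<in> {0..T} \<Longrightarrow> (l has_real_derivative G t (l t)) (at t within {0..T})"
proof -
  define kap where "kap = 2 * K + 1"
  have kap: "kap > 0" "K / kap \<le> 1 / 2" using K by (auto simp: kap_def field_simps)
  define c where "c t = max 0 (min T t)" for t
  have c: "c t \<in> {0..T}" for t using T by (auto simp: c_def)
  have c_id: "c t = t" if "t \<in> {0..T}" for t using that by (auto simp: c_def)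
  have cc: "continuous_on UNIV c" unfolding c_def by (intro continuous_intros)
  define g where "g w r = G r (exp (kap * r) * w r)" for w r
  define h where "h w t = l0 + integral {0..t} (g w)" for w t
  have gc: "continuous_on {0..T} (g w)" if "continuous_on {0..T} w" for w
    unfolding g_def
    by (rule continuous_on_compose2[OF cont, where f = "\<lambda>r. (r, exp (kap * r) * w r)", unfolded case_prod_conv])
      (use that in \<open>auto intro!: continuous_intros\<close>)
  have hc: "continuous_on {0..T} (h w)" if "continuous_on {0..T} w" for w
    unfolding h_def using gc[OF that]
    by (intro continuous_intros indefinite_integral_continuous_1 integrable_continuous_real)
  have wc: "continuous_on {0..T} (apply_bcontfun w)" for w :: "real \<Rightarrow>\<^sub>C real"
    using continuous_on_apply_bcontfun by (rule continuous_on_subset) auto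
  define k where "k w t = exp (- kap * c t) * h (apply_bcontfun w) (c t)" for w :: "real \<Rightarrow>\<^sub>C real" and t
  have kb: "k w \<in> bcontfun" for w
  proof -
    have "continuous_on {0..T} (\<lambda>t. exp (- kap * t) * h (apply_bcontfun w) t)"
      by (intro continuous_intros hc wc)
    then have k1: "continuous_on UNIV (\<lambda>t. (\<lambda>t. exp (- kap * t) * h (apply_bcontfun w) t) (c t))"
      and "compact ((\<lambda>t. exp (- kap * t) * h (apply_bcontfun w) t) ` {0..T})"
      using c by (auto intro!: continuous_on_compose2[OF _ cc] compact_continuous_image)
    then obtain b where "\<And>t. t \<in> {0..T} \<Longrightarrow> norm (exp (- kap * t) * h (apply_bcontfun w) t) \<le> b"
      by (meson compact_imp_bounded bounded_iff imageI)
    then have "norm (k w t) \<le> b" for t using c by (auto simp: k_def)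
    moreover have "continuous_on UNIV (k w)" using k1 by (simp add: k_def[abs_def])
    ultimately show ?thesis by (rule bcontfun_normI[rotated])
  qed
  define P where "P w = Bcontfun (k w)" for w
  have P: "apply_bcontfun (P w) = k w" for w by (simp add: P_def Bcontfun_inverse kb)
  have "dist (P w) (P v) \<le> 1 / 2 * dist w v" for w v
  proof (rule dist_bound)
    fix t
    let ?t = "c t" and ?d = "dist w v"
    have gi: "g (apply_bcontfun w) integrable_on {0..?t}" for w
      using c[of t] by (intro integrable_continuous_real continuous_on_subset[OF gc[OF wc]]) auto
    have 1: "((\<lambda>r. K * ?d * exp (kap * r)) has_integral (K * ?d * exp (kap * ?t) / kap - K * ?d * exp (kap * 0) / kap)) {0..?t}"
      using c[of t] kap by (intro fundamental_theorem_of_calculus)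
        (auto simp flip: has_real_derivative_iff_has_vector_derivative intro!: derivative_eq_intros)
    have "h (apply_bcontfun w) ?t - h (apply_bcontfun v) ?t = integral {0..?t} (\<lambda>r. g (apply_bcontfun w) r - g (apply_bcontfun v) r)"
      using gi by (simp add: h_def Henstock_Kurzweil_Integration.integral_diff)
    also have "norm \<dots> \<le> integral {0..?t} (\<lambda>r. K * ?d * exp (kap * r))"
    proof (rule Henstock_Kurzweil_Integration.integral_norm_bound_integral)
      fix r assume r: "r \<in> {0..?t}"
      have "\<bar>g (apply_bcontfun w) r - g (apply_bcontfun v) r\<bar> \<le> K * \<bar>exp (kap * r) * w r - exp (kap * r) * v r\<bar>"
        unfolding g_def using r c[of t] by (intro lip) auto
      also have "\<dots> = K * (exp (kap * r) * dist (w r) (v r))"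
        by (simp add: dist_real_def abs_mult flip: right_diff_distrib)
      also have "\<dots> \<le> K * (exp (kap * r) * ?d)"
        using K by (intro mult_left_mono dist_bounded) auto
      finally show "norm (g (apply_bcontfun w) r - g (apply_bcontfun v) r) \<le> K * ?d * exp (kap * r)"
        by (simp add: mult_ac)
    qed (use gi 1 in \<open>auto intro!: integrable_diff\<close>)
    also have "\<dots> \<le> K * ?d * exp (kap * ?t) / kap"
      using integral_unique[OF 1] K kap by simp
    finally have "\<bar>h (apply_bcontfun w) ?t - h (apply_bcontfun v) ?t\<bar> \<le> K * ?d * exp (kap * ?t) / kap" by simp
    then have "exp (- kap * ?t) * \<bar>h (apply_bcontfun w) ?t - h (apply_bcontfun v) ?t\<bar> \<le> exp (- kap * ?t) * (K * ?d * exp (kap * ?t) / kap)"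
      by (intro mult_left_mono) auto
    also have "\<dots> = K / kap * ?d" by (simp add: exp_minus)
    also have "\<dots> \<le> 1 / 2 * ?d" using kap by (intro mult_right_mono) auto
    finally show "dist (P w t) (P v t) \<le> 1 / 2 * ?d"
      by (simp add: P k_def dist_real_def abs_mult flip: right_diff_distrib)
  qed
  then obtain w where w: "P w = w"
    using banach_fix_type[of "1/2" P] by auto
  define l where "l = h (apply_bcontfun w)"
  have lw: "exp (kap * t) * w t = l t" if "t \<in> {0..T}" for t
  proof -
    have "w t = k w t" using w P by metis
    then show ?thesis using that by (simp add: k_def c_id l_def exp_minus)
  qed
  show ?thesis
  proof (rule that[of l])
    show "l 0 = l0" by (simp add: l_def h_def)
    fix t assume t: "t \<in> {0..T}"
    have "(l has_real_derivative g (apply_bcontfun w) t) (at t within {0..T})"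
      unfolding l_def h_def
      using DERIV_add[OF DERIV_const integral_has_real_derivative_within[OF gc[OF wc] t], of l0]
      by simp
    then show "(l has_real_derivative G t (l t)) (at t within {0..T})"
      using lw[OF t] by (simp add: g_def)
  qed
qed

section \<open>Continuity of affine substitutions in L1 and L2\<close>

lemma integral_affine:
  fixes f :: "real \<Rightarrow> real"
  assumes "f absolutely_integrable_on UNIV" "a > 0"
  shows "(\<lambda>x. f (a * x + b)) absolutely_integrable_on UNIV"
    and "integral UNIV (\<lambda>x. f (a * x + b)) = integral UNIV f / a"
proof -
  have r: "range (\<lambda>x. a * x + b) = UNIV"
  proof (rule surjI)
    show "a * ((y - b) / a) + b = y" for y using \<open>a > 0\<close> by simp
  qed
  have "(\<lambda>x. \<bar>a\<bar> * f (a * x + b)) absolutely_integrable_on UNIV \<and>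
      integral UNIV (\<lambda>x. \<bar>a\<bar> * f (a * x + b)) = integral UNIV f \<longleftrightarrow>
      f absolutely_integrable_on (range (\<lambda>x. a * x + b)) \<and> integral (range (\<lambda>x. a * x + b)) f = integral UNIV f"
    by (rule has_absolute_integral_change_of_variables_1')
      (use \<open>a > 0\<close> in \<open>auto intro!: derivative_eq_intros inj_onI\<close>)
  then have *: "(\<lambda>x. a * f (a * x + b)) absolutely_integrable_on UNIV"
    "integral UNIV (\<lambda>x. a * f (a * x + b)) = integral UNIV f"
    using assms by (auto simp: r)
  have "(\<lambda>x. (1 / a) * (a * f (a * x + b))) absolutely_integrable_on UNIV"
    by (intro set_integrable_mult_right *)
  then show "(\<lambda>x. f (a * x + b)) absolutely_integrable_on UNIV"
    using \<open>a > 0\<close> by simp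
  show "integral UNIV (\<lambda>x. f (a * x + b)) = integral UNIV f / a"
    using *(2) \<open>a > 0\<close> by (simp add: field_simps)
qed

text \<open>Translations and dilations act continuously on \<open>f\<close> in the \<open>L\<^sup>1\<close> norm.\<close>

definition L1_cont :: "(real \<Rightarrow> real) \<Rightarrow> bool" where
  "L1_cont f \<longleftrightarrow> (\<forall>a b a0 b0. (\<forall>n. a n > 0) \<longrightarrow> a0 > 0 \<longrightarrow> a \<longlonglongrightarrow> a0 \<longrightarrow> b \<longlonglongrightarrow> b0 \<longrightarrow>
     (\<lambda>n::nat. integral UNIV (\<lambda>x. \<bar>f (a n * x + b n) - f (a0 * x + b0)\<bar>)) \<longlonglongrightarrow> 0)"

text \<open>The triangle inequality: an affine substitution scales the \<open>L\<^sup>1\<close> norm of \<open>f - g\<close> by a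
  factor that stays bounded along the sequence.\<close>

lemma L1_cont_closed:
  assumes f: "f absolutely_integrable_on UNIV"
    and approx: "\<And>e. e > 0 \<Longrightarrow> \<exists>g. g absolutely_integrable_on UNIV \<and> L1_cont g \<and> integral UNIV (\<lambda>x. \<bar>f x - g x\<bar>) < e"
  shows "L1_cont f"
  unfolding L1_cont_def
proof (intro allI impI)
  fix a b :: "nat \<Rightarrow> real" and a0 b0 :: real
  assume a: "\<forall>n. a n > 0" "a0 > 0" "a \<longlonglongrightarrow> a0" and b: "b \<longlonglongrightarrow> b0"
  let ?D = "\<lambda>f n. integral UNIV (\<lambda>x. \<bar>f (a n * x + b n) - f (a0 * x + b0)\<bar>)"
  show "?D f \<longlonglongrightarrow> 0"
  proof (rule LIMSEQ_I)
    fix e :: real assume "e > 0"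
    define d where "d = e * a0 / 6"
    have "d > 0" using \<open>e > 0\<close> a by (simp add: d_def)
    then obtain g where g: "g absolutely_integrable_on UNIV" "L1_cont g" and fg: "integral UNIV (\<lambda>x. \<bar>f x - g x\<bar>) < d"
      using approx by blast
    let ?I = "integral UNIV (\<lambda>x. \<bar>f x - g x\<bar>)"
    have fgi: "(\<lambda>x. \<bar>f x - g x\<bar>) absolutely_integrable_on UNIV"
      by (intro set_integrable_abs set_integral_diff f g)
    have "?D g \<longlonglongrightarrow> 0" using g(2) a b unfolding L1_cont_def by blast
    then have "\<forall>\<^sub>F n in sequentially. ?D g n < e / 2" using \<open>e > 0\<close> by (intro order_tendstoD) auto
    moreover have "\<forall>\<^sub>F n in sequentially. a0 / 2 < a n" using a by (intro order_tendstoD(1)[OF a(3)]) auto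
    ultimately have "\<forall>\<^sub>F n in sequentially. norm (?D f n - 0) < e"
    proof eventually_elim
      case (elim n)
      have ai: "(\<lambda>x. \<bar>w (c * x + s) - w (c' * x + s')\<bar>) absolutely_integrable_on UNIV"
        if "w absolutely_integrable_on UNIV" "c > 0" "c' > 0" for w :: "real \<Rightarrow> real" and c s c' s'
        by (intro set_integrable_abs set_integral_diff integral_affine(1) that)
      note ii = set_lebesgue_integral_eq_integral(1)
      let ?F = "\<lambda>x. \<bar>f x - g x\<bar>"
      have "?D f n \<le> integral UNIV (\<lambda>x. ?F (a n * x + b n) + (\<bar>g (a n * x + b n) - g (a0 * x + b0)\<bar> + ?F (a0 * x + b0)))"
        by (rule integral_le) (use a in \<open>auto intro!: integrable_add ii[OF ai] f g ii[OF integral_affine(1)[OF fgi]]\<close>)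
      also have "\<dots> = integral UNIV (\<lambda>x. ?F (a n * x + b n)) + (?D g n + integral UNIV (\<lambda>x. ?F (a0 * x + b0)))"
      proof -
        have 1: "(\<lambda>x. ?F (a n * x + b n)) integrable_on UNIV" "(\<lambda>x. ?F (a0 * x + b0)) integrable_on UNIV"
          "(\<lambda>x. \<bar>g (a n * x + b n) - g (a0 * x + b0)\<bar>) integrable_on UNIV"
          using a by (auto intro!: ii ai g integral_affine(1)[OF fgi])
        show ?thesis
          using Henstock_Kurzweil_Integration.integral_add[OF 1(1) integrable_add[OF 1(3) 1(2)]]
            Henstock_Kurzweil_Integration.integral_add[OF 1(3) 1(2)] by simp
      qed
      also have "\<dots> = ?I / a n + ?D g n + ?I / a0"
        using a integral_affine(2)[OF fgi] by simp
      also have "\<dots> \<le> d / (a0 / 2) + ?D g n + d / a0"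
      proof -
        have "?I \<ge> 0" using fgi by (intro Henstock_Kurzweil_Integration.integral_nonneg ii) auto
        have "?I / a n \<le> d / (a0 / 2)"
          using fg elim a \<open>?I \<ge> 0\<close> by (intro frac_le) auto
        moreover have "?I / a0 \<le> d / a0" using fg a by (intro divide_right_mono) auto
        ultimately show ?thesis by simp
      qed
      also have "d / (a0 / 2) + ?D g n + d / a0 < e"
        using elim a by (simp add: d_def field_simps)
      finally have "?D f n < e" .
      moreover have "?D f n \<ge> 0"
        using a by (intro Henstock_Kurzweil_Integration.integral_nonneg ii ai f) auto
      ultimately show ?case by simp
    qed
    then show "\<exists>no. \<forall>n\<ge>no. norm (?D f n - 0) < e" by (simp add: eventually_sequentially)
  qed
qed

text \<open>Write \<open>h\<^sub>n\<close> and \<open>k\<close> for the transformed indicators. From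
  \<open>\<bar>h\<^sub>n - k\<bar> = h\<^sub>n - k + 2 max 0 (k - h\<^sub>n)\<close> it suffices that the integral of \<open>h\<^sub>n\<close>
  tends to that of \<open>k\<close>, which is a scaling identity, and that \<open>max 0 (k - h\<^sub>n)\<close> tends to \<open>0\<close>.
  The latter is dominated by \<open>k\<close>, and tends to \<open>0\<close> pointwise because \<open>U\<close> is open.\<close>

lemma L1_cont_open:
  fixes U :: "real set"
  assumes "open U" "U \<in> lmeasurable"
  shows "L1_cont (indicat_real U)"
  unfolding L1_cont_def
proof (intro allI impI)
  fix a b :: "nat \<Rightarrow> real" and a0 b0 :: real
  assume a: "\<forall>n. a n > 0" "a0 > 0" "a \<longlonglongrightarrow> a0" and b: "b \<longlonglongrightarrow> b0"
  let ?f = "indicat_real U"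
  let ?h = "\<lambda>n x. ?f (a n * x + b n)" and ?k = "\<lambda>x. ?f (a0 * x + b0)"
  note ii = set_lebesgue_integral_eq_integral(1)
  have fi: "?f absolutely_integrable_on UNIV"
    using assms by (intro nonnegative_absolutely_integrable_1) (auto simp: lmeasurable_iff_has_integral)
  have hi: "?h n absolutely_integrable_on UNIV" "integral UNIV (?h n) = integral UNIV ?f / a n" for n
    using integral_affine[OF fi, of "a n"] a by auto
  have ki: "?k absolutely_integrable_on UNIV" "integral UNIV ?k = integral UNIV ?f / a0"
    using integral_affine[OF fi, of a0] a by auto
  have mi: "(\<lambda>x. max 0 (?k x - ?h n x)) absolutely_integrable_on UNIV" for n
    by (intro absolutely_integrable_max_1 set_integral_diff ki hi) auto
  have "(\<lambda>n. integral UNIV (\<lambda>x. max 0 (?k x - ?h n x))) \<longlonglongrightarrow> integral UNIV (\<lambda>x::real. 0::real)"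
  proof (rule dominated_convergence)
    show "(\<lambda>x. max 0 (?k x - ?h n x)) integrable_on UNIV" for n by (rule ii[OF mi])
    show "?k integrable_on UNIV" by (rule ii[OF ki(1)])
    show "norm (max 0 (?k x - ?h n x)) \<le> ?k x" for n x by (auto simp: indicator_def)
    show "(\<lambda>n. max 0 (?k x - ?h n x)) \<longlonglongrightarrow> 0" for x
    proof (cases "a0 * x + b0 \<in> U")
      case True
      have "(\<lambda>n. a n * x + b n) \<longlonglongrightarrow> a0 * x + b0" by (intro tendsto_intros a b)
      then have "\<forall>\<^sub>F n in sequentially. a n * x + b n \<in> U"
        using topological_tendstoD[OF _ \<open>open U\<close> True] by blast
      then have "\<forall>\<^sub>F n in sequentially. max 0 (?k x - ?h n x) = 0"
        by eventually_elim (simp add: indicator_def)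
      then show ?thesis by (rule tendsto_eventually)
    qed auto
  qed
  then have m0: "(\<lambda>n. integral UNIV (\<lambda>x. max 0 (?k x - ?h n x))) \<longlonglongrightarrow> 0" by simp
  have "(\<lambda>n. integral UNIV ?f / a n - integral UNIV ?f / a0 + 2 * integral UNIV (\<lambda>x. max 0 (?k x - ?h n x)))
     \<longlonglongrightarrow> integral UNIV ?f / a0 - integral UNIV ?f / a0 + 2 * 0"
    using a by (intro tendsto_intros m0) auto
  moreover have "integral UNIV (\<lambda>x. \<bar>?h n x - ?k x\<bar>) =
     integral UNIV ?f / a n - integral UNIV ?f / a0 + 2 * integral UNIV (\<lambda>x. max 0 (?k x - ?h n x))" for n
  proof -
    have "((\<lambda>x. ?h n x - ?k x + 2 * max 0 (?k x - ?h n x)) has_integral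
      (integral UNIV (?h n) - integral UNIV ?k + 2 * integral UNIV (\<lambda>x. max 0 (?k x - ?h n x)))) UNIV"
      by (intro has_integral_add has_integral_diff has_integral_mult_right integrable_integral ii hi ki mi)
    moreover have "(\<lambda>x. ?h n x - ?k x + 2 * max 0 (?k x - ?h n x)) = (\<lambda>x. \<bar>?h n x - ?k x\<bar>)"
      by (auto simp: max_def)
    ultimately show ?thesis using hi ki by (simp add: integral_unique)
  qed
  ultimately show "(\<lambda>n. integral UNIV (\<lambda>x. \<bar>?h n x - ?k x\<bar>)) \<longlonglongrightarrow> 0" by simp
qed

lemma L1_cont_add:
  assumes f: "f absolutely_integrable_on UNIV" "L1_cont f" and g: "g absolutely_integrable_on UNIV" "L1_cont g"
  shows "L1_cont (\<lambda>x. f x + g x)"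
  unfolding L1_cont_def
proof (intro allI impI)
  fix a b :: "nat \<Rightarrow> real" and a0 b0 :: real
  assume a: "\<forall>n. a n > 0" "a0 > 0" "a \<longlonglongrightarrow> a0" and b: "b \<longlonglongrightarrow> b0"
  let ?d = "\<lambda>f n x. \<bar>f (a n * x + b n) - f (a0 * x + b0)\<bar>"
  have lim: "(\<lambda>n. integral UNIV (?d f n) + integral UNIV (?d g n)) \<longlonglongrightarrow> 0 + 0"
    using f(2) g(2) a b unfolding L1_cont_def by (intro tendsto_add) blast+
  have ai: "?d w n absolutely_integrable_on UNIV" if "w absolutely_integrable_on UNIV" for w :: "real \<Rightarrow> real" and n
    using a by (intro set_integrable_abs set_integral_diff integral_affine(1) that) auto
  note ii = set_lebesgue_integral_eq_integral(1)
  have fgi: "(\<lambda>x. f x + g x) absolutely_integrable_on UNIV" by (intro set_integral_add f g)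
  have "integral UNIV (?d (\<lambda>x. f x + g x) n) \<le> integral UNIV (\<lambda>x. ?d f n x + ?d g n x)" for n
    by (rule integral_le) (auto intro!: ii[OF ai[OF fgi]] integrable_add ii[OF ai] f g)
  also have "integral UNIV (\<lambda>x. ?d f n x + ?d g n x) = integral UNIV (?d f n) + integral UNIV (?d g n)" for n
    by (intro Henstock_Kurzweil_Integration.integral_add ii ai f g)
  finally have le: "integral UNIV (?d (\<lambda>x. f x + g x) n) \<le> integral UNIV (?d f n) + integral UNIV (?d g n)" for n .
  have "0 \<le> integral UNIV (?d (\<lambda>x. f x + g x) n)" for n
    by (intro Henstock_Kurzweil_Integration.integral_nonneg ii ai fgi) auto
  then have "norm (integral UNIV (?d (\<lambda>x. f x + g x) n)) \<le> integral UNIV (?d f n) + integral UNIV (?d g n)" for n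
    unfolding real_norm_def using le[of n] by (rule abs_of_nonneg[THEN ord_eq_le_trans])
  then show "(\<lambda>n. integral UNIV (?d (\<lambda>x. f x + g x) n)) \<longlonglongrightarrow> 0"
    by (intro Lim_null_comparison[OF always_eventually lim[unfolded add_0_left]] allI)
qed

lemma L1_cont_cmult:
  assumes "L1_cont f" shows "L1_cont (\<lambda>x. c * f x)"
  unfolding L1_cont_def
proof (intro allI impI)
  fix a b :: "nat \<Rightarrow> real" and a0 b0 :: real
  assume a: "\<forall>n. a n > 0" "a0 > 0" "a \<longlonglongrightarrow> a0" "b \<longlonglongrightarrow> b0"
  have "(\<lambda>n. \<bar>c\<bar> * integral UNIV (\<lambda>x. \<bar>f (a n * x + b n) - f (a0 * x + b0)\<bar>)) \<longlonglongrightarrow> \<bar>c\<bar> * 0"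
    using assms a unfolding L1_cont_def by (intro tendsto_mult_left) blast
  then show "(\<lambda>n. integral UNIV (\<lambda>x. \<bar>c * f (a n * x + b n) - c * f (a0 * x + b0)\<bar>)) \<longlonglongrightarrow> 0"
    by (simp add: abs_mult flip: right_diff_distrib)
qed

text \<open>Induction over integrable functions. Indicators of measurable sets are approximated by
  indicators of open sets, using outer regularity of Lebesgue measure.\<close>

lemma integrable_imp_L1_cont:
  fixes f :: "real \<Rightarrow> real"
  assumes "integrable lebesgue f"
  shows "L1_cont f"
  using assms
proof (induction rule: integrable_induct)
  case (base A c)
  have A: "A \<in> lmeasurable" using base by (simp add: fmeasurable_def)
  have ind: "indicat_real B absolutely_integrable_on UNIV" if "B \<in> lmeasurable" for B :: "real set"
    using that by (intro nonnegative_absolutely_integrable_1) (auto simp: lmeasurable_iff_has_integral)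
  have "L1_cont (indicat_real A)"
  proof (rule L1_cont_closed[OF ind[OF A]])
    fix e :: real assume "e > 0"
    obtain U where U: "open U" "A \<subseteq> U" "U - A \<in> lmeasurable" "emeasure lebesgue (U - A) < ennreal e"
      using sets_lebesgue_outer_open[of A e] base \<open>e > 0\<close> by auto
    have "U = A \<union> (U - A)" using U by auto
    then have Um: "U \<in> lmeasurable" using fmeasurable.Un[OF A U(3)] by simp
    have "(\<lambda>x. \<bar>indicat_real A x - indicat_real U x\<bar>) = indicat_real (U - A)"
      using U(2) by (auto simp: indicator_def fun_eq_iff)
    moreover have "integral UNIV (indicat_real (U - A)) = measure lebesgue (U - A)"
      using U(3) by (intro integral_unique) (simp add: lmeasurable_iff_has_integral)
    moreover have "measure lebesgue (U - A) < e"
      using U(4) emeasure_eq_measure2[OF U(3)] \<open>e > 0\<close> by (simp add: ennreal_less_iff)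
    ultimately show "\<exists>g. g absolutely_integrable_on UNIV \<and> L1_cont g \<and> integral UNIV (\<lambda>x. \<bar>indicat_real A x - g x\<bar>) < e"
      using ind[OF Um] L1_cont_open[OF U(1) Um] by (intro exI[of _ "indicat_real U"]) auto
  qed
  from L1_cont_cmult[OF this, of c] show ?case by (simp add: mult.commute)
next
  case (add f g)
  then show ?case by (intro L1_cont_add) (auto simp: set_integrable_def)
next
  case (lim f s)
  have ai: "w absolutely_integrable_on UNIV" if "integrable lebesgue w" for w :: "real \<Rightarrow> real"
    using that by (simp add: set_integrable_def)
  show ?case
  proof (rule L1_cont_closed[OF ai[OF lim(4)]])
    fix e :: real assume "e > 0"
    have "(\<lambda>i. \<integral>x. \<bar>f x - s i x\<bar> \<partial>lebesgue) \<longlonglongrightarrow> (\<integral>x. 0 \<partial>(lebesgue :: real measure))"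
    proof (rule integral_dominated_convergence[where w = "\<lambda>x. 3 * \<bar>f x\<bar>"])
      show "integrable lebesgue (\<lambda>x. 3 * \<bar>f x\<bar>)" using lim(4) by auto
      show "(\<lambda>x. \<bar>f x - s i x\<bar>) \<in> borel_measurable lebesgue" for i
        using lim(1)[of i] lim(4) by (intro borel_measurable_abs borel_measurable_diff) auto
      show "AE x in lebesgue. (\<lambda>i. \<bar>f x - s i x\<bar>) \<longlonglongrightarrow> 0"
      proof (rule AE_I2)
        fix x :: real
        have "(\<lambda>i. \<bar>f x - s i x\<bar>) \<longlonglongrightarrow> \<bar>f x - f x\<bar>" by (intro tendsto_intros lim(2)) simp
        then show "(\<lambda>i. \<bar>f x - s i x\<bar>) \<longlonglongrightarrow> 0" by simp
      qed
      show "AE x in lebesgue. norm \<bar>f x - s i x\<bar> \<le> 3 * \<bar>f x\<bar>" for i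
        using lim(3)[of _ i] by (intro AE_I2) (smt (verit) real_norm_def)
    qed auto
    then have "\<forall>\<^sub>F i in sequentially. (\<integral>x. \<bar>f x - s i x\<bar> \<partial>lebesgue) < e"
      using \<open>e > 0\<close> by (intro order_tendstoD) auto
    then obtain i where i: "(\<integral>x. \<bar>f x - s i x\<bar> \<partial>lebesgue) < e"
      by (auto simp: eventually_sequentially)
    moreover have "integral UNIV (\<lambda>x. \<bar>f x - s i x\<bar>) = (\<integral>x. \<bar>f x - s i x\<bar> \<partial>lebesgue)"
      using lim by (intro integral_lebesgue) auto
    ultimately show "\<exists>g. g absolutely_integrable_on UNIV \<and> L1_cont g \<and> integral UNIV (\<lambda>x. \<bar>f x - g x\<bar>) < e"
      using lim ai by (intro exI[of _ "s i"]) auto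
  qed
qed

text \<open>Transfers \<open>L\<^sup>1\<close> continuity of the signed square \<open>q * \<bar>q\<bar>\<close> to \<open>L\<^sup>2\<close> continuity of \<open>q\<close>. If \<open>u\<close>
  and \<open>v\<close> have equal signs then \<open>\<bar>u - v\<bar> \<le> \<bar>u + v\<bar>\<close>; otherwise the right-hand side is
  \<open>2 (u\<^sup>2 + v\<^sup>2)\<close>.\<close>

lemma diff_square_le_signed_squares:
  fixes u v :: real
  shows "(u - v)\<^sup>2 \<le> 2 * \<bar>u * \<bar>u\<bar> - v * \<bar>v\<bar>\<bar>"
proof -
  have same: "(u - v)\<^sup>2 \<le> 2 * \<bar>u * u - v * v\<bar>" if "u * v \<ge> 0"
  proof -
    have "\<bar>u - v\<bar> * \<bar>u - v\<bar> \<le> \<bar>u - v\<bar> * \<bar>u + v\<bar>"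
      using that by (intro mult_left_mono) (auto simp: abs_if zero_le_mult_iff split: if_splits)
    also have "\<dots> = \<bar>u * u - v * v\<bar>"
      by (simp add: abs_mult[symmetric] algebra_simps)
    finally have "(u - v) * (u - v) \<le> \<bar>u * u - v * v\<bar>" by simp
    then show ?thesis unfolding power2_eq_square
      by (rule order_trans) (use abs_ge_zero[of "u * u - v * v"] in simp)
  qed
  have opp: "(u - v)\<^sup>2 \<le> 2 * (u * u + v * v)"
    using zero_le_power2[of "u + v"] by (simp add: power2_eq_square algebra_simps)
  consider "u \<ge> 0" "v \<ge> 0" | "u \<le> 0" "v \<le> 0" | "u \<ge> 0" "v \<le> 0" | "u \<le> 0" "v \<ge> 0" by linarith
  then show ?thesis
  proof cases
    case 1 then show ?thesis using same by simp
  next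
    case 2 then show ?thesis using same by (simp add: mult_nonpos_nonpos abs_minus_commute)
  next
    case 3 then have "\<bar>u * \<bar>u\<bar> - v * \<bar>v\<bar>\<bar> = u * u + v * v" by (simp add: add_nonneg_nonneg)
    then show ?thesis using opp by simp
  next
    case 4 then have "\<bar>u * \<bar>u\<bar> - v * \<bar>v\<bar>\<bar> = u * u + v * v"
      by (smt (verit) abs_of_nonneg abs_of_nonpos mult_minus_right zero_le_square)
    then show ?thesis using opp by simp
  qed
qed

lemma L2_affine_continuous:
  fixes q :: "real \<Rightarrow> real"
  assumes q: "q \<in> borel_measurable lebesgue" "(\<lambda>x. (q x)\<^sup>2) integrable_on UNIV"
    and a: "\<And>n. a n > 0" "a0 > 0" "a \<longlonglongrightarrow> a0" and b: "b \<longlonglongrightarrow> b0"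
  shows "(\<lambda>x. (q (a n * x + b n) - q (a0 * x + b0))\<^sup>2) integrable_on UNIV"
    and "(\<lambda>n::nat. integral UNIV (\<lambda>x. (q (a n * x + b n) - q (a0 * x + b0))\<^sup>2)) \<longlonglongrightarrow> 0"
proof -
  let ?s = "\<lambda>x. q x * \<bar>q x\<bar>"
  have s: "integrable lebesgue ?s"
  proof (rule Bochner_Integration.integrable_bound)
    show "integrable lebesgue (\<lambda>x. (q x)\<^sup>2)"
      using nonnegative_absolutely_integrable_1[OF q(2)] by (simp add: set_integrable_def)
    show "AE x in lebesgue. norm (?s x) \<le> norm ((q x)\<^sup>2)" by (simp add: abs_mult power2_eq_square)
    show "?s \<in> borel_measurable lebesgue" using q(1) by measurable
  qed
  then have sa: "?s absolutely_integrable_on UNIV" by (simp add: set_integrable_def)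
  note ii = set_lebesgue_integral_eq_integral(1)
  let ?d = "\<lambda>n x. 2 * \<bar>?s (a n * x + b n) - ?s (a0 * x + b0)\<bar>"
  let ?e = "\<lambda>n x. (q (a n * x + b n) - q (a0 * x + b0))\<^sup>2"
  have di: "?d n absolutely_integrable_on UNIV" for n
    using a by (intro set_integrable_mult_right set_integrable_abs set_integral_diff integral_affine(1)[OF sa]) auto
  have q_aff: "(\<lambda>x. q (c * x + d)) \<in> borel_measurable lebesgue" if "c > 0" for c d
  proof -
    have "(\<lambda>x. d + c * x) \<in> lebesgue \<rightarrow>\<^sub>M lebesgue"
      using lebesgue_affine_measurable[of "\<lambda>_. c" d] that by simp
    from measurable_compose[OF this q(1)] show ?thesis by (simp add: add.commute)
  qed
  show ei: "?e n integrable_on UNIV" for n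
  proof -
    have "?e n absolutely_integrable_on UNIV"
    proof (rule measurable_bounded_by_integrable_imp_absolutely_integrable)
      show "?e n \<in> borel_measurable (lebesgue_on UNIV)"
        using a q_aff by (auto intro!: borel_measurable_power borel_measurable_diff)
      show "?d n integrable_on UNIV" by (rule ii[OF di])
      show "norm (?e n x) \<le> ?d n x" for x using diff_square_le_signed_squares by simp
    qed auto
    then show ?thesis by (rule ii)
  qed
  have "(\<lambda>n. 2 * integral UNIV (\<lambda>x. \<bar>?s (a n * x + b n) - ?s (a0 * x + b0)\<bar>)) \<longlonglongrightarrow> 2 * 0"
    using integrable_imp_L1_cont[OF s] a b unfolding L1_cont_def by (intro tendsto_mult_left) blast
  then have "(\<lambda>n. integral UNIV (?d n)) \<longlonglongrightarrow> 0" by simp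
  moreover have "integral UNIV (?e n) \<le> integral UNIV (?d n)" for n
    by (intro integral_le ei ii[OF di] diff_square_le_signed_squares)
  moreover have "0 \<le> integral UNIV (?e n)" for n
    by (intro Henstock_Kurzweil_Integration.integral_nonneg ei) auto
  ultimately show "(\<lambda>n. integral UNIV (?e n)) \<longlonglongrightarrow> 0"
    using tendsto_sandwich[of "\<lambda>_. 0" "\<lambda>n. integral UNIV (?e n)" sequentially "\<lambda>n. integral UNIV (?d n)" 0] by simp
qed

section \<open>The profile determined by initial and boundary data\<close>

lemma square_diff_le: "(a - b)\<^sup>2 \<le> 2 * (a\<^sup>2 + b\<^sup>2)" for a b :: real
  using zero_le_power2[of "a + b"] by (simp add: power2_eq_square algebra_simps)

lemma abs_integrable_substitution:
  fixes f \<sigma> \<sigma>' :: "real \<Rightarrow> real"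
  assumes "\<And>x. x \<in> {a..b} \<Longrightarrow> (\<sigma> has_real_derivative \<sigma>' x) (at x within {a..b})"
    and "inj_on \<sigma> {a..b}"
    and "(\<lambda>x. \<bar>\<sigma>' x\<bar> * f (\<sigma> x)) absolutely_integrable_on {a..b}"
  shows "f absolutely_integrable_on (\<sigma> ` {a..b})"
    and "integral (\<sigma> ` {a..b}) f = integral {a..b} (\<lambda>x. \<bar>\<sigma>' x\<bar> * f (\<sigma> x))"
  using has_absolute_integral_change_of_variables_1'[of "{a..b}" \<sigma> \<sigma>' f] assms by auto

lemma constant_difference_if_DERIV_eq:
  fixes f h d :: "real \<Rightarrow> real"
  assumes "\<And>x. x \<in> {a..b} \<Longrightarrow> (f has_real_derivative d x) (at x within {a..b})"
    and "\<And>x. x \<in> {a..b} \<Longrightarrow> (h has_real_derivative d x) (at x within {a..b})"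
    and "f a = h a" "x \<in> {a..b}"
  shows "f x = h x"
proof -
  have "\<exists>c. \<forall>x\<in>{a..b}. f x - h x = c"
  proof (rule has_field_derivative_zero_constant)
    show "((\<lambda>x. f x - h x) has_real_derivative 0) (at x within {a..b})" if "x \<in> {a..b}" for x
      using DERIV_diff[OF assms(1)[OF that] assms(2)[OF that]] by simp
  qed simp
  then obtain c where "\<And>x. x \<in> {a..b} \<Longrightarrow> f x - h x = c" by blast
  from this[of a] this[of x] show ?thesis using assms(3,4) by auto
qed

text \<open>Serves to verify an identity between absolutely continuous functions when the
  difference \<open>e\<close> of both sides satisfies \<open>e' = w e\<close> almost everywhere with bounded \<open>w\<close>.\<close>

lemma linear_Volterra_eq_zero:
  fixes e w :: "real \<Rightarrow> real"
  assumes e: "continuous_on {0..T} e" and w: "w absolutely_integrable_on {0..T}" and k: "\<And>t. \<bar>w t\<bar> \<le> k"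
    and eq: "\<And>t. t \<in> {0..T} \<Longrightarrow> e t = integral {0..t} (\<lambda>s. w s * e s)" and t: "t \<in> {0..T}"
  shows "e t = 0"
proof -
  have "\<bar>e t\<bar> \<le> 0 * exp (k * t)"
  proof (rule gronwall)
    show "continuous_on {0..T} (\<lambda>t. \<bar>e t\<bar>)" by (intro continuous_intros e)
    show "0 \<le> k" using k[of 0] by linarith
    fix t assume t: "t \<in> {0..T}"
    have et: "continuous_on {0..t} e" using e t by (auto intro: continuous_on_subset)
    have "w absolutely_integrable_on {0..t}"
      using t by (intro absolutely_integrable_on_subinterval[OF w]) auto
    from abs_integrable_mult_continuous[OF et this]
    have "(\<lambda>s. w s * e s) integrable_on {0..t}"
      by (auto simp: mult.commute dest: set_lebesgue_integral_eq_integral)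
    then have "norm (integral {0..t} (\<lambda>s. w s * e s)) \<le> integral {0..t} (\<lambda>s. k * \<bar>e s\<bar>)"
    proof (rule Henstock_Kurzweil_Integration.integral_norm_bound_integral)
      show "(\<lambda>s. k * \<bar>e s\<bar>) integrable_on {0..t}"
        by (intro integrable_continuous_real continuous_intros et)
      show "norm (w s * e s) \<le> k * \<bar>e s\<bar>" for s
        using k by (auto simp: abs_mult intro: mult_right_mono)
    qed
    then show "\<bar>e t\<bar> \<le> 0 + k * integral {0..t} (\<lambda>t. \<bar>e t\<bar>)"
      using eq[OF t] by simp
  qed (rule t)
  then show ?thesis by simp
qed

text \<open>The profile equals \<open>fp0 (y / l0)\<close> for \<open>y\<close> between \<open>0\<close> and \<open>l0\<close>, and it equals \<open>g t\<close> at
  \<open>y = - M t\<close>. Differentiating the second relation, its derivative at \<open>- M t\<close> has to be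
  \<open>r t = - g' t / (\<zeta> N t)\<close>, and the second compatibility condition says that \<open>r 0\<close> is
  the derivative coming from the right. Hence a single function \<open>q\<close> can serve as second
  derivative on both sides; it is extended by \<open>0\<close>, which makes \<open>\<phi>\<close> a function on the whole line
  and spares all distinctions of one-sided derivatives. The bound on \<open>q\<close> in \<open>L\<^sup>2\<close> is a change of
  variables, using that \<open>g' N'\<close> is square integrable for Lipschitz continuous \<open>N\<close>.\<close>

lemma profile_exists:
  fixes N N' fp0 p0 q0 g g1 g2 :: "real \<Rightarrow> real" and n0 k l0 \<zeta> T :: real
  assumes pos: "0 < T" "0 < l0" "0 < \<zeta>" "0 < n0"
    and N: "AC_on 0 T N N'" "\<And>t. t \<in> {0..T} \<Longrightarrow> n0 \<le> N t" "\<And>t. \<bar>N' t\<bar> \<le> k"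
    and f0: "H2_triple 0 1 fp0 p0 q0" and g: "H2_triple 0 T g g1 g2"
    and comp0: "g 0 = fp0 0" and comp1: "p0 0 + l0 / (\<zeta> * N 0) * g1 0 = 0"
  defines "M \<equiv> \<lambda>t. integral {0..t} (\<lambda>s. \<zeta> * N s)"
  obtains \<phi> p q :: "real \<Rightarrow> real" where "\<And>y. (\<phi> has_real_derivative p y) (at y)" "\<And>x y. AC_on x y p q"
    "q \<in> borel_measurable lebesgue" "(\<lambda>y. (q y)\<^sup>2) integrable_on UNIV"
    "\<And>x. x \<in> {0..1} \<Longrightarrow> \<phi> (l0 * x) = fp0 x" "\<And>t. t \<in> {0..T} \<Longrightarrow> \<phi> (- M t) = g t" "p 0 = p0 0 / l0"
    "integral UNIV (\<lambda>y. (q y)\<^sup>2) \<le> integral {0..1} (\<lambda>x. (q0 x)\<^sup>2) / l0 ^ 3 +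
        2 / (\<zeta> * n0) ^ 3 * (integral {0..T} (\<lambda>t. (g2 t)\<^sup>2) + (k / n0)\<^sup>2 * integral {0..T} (\<lambda>t. (g1 t)\<^sup>2))"
proof -
  note ii = set_lebesgue_integral_eq_integral(1)
  have Nc: "continuous_on {0..T} N" by (rule AC_on_continuous[OF N(1)])
  have Npos: "0 < N t" if "t \<in> {0..T}" for t using N(2)[OF that] pos by simp
  have g_ac: "AC_on 0 T g1 g2" and p0_ac: "AC_on 0 1 p0 q0" using g f0 by (auto simp: H2_triple_def)
  note g1c = AC_on_continuous[OF g_ac]
  have k: "0 \<le> k" using N(3)[of 0] by linarith

  \<comment> \<open>\<open>\<rho>\<close> is the derivative of \<open>- g1 / (\<zeta> N)\<close> by the quotient rule. Instead of proving that rule for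
     absolutely continuous functions, \<open>r\<close> is defined as the primitive of \<open>\<rho>\<close>, and \<open>e = \<zeta> N r + g1\<close>
     satisfies \<open>e' = (N' / N) e\<close> with \<open>e 0 = 0\<close>.\<close>
  define \<rho> where "\<rho> t = (g1 t / (\<zeta> * (N t)\<^sup>2)) * N' t - (1 / (\<zeta> * N t)) * g2 t" for t
  have \<rho>_ai: "\<rho> absolutely_integrable_on {0..T}"
    unfolding \<rho>_def using Npos pos
    by (intro set_integral_diff abs_integrable_mult_continuous continuous_intros Nc g1c
      AC_on_abs_integrable[OF N(1)] AC_on_abs_integrable[OF g_ac]) force+
  define r where "r t = p0 0 / l0 + integral {0..t} \<rho>" for t
  have r_ac: "AC_on 0 T r \<rho>" unfolding r_def[abs_def] by (rule AC_onI_integral[OF \<rho>_ai])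
  have g1_eq: "g1 t = - (\<zeta> * N t * r t)" if t: "t \<in> {0..T}" for t
  proof -
    define e where "e t = \<zeta> * (N t * r t) + g1 t" for t
    have ac: "AC_on 0 T e (\<lambda>t. \<zeta> * (N' t * r t + N t * \<rho> t) + g2 t)"
      unfolding e_def[abs_def] by (intro AC_on_add AC_on_cmult AC_on_mult N r_ac g_ac)
    have e0: "e 0 = 0"
      using comp1 pos Npos[of 0] by (simp add: e_def r_def field_simps)
    have w: "(\<lambda>t. (1 / N t) * N' t) absolutely_integrable_on {0..T}"
      using Npos by (intro abs_integrable_mult_continuous continuous_intros Nc AC_on_abs_integrable[OF N(1)]) force
    have "e t = 0"
    proof (rule linear_Volterra_eq_zero[where w = "\<lambda>t. if t \<in> {0..T} then (1 / N t) * N' t else 0" and k = "k / n0" and T = T and e = e and t = t])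
      show "continuous_on {0..T} e" by (rule AC_on_continuous[OF ac])
      show "(\<lambda>t. if t \<in> {0..T} then 1 / N t * N' t else 0) absolutely_integrable_on {0..T}"
        by (rule set_integrable_cong[THEN iffD1, OF refl refl _ w]) auto
      show "\<bar>if t \<in> {0..T} then 1 / N t * N' t else 0\<bar> \<le> k / n0" for t
      proof (cases "t \<in> {0..T}")
        case True
        then have "\<bar>N' t\<bar> / N t \<le> k / n0"
          using N(2)[OF True] N(3)[of t] pos by (intro frac_le) auto
        then show ?thesis using True Npos[OF True] by (simp add: abs_mult)
      qed (use k pos in auto)
      fix s assume s: "s \<in> {0..T}"
      have "e s = integral {0..s} (\<lambda>t. \<zeta> * (N' t * r t + N t * \<rho> t) + g2 t)"
        using AC_on_eq[OF ac, of s] s e0 by auto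
      also have "\<dots> = integral {0..s} (\<lambda>s. (if s \<in> {0..T} then 1 / N s * N' s else 0) * e s)"
      proof (rule Henstock_Kurzweil_Integration.integral_cong)
        fix t assume "t \<in> {0..s}"
        then have "t \<in> {0..T}" using s by auto
        then show "\<zeta> * (N' t * r t + N t * \<rho> t) + g2 t = (if t \<in> {0..T} then 1 / N t * N' t else 0) * e t"
          using Npos[of t] pos by (simp add: e_def \<rho>_def field_simps power2_eq_square)
      qed
      finally show "e s = integral {0..s} (\<lambda>s. (if s \<in> {0..T} then 1 / N s * N' s else 0) * e s)" .
    qed (rule t)
    then show ?thesis by (simp add: e_def)
  qed

  have M0: "M 0 = 0" by (simp add: M_def)
  have MD: "(M has_real_derivative \<zeta> * N t) (at t within {0..T})" if "t \<in> {0..T}" for t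
    unfolding M_def by (rule integral_has_real_derivative_within) (use that in \<open>auto intro!: continuous_intros Nc\<close>)
  have Mc: "continuous_on {0..T} M"
    using MD by (meson DERIV_continuous continuous_on_eq_continuous_within)
  have Mmono: "M s < M t" if "0 \<le> s" "s < t" "t \<le> T" for s t
  proof (rule DERIV_pos_imp_increasing_open[OF \<open>s < t\<close>])
    fix x assume x: "s < x" "x < t"
    then have "(M has_real_derivative \<zeta> * N x) (at x)"
      using MD[of x] that by (auto simp: at_within_Icc_at)
    then show "\<exists>y. (M has_real_derivative y) (at x) \<and> y > 0"
      using Npos[of x] pos x that by auto
  qed (use Mc that in \<open>auto intro: continuous_on_subset\<close>)
  have Mle: "M s \<le> M t" if "0 \<le> s" "s \<le> t" "t \<le> T" for s t
    using Mmono[of s t] that by (cases "s = t") auto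
  have Minj: "inj_on M {0..T}"
  proof (rule inj_onI)
    fix s t assume "s \<in> {0..T}" "t \<in> {0..T}" "M s = M t"
    then show "s = t" using Mmono[of s t] Mmono[of t s] by (cases s t rule: linorder_cases) auto
  qed
  have nMinj: "inj_on (\<lambda>t. - M t) {0..t}" if "t \<in> {0..T}" for t
  proof (rule inj_onI)
    fix x y assume xy: "x \<in> {0..t}" "y \<in> {0..t}" "- M x = - M y"
    from xy(3) have "M x = M y" by (rule neg_equal_iff_equal[THEN iffD1])
    from inj_onD[OF Minj this] xy(1,2) that show "x = y" by auto
  qed
  have Mimg: "(\<lambda>s. - M s) ` {0..t} = {- M t..0}" if t: "t \<in> {0..T}" for t
  proof
    show "(\<lambda>s. - M s) ` {0..t} \<subseteq> {- M t..0}"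
    proof safe
      fix s assume "s \<in> {0..t}"
      then have "M s \<le> M t" "M 0 \<le> M s"
        using Mle[of s t] Mle[of 0 s] t by (meson atLeastAtMost_iff order_refl order_trans)+
      then show "- M s \<in> {- M t..0}" using M0 by auto
    qed
    show "{- M t..0} \<subseteq> (\<lambda>s. - M s) ` {0..t}"
    proof
      fix y assume y: "y \<in> {- M t..0}"
      have "\<exists>s\<ge>0. s \<le> t \<and> M s = - y"
        by (rule IVT') (use y M0 t continuous_on_subset[OF Mc, of "{0..t}"] in auto)
      then obtain s where "0 \<le> s" "s \<le> t" "M s = - y" by blast
      then show "y \<in> (\<lambda>s. - M s) ` {0..t}" by (intro image_eqI[of _ _ s]) auto
    qed
  qed
  define m where "m = M T"
  have m: "m > 0" using Mmono[of 0 T] M0 pos by (simp add: m_def)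

  define q where "q y = (if 0 \<le> y \<and> y \<le> l0 then q0 (y / l0) / l0\<^sup>2
     else if - m \<le> y \<and> y < 0 then - \<rho> (inv_into {0..T} M (- y)) / (\<zeta> * N (inv_into {0..T} M (- y))) else 0)" for y
  have q_out: "q y = 0" if "y \<notin> {-m..l0}" for y using that m pos by (auto simp: q_def)
  have q_right: "q (l0 * x) = q0 x / l0\<^sup>2" if "x \<in> {0..1}" for x
    using that pos by (auto simp: q_def mult_left_le)
  have q_left: "q (- M t) = - \<rho> t / (\<zeta> * N t)" if "t \<in> {0<..T}" for t
  proof -
    have "0 < M t" "M t \<le> m" using Mmono[of 0 t] Mle[of t T] M0 that by (auto simp: m_def)
    then show ?thesis using inv_into_f_f[OF Minj, of t] that by (auto simp: q_def)
  qed

  \<comment> \<open>On the right of \<open>0\<close>, substitute \<open>y = l0 * x\<close>.\<close>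
  have q0_ai: "q0 absolutely_integrable_on {0..x}" if "x \<in> {0..1}" for x
    using that by (intro absolutely_integrable_on_subinterval[OF AC_on_abs_integrable[OF p0_ac]]) auto
  have img: "(\<lambda>x. l0 * x) ` {0..x} = {0..l0 * x}" if "x \<in> {0..1}" for x
    using that pos image_mult_atLeastAtMost[of l0 0 x] by simp
  have injl: "inj_on (\<lambda>x. l0 * x) {0..x}" for x using pos by (auto intro: inj_onI)
  have dl: "((\<lambda>x. l0 * x) has_real_derivative l0) (at y within {0..x})" for x y
    by (auto intro!: derivative_eq_intros)
  have rsub: "(\<lambda>y. \<bar>l0\<bar> * q (l0 * y)) absolutely_integrable_on {0..x}"
    "integral {0..x} (\<lambda>y. \<bar>l0\<bar> * q (l0 * y)) = integral {0..x} q0 / l0" if x: "x \<in> {0..1}" for x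
  proof -
    have eq: "\<bar>l0\<bar> * q (l0 * y) = (1 / l0) * q0 y" if "y \<in> {0..x}" for y
      using q_right[of y] that x pos by (auto simp: field_simps power2_eq_square)
    show "(\<lambda>y. \<bar>l0\<bar> * q (l0 * y)) absolutely_integrable_on {0..x}"
      by (rule set_integrable_cong[THEN iffD2, OF refl refl eq]) (auto intro: q0_ai[OF x])
    have "integral {0..x} (\<lambda>y. \<bar>l0\<bar> * q (l0 * y)) = integral {0..x} (\<lambda>y. (1 / l0) * q0 y)"
      by (rule Henstock_Kurzweil_Integration.integral_cong) (rule eq)
    then show "integral {0..x} (\<lambda>y. \<bar>l0\<bar> * q (l0 * y)) = integral {0..x} q0 / l0" by simp
  qed
  have R: "q absolutely_integrable_on {0..l0 * x}" "integral {0..l0 * x} q = integral {0..x} q0 / l0"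
    if x: "x \<in> {0..1}" for x
    using abs_integrable_substitution[OF dl injl rsub(1)[OF x]] rsub(2)[OF x] img[OF x] by auto
  have R2: "(\<lambda>y. (q y)\<^sup>2) absolutely_integrable_on {0..l0}"
    "integral {0..l0} (\<lambda>y. (q y)\<^sup>2) = integral {0..1} (\<lambda>x. (q0 x)\<^sup>2) / l0 ^ 3"
  proof -
    have eq: "\<bar>l0\<bar> * (q (l0 * y))\<^sup>2 = (1 / l0 ^ 3) * (q0 y)\<^sup>2" if "y \<in> {0..1}" for y
      using q_right[of y] that pos by (auto simp: field_simps eval_nat_numeral)
    have "(\<lambda>x. (q0 x)\<^sup>2) absolutely_integrable_on {0..1}"
      using H2_triple_integrable_sq(3)[OF f0] by (auto intro: nonnegative_absolutely_integrable_1)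
    then have a: "(\<lambda>y. \<bar>l0\<bar> * (q (l0 * y))\<^sup>2) absolutely_integrable_on {0..1}"
      by (subst set_integrable_cong[OF refl refl eq]) auto
    have "integral {0..1} (\<lambda>y. \<bar>l0\<bar> * (q (l0 * y))\<^sup>2) = integral {0..1} (\<lambda>y. (1 / l0 ^ 3) * (q0 y)\<^sup>2)"
      by (rule Henstock_Kurzweil_Integration.integral_cong) (rule eq)
    then show "(\<lambda>y. (q y)\<^sup>2) absolutely_integrable_on {0..l0}"
      "integral {0..l0} (\<lambda>y. (q y)\<^sup>2) = integral {0..1} (\<lambda>x. (q0 x)\<^sup>2) / l0 ^ 3"
      using abs_integrable_substitution[OF dl injl a] img[of 1] by auto
  qed

  \<comment> \<open>On the left of \<open>0\<close>, substitute \<open>y = - M t\<close>. The point \<open>t = 0\<close> is excluded from the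
     formula for \<open>q\<close>, since \<open>q 0\<close> is given by the datum on the right.\<close>
  have nMD: "((\<lambda>s. - M s) has_real_derivative - (\<zeta> * N s)) (at s within {0..t})" if "s \<in> {0..t}" "t \<in> {0..T}" for s t
    using DERIV_minus[OF DERIV_subset[OF MD]] that by auto
  have lsub: "(\<lambda>s. \<bar>- (\<zeta> * N s)\<bar> * q (- M s)) absolutely_integrable_on {0..t}"
    "integral {0..t} (\<lambda>s. \<bar>- (\<zeta> * N s)\<bar> * q (- M s)) = - integral {0..t} \<rho>" if t: "t \<in> {0..T}" for t
  proof -
    have eq: "\<bar>- (\<zeta> * N s)\<bar> * q (- M s) = - \<rho> s" if "s \<in> {0..t} - {0}" for s
      using q_left[of s] that t pos Npos[of s] by (auto simp: field_simps abs_mult)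
    have \<rho>t: "(\<lambda>s. - \<rho> s) absolutely_integrable_on {0..t}"
      using t set_integrable_mult_right[of "-1" lebesgue "{0..t}" \<rho>, OF absolutely_integrable_on_subinterval[OF \<rho>_ai]] by auto
    show "(\<lambda>s. \<bar>- (\<zeta> * N s)\<bar> * q (- M s)) absolutely_integrable_on {0..t}"
      by (rule absolutely_integrable_spike[OF \<rho>t negligible_sing]) (use eq in auto)
    have "integral {0..t} (\<lambda>s. \<bar>- (\<zeta> * N s)\<bar> * q (- M s)) = integral {0..t} (\<lambda>s. - \<rho> s)"
      by (rule integral_spike[OF negligible_sing[of 0]]) (use eq in auto)
    then show "integral {0..t} (\<lambda>s. \<bar>- (\<zeta> * N s)\<bar> * q (- M s)) = - integral {0..t} \<rho>" by simp
  qed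
  have Lft: "q absolutely_integrable_on {- M t..0}" "integral {- M t..0} q = - integral {0..t} \<rho>"
    if t: "t \<in> {0..T}" for t
    using abs_integrable_substitution[OF nMD[OF _ t] nMinj[OF t] lsub(1)[OF t]] lsub(2)[OF t] Mimg[OF t] by auto
  let ?G = "\<lambda>t. 2 / (\<zeta> * n0) ^ 3 * ((g2 t)\<^sup>2 + (k / n0)\<^sup>2 * (g1 t)\<^sup>2)"
  have G: "(?G has_integral 2 / (\<zeta> * n0) ^ 3 * (integral {0..T} (\<lambda>t. (g2 t)\<^sup>2) + (k / n0)\<^sup>2 * integral {0..T} (\<lambda>t. (g1 t)\<^sup>2))) {0..T}"
    by (intro has_integral_mult_right has_integral_add integrable_integral H2_triple_integrable_sq[OF g])
  have L2: "(\<lambda>y. (q y)\<^sup>2) absolutely_integrable_on {- m..0}"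
    "integral {- m..0} (\<lambda>y. (q y)\<^sup>2) \<le> 2 / (\<zeta> * n0) ^ 3 * (integral {0..T} (\<lambda>t. (g2 t)\<^sup>2) + (k / n0)\<^sup>2 * integral {0..T} (\<lambda>t. (g1 t)\<^sup>2))"
  proof -
    let ?h = "\<lambda>s. (1 / (\<zeta> * N s)) * (\<rho> s)\<^sup>2"
    have eq: "\<bar>- (\<zeta> * N s)\<bar> * (q (- M s))\<^sup>2 = ?h s" if "s \<in> {0..T} - {0}" for s
    proof -
      have qs: "q (- M s) = - \<rho> s / (\<zeta> * N s)" using that by (intro q_left) auto
      show ?thesis unfolding qs using that pos Npos[of s] by (auto simp: field_simps abs_mult power2_eq_square)
    qed
    have hb: "norm (?h s) \<le> ?G s" if s: "s \<in> {0..T}" for s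
    proof -
      have n: "n0 \<le> N s" "0 < N s" using N(2)[OF s] Npos[OF s] by auto
      have "(\<zeta> * N s * \<rho> s)\<^sup>2 = (g1 s * (N' s / N s) - g2 s)\<^sup>2"
        using n pos by (simp add: \<rho>_def field_simps power2_eq_square)
      also have "\<dots> \<le> 2 * ((g2 s)\<^sup>2 + (g1 s * (N' s / N s))\<^sup>2)"
        using square_diff_le[of "g1 s * (N' s / N s)" "g2 s"] by simp
      also have "(g1 s * (N' s / N s))\<^sup>2 \<le> (k / n0)\<^sup>2 * (g1 s)\<^sup>2"
      proof -
        have "\<bar>N' s / N s\<bar> \<le> k / n0" using n N(3)[of s] pos by (auto simp: abs_divide intro!: frac_le)
        then have "(N' s / N s)\<^sup>2 \<le> (k / n0)\<^sup>2" by (metis abs_ge_zero power2_abs power_mono)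
        then show ?thesis
          unfolding power_mult_distrib[of "g1 s"] mult.commute[of "(g1 s)\<^sup>2"] by (rule mult_right_mono) simp
      qed
      finally have b: "(\<zeta> * N s * \<rho> s)\<^sup>2 \<le> 2 * ((g2 s)\<^sup>2 + (k / n0)\<^sup>2 * (g1 s)\<^sup>2)" by simp
      have "norm (?h s) = (1 / (\<zeta> * N s) ^ 3) * (\<zeta> * N s * \<rho> s)\<^sup>2"
        using n pos by (simp add: field_simps eval_nat_numeral)
      also have "\<dots> \<le> (1 / (\<zeta> * n0) ^ 3) * (2 * ((g2 s)\<^sup>2 + (k / n0)\<^sup>2 * (g1 s)\<^sup>2))"
        using n pos by (intro mult_mono b divide_left_mono power_mono mult_left_mono mult_pos_pos zero_less_power) auto
      finally show ?thesis by simp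
    qed
    have hm: "?h \<in> borel_measurable (lebesgue_on {0..T})"
    proof (intro borel_measurable_times borel_measurable_power)
      show "(\<lambda>s. 1 / (\<zeta> * N s)) \<in> borel_measurable (lebesgue_on {0..T})"
        using Npos pos by (intro continuous_imp_measurable_on_sets_lebesgue continuous_intros Nc) force+
      show "\<rho> \<in> borel_measurable (lebesgue_on {0..T})"
        by (rule absolutely_integrable_imp_borel_measurable[OF \<rho>_ai]) simp
    qed
    have h: "?h absolutely_integrable_on {0..T}"
      by (rule measurable_bounded_by_integrable_imp_absolutely_integrable[OF hm _ _ hb]) (use G in auto)
    have a: "(\<lambda>s. \<bar>- (\<zeta> * N s)\<bar> * (q (- M s))\<^sup>2) absolutely_integrable_on {0..T}"
      by (rule absolutely_integrable_spike[OF h negligible_sing]) (use eq in auto)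
    have i: "integral {0..T} (\<lambda>s. \<bar>- (\<zeta> * N s)\<bar> * (q (- M s))\<^sup>2) = integral {0..T} ?h"
      by (rule integral_spike[OF negligible_sing[of 0]]) (use eq in auto)
    have T: "T \<in> {0..T}" using pos by simp
    show "(\<lambda>y. (q y)\<^sup>2) absolutely_integrable_on {- m..0}"
      using abs_integrable_substitution(1)[OF nMD[OF _ T] nMinj[OF T] a] Mimg[OF T] by (simp add: m_def)
    have "integral {- m..0} (\<lambda>y. (q y)\<^sup>2) = integral {0..T} ?h"
      using abs_integrable_substitution(2)[OF nMD[OF _ T] nMinj[OF T] a] i Mimg[OF T] by (simp add: m_def)
    also have "\<dots> \<le> integral {0..T} ?G"
    proof (rule integral_le[OF ii[OF h]])
      show "?G integrable_on {0..T}" using G by blast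
      show "?h s \<le> ?G s" if "s \<in> {0..T}" for s
        using hb[OF that] unfolding real_norm_def by (rule order_trans[OF abs_ge_self])
    qed
    finally show "integral {- m..0} (\<lambda>y. (q y)\<^sup>2) \<le> 2 / (\<zeta> * n0) ^ 3 * (integral {0..T} (\<lambda>t. (g2 t)\<^sup>2) + (k / n0)\<^sup>2 * integral {0..T} (\<lambda>t. (g1 t)\<^sup>2))"
      unfolding integral_unique[OF G] .
  qed

  have q_ai: "q absolutely_integrable_on UNIV"
  proof -
    have "q absolutely_integrable_on ({-m..0} \<union> {0..l0})"
      using Lft(1)[of T] R(1)[of 1] pos by (intro absolutely_integrable_Un) (auto simp: m_def)
    also have "{-m..0} \<union> {0..l0} = {-m..l0}" using m pos by auto
    finally have "(\<lambda>y. if y \<in> {-m..l0} then q y else 0) absolutely_integrable_on UNIV"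
      by (simp only: absolutely_integrable_restrict_UNIV)
    moreover have "(\<lambda>y. if y \<in> {-m..l0} then q y else 0) = q" using q_out by (intro ext) auto
    ultimately show ?thesis by simp
  qed
  have q2: "(\<lambda>y. (q y)\<^sup>2) integrable_on UNIV"
    "integral UNIV (\<lambda>y. (q y)\<^sup>2) = integral {-m..0} (\<lambda>y. (q y)\<^sup>2) + integral {0..l0} (\<lambda>y. (q y)\<^sup>2)"
  proof -
    have "((\<lambda>y. (q y)\<^sup>2) has_integral (integral {-m..0} (\<lambda>y. (q y)\<^sup>2) + integral {0..l0} (\<lambda>y. (q y)\<^sup>2))) {-m..l0}"
      by (rule has_integral_combine[where c = 0]) (use m pos ii[OF L2(1)] ii[OF R2(1)] in auto)
    then have h: "((\<lambda>y. (q y)\<^sup>2) has_integral (integral {-m..0} (\<lambda>y. (q y)\<^sup>2) + integral {0..l0} (\<lambda>y. (q y)\<^sup>2))) UNIV"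
      by (rule has_integral_on_superset) (use q_out in auto)
    then show "(\<lambda>y. (q y)\<^sup>2) integrable_on UNIV" by blast
    show "integral UNIV (\<lambda>y. (q y)\<^sup>2) = integral {-m..0} (\<lambda>y. (q y)\<^sup>2) + integral {0..l0} (\<lambda>y. (q y)\<^sup>2)"
      using h by (rule integral_unique)
  qed
  have q_sub: "q absolutely_integrable_on S" if "S \<in> sets lebesgue" for S
    by (rule set_integrable_subset[OF q_ai that]) simp
  define p where "p y = p0 0 / l0 - integral {..0} q + integral {..y} q" for y
  have p_diff: "p y = p x + integral {x..y} q" if "x \<le> y" for x y
  proof -
    have "integral ({..x} \<union> {x..y}) q = integral {..x} q + integral {x..y} q"
      by (rule Henstock_Kurzweil_Integration.integral_Un)
        (auto intro!: ii[OF q_sub] negligible_subset[OF negligible_sing[of x]])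
    moreover have "{..x} \<union> {x..y} = {..y}" using that by auto
    ultimately show ?thesis by (simp add: p_def)
  qed
  have p_ac: "AC_on x y p q" for x y
    unfolding AC_on_def by (intro conjI ballI q_sub p_diff) auto
  have p_0: "p 0 = p0 0 / l0" by (simp add: p_def)
  have "isCont p x" for x
    using AC_on_continuous[OF p_ac, of "x - 1" "x + 1"]
    by (rule continuous_on_interior) (simp add: interior_atLeastAtMost_real)
  then obtain \<phi>0 where \<phi>0: "\<And>x. (\<phi>0 has_real_derivative p x) (at x)"
    using einterval_antiderivative[of "-\<infinity>" "\<infinity>" p]
    by (auto simp: has_real_derivative_iff_has_vector_derivative)
  define \<phi> where "\<phi> y = fp0 0 - \<phi>0 0 + \<phi>0 y" for y
  have \<phi>D: "(\<phi> has_real_derivative p y) (at y)" for y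
    unfolding \<phi>_def using DERIV_add[OF DERIV_const \<phi>0] by simp
  show ?thesis
  proof (rule that[of \<phi> p q])
    show "q \<in> borel_measurable lebesgue"
      using absolutely_integrable_imp_borel_measurable[OF q_ai] by simp
    show "\<phi> (l0 * x) = fp0 x" if x: "x \<in> {0..1}" for x
    proof (rule constant_difference_if_DERIV_eq[OF _ _ _ x])
      fix y :: real assume y: "y \<in> {0..1}"
      show "(fp0 has_real_derivative p0 y) (at y within {0..1})" using f0 y by (simp add: H2_triple_def)
      have "p (l0 * y) = p0 0 / l0 + integral {0..y} q0 / l0"
        using p_diff[of 0 "l0 * y"] R(2)[OF y] y pos p_0 by simp
      also have "\<dots> = p0 y / l0"
        using AC_on_eq[OF p0_ac, of y] y by (simp add: add_divide_distrib)
      finally have "p (l0 * y) * l0 = p0 y" using pos by simp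
      then show "((\<lambda>x. \<phi> (l0 * x)) has_real_derivative p0 y) (at y within {0..1})"
        using DERIV_chain2[OF \<phi>D[of "l0 * y"] dl[of y 1]] by simp
    qed (simp add: \<phi>_def)
    show "\<phi> (- M t) = g t" if t: "t \<in> {0..T}" for t
    proof (rule constant_difference_if_DERIV_eq[OF _ _ _ t])
      fix s :: real assume s: "s \<in> {0..T}"
      show "(g has_real_derivative g1 s) (at s within {0..T})" using g s by (simp add: H2_triple_def)
      have "- M s \<le> 0" using Mle[of 0 s] M0 s by auto
      then have "p (- M s) = r s"
        using p_diff[of "- M s" 0] Lft(2)[OF s] p_0 by (simp add: r_def)
      then have "p (- M s) * - (\<zeta> * N s) = g1 s" using g1_eq[OF s] by simp
      then show "((\<lambda>t. \<phi> (- M t)) has_real_derivative g1 s) (at s within {0..T})"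
        using DERIV_chain2[OF \<phi>D nMD[OF s]] pos by simp
    qed (simp add: \<phi>_def M0 comp0)
    show "integral UNIV (\<lambda>y. (q y)\<^sup>2) \<le> integral {0..1} (\<lambda>x. (q0 x)\<^sup>2) / l0 ^ 3 +
        2 / (\<zeta> * n0) ^ 3 * (integral {0..T} (\<lambda>t. (g2 t)\<^sup>2) + (k / n0)\<^sup>2 * integral {0..T} (\<lambda>t. (g1 t)\<^sup>2))"
      using q2(2) R2(2) L2(2) by linarith
  qed (fact \<phi>D p_ac q2 p_0)+
qed

section \<open>Weak derivatives on a rectangle\<close>

lemma unit_rectangle_box: "{0<..<T::real} \<times> {0<..<1::real} = box (0, 0) (T, 1)"
  by (simp add: box_prod)

lemma unit_rectangle_cbox: "{0..T::real} \<times> {0..1::real} = cbox (0, 0) (T, 1)"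
  by (simp add: cbox_prod)

lemma lebesgue_on_box_integral:
  fixes f :: "'a::euclidean_space \<Rightarrow> real"
  assumes "continuous_on (cbox a b) f"
  shows "integrable (lebesgue_on (box a b)) f"
    and "(\<integral>x. f x \<partial>lebesgue_on (box a b)) = integral (cbox a b) f"
proof -
  have "f absolutely_integrable_on (cbox a b)" by (rule absolutely_integrable_continuous[OF assms])
  then have "f absolutely_integrable_on (box a b)" by (simp add: absolutely_integrable_on_open_interval)
  then show i: "integrable (lebesgue_on (box a b)) f"
    by (rule absolutely_integrable_imp_integrable) simp
  show "(\<integral>x. f x \<partial>lebesgue_on (box a b)) = integral (cbox a b) f"
    using lebesgue_integral_eq_integral[OF i] by (simp add: integral_open_interval)
qed

text \<open>For functions continuous up to the boundary the definition of the weak derivative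
  becomes the vanishing of Henstock-Kurzweil integrals over closed boxes, for which iterated
  integration is available.\<close>

lemma has_weak_deriv_box_iff:
  fixes u v :: "'a::euclidean_space \<Rightarrow> real"
  assumes u: "continuous_on (cbox a b) u" and v: "continuous_on (cbox a b) v" and i: "i \<in> Basis"
  shows "has_weak_deriv (box a b) i u v \<longleftrightarrow>
    (\<forall>\<phi>\<in>C1c (box a b). integral (cbox a b) (\<lambda>z. u z * frechet_derivative \<phi> (at z) i + v z * \<phi> z) = 0)"
proof -
  have "(\<integral>x. u x * frechet_derivative \<phi> (at x) i \<partial>lebesgue_on (box a b)) = - (\<integral>x. v x * \<phi> x \<partial>lebesgue_on (box a b)) \<longleftrightarrow>
     integral (cbox a b) (\<lambda>z. u z * frechet_derivative \<phi> (at z) i + v z * \<phi> z) = 0"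
    if "\<phi> \<in> C1c (box a b)" for \<phi>
  proof -
    have c: "continuous_on (cbox a b) (\<lambda>z. u z * frechet_derivative \<phi> (at z) i)" "continuous_on (cbox a b) (\<lambda>z. v z * \<phi> z)"
      by (intro continuous_intros u v C1c_continuous_deriv[OF that i] C1c_continuous[OF that])+
    show ?thesis
      using lebesgue_on_box_integral[OF c(1)] lebesgue_on_box_integral[OF c(2)]
      by (simp add: Henstock_Kurzweil_Integration.integral_add integrable_continuous c eq_neg_iff_add_eq_0)
  qed
  then show ?thesis
    using lebesgue_on_box_integral[OF u] lebesgue_on_box_integral[OF v] by (auto simp: has_weak_deriv_def)
qed

lemma C1c_partial:
  fixes \<phi> :: "real \<times> real \<Rightarrow> real"
  assumes "\<phi> \<in> C1c \<Omega>"
  shows "((\<lambda>s. \<phi> (s, x)) has_real_derivative frechet_derivative \<phi> (at (t, x)) (1, 0)) (at t)"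
    and "((\<lambda>y. \<phi> (t, y)) has_real_derivative frechet_derivative \<phi> (at (t, x)) (0, 1)) (at x)"
proof -
  have D: "(\<phi> has_derivative frechet_derivative \<phi> (at (t, x))) (at (t, x))"
    using assms by (intro C1_has_derivative) (auto simp: C1c_def C1_def)
  have lin: "linear (frechet_derivative \<phi> (at (t, x)))"
    using D has_derivative_linear by blast
  have "((\<lambda>s. \<phi> (s, x)) has_derivative (\<lambda>h. frechet_derivative \<phi> (at (t, x)) (h, 0))) (at t)"
    by (rule has_derivative_compose[where g = \<phi> and f = "\<lambda>s. (s, x)"]) (auto intro!: derivative_eq_intros D)
  moreover have "frechet_derivative \<phi> (at (t, x)) (h, 0) = frechet_derivative \<phi> (at (t, x)) (1, 0) * h" for h
    using linear_scale[OF lin, of h "(1, 0)"] by simp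
  ultimately show "((\<lambda>s. \<phi> (s, x)) has_real_derivative frechet_derivative \<phi> (at (t, x)) (1, 0)) (at t)"
    unfolding has_field_derivative_def by (rule has_derivative_eq_rhs[OF _ ext])
  have "((\<lambda>y. \<phi> (t, y)) has_derivative (\<lambda>h. frechet_derivative \<phi> (at (t, x)) (0, h))) (at x)"
    by (rule has_derivative_compose[where g = \<phi> and f = "\<lambda>y. (t, y)"]) (auto intro!: derivative_eq_intros D)
  moreover have "frechet_derivative \<phi> (at (t, x)) (0, h) = frechet_derivative \<phi> (at (t, x)) (0, 1) * h" for h
    using linear_scale[OF lin, of h "(0, 1)"] by simp
  ultimately show "((\<lambda>y. \<phi> (t, y)) has_real_derivative frechet_derivative \<phi> (at (t, x)) (0, 1)) (at x)"
    unfolding has_field_derivative_def by (rule has_derivative_eq_rhs[OF _ ext])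
qed

lemma integral_by_parts_test:
  fixes u u' \<psi> \<psi>' :: "real \<Rightarrow> real"
  assumes "a \<le> b" "continuous_on {a..b} u" "continuous_on {a..b} \<psi>"
    and "\<And>x. x \<in> {a<..<b} \<Longrightarrow> (u has_real_derivative u' x) (at x)"
    and "\<And>x. x \<in> {a<..<b} \<Longrightarrow> (\<psi> has_real_derivative \<psi>' x) (at x)"
    and "\<psi> a = 0" "\<psi> b = 0"
  shows "integral {a..b} (\<lambda>x. u x * \<psi>' x + u' x * \<psi> x) = 0"
proof -
  have "((\<lambda>x. u x * \<psi>' x + u' x * \<psi> x) has_integral (u b * \<psi> b - u a * \<psi> a)) {a..b}"
  proof (rule fundamental_theorem_of_calculus_interior)
    fix x assume x: "x \<in> {a<..<b}"
    show "((\<lambda>x. u x * \<psi> x) has_vector_derivative u x * \<psi>' x + u' x * \<psi> x) (at x)"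
      unfolding has_real_derivative_iff_has_vector_derivative[symmetric]
      by (rule DERIV_cong[OF DERIV_mult[OF assms(4)[OF x] assms(5)[OF x]]]) simp
  qed (use assms in \<open>auto intro!: continuous_intros\<close>)
  then show ?thesis using assms(6,7) by (simp add: integral_unique)
qed

lemma continuous_on_slice:
  assumes "continuous_on (A \<times> B) w"
  shows "t \<in> A \<Longrightarrow> continuous_on B (\<lambda>x. w (t, x))" and "x \<in> B \<Longrightarrow> continuous_on A (\<lambda>t. w (t, x))"
  by (rule continuous_on_compose2[OF assms]; auto intro!: continuous_intros)+

text \<open>Integration by parts on every line parallel to the direction of differentiation, where
  the test function vanishes at both ends; then integration over all lines. The same
  reasoning gives the time derivative below.\<close>

lemma has_weak_deriv_space:
  fixes u v :: "real \<Rightarrow> real \<Rightarrow> real"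
  assumes T: "0 < T" and u: "continuous_on ({0..T} \<times> {0..1}) (\<lambda>(t, x). u t x)"
    and v: "continuous_on ({0..T} \<times> {0..1}) (\<lambda>(t, x). v t x)"
    and D: "\<And>t x. t \<in> {0..T} \<Longrightarrow> x \<in> {0<..<1} \<Longrightarrow> (u t has_real_derivative v t x) (at x)"
  shows "has_weak_deriv ({0<..<T} \<times> {0<..<1}) (0, 1) (\<lambda>(t, x). u t x) (\<lambda>(t, x). v t x)"
  unfolding unit_rectangle_box
proof (subst has_weak_deriv_box_iff)
  show "\<forall>\<phi>\<in>C1c (box (0, 0) (T, 1)). integral (cbox (0, 0) (T, 1)) (\<lambda>z. (case z of (t, x) \<Rightarrow> u t x) *
     frechet_derivative \<phi> (at z) (0, 1) + (case z of (t, x) \<Rightarrow> v t x) * \<phi> z) = 0"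
  proof
    fix \<phi> :: "real \<times> real \<Rightarrow> real" assume \<phi>: "\<phi> \<in> C1c (box (0, 0) (T, 1))"
    let ?w = "\<lambda>z. (case z of (t, x) \<Rightarrow> u t x) * frechet_derivative \<phi> (at z) (0, 1) + (case z of (t, x) \<Rightarrow> v t x) * \<phi> z"
    have "continuous_on (cbox (0, 0) (T, 1)) ?w"
      using u v unfolding unit_rectangle_cbox
      by (intro continuous_intros C1c_continuous[OF \<phi>] C1c_continuous_deriv[OF \<phi>]) (auto simp: Basis_prod_def)
    from integral_prod_continuous[OF this]
    have "integral (cbox (0, 0) (T, 1)) ?w = integral {0..T} (\<lambda>t. integral {0..1} (\<lambda>x. ?w (t, x)))" by simp
    also have "\<dots> = integral {0..T} (\<lambda>t. 0)"
    proof (rule Henstock_Kurzweil_Integration.integral_cong)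
      fix t assume t: "t \<in> {0..T}"
      show "integral {0..1} (\<lambda>x. ?w (t, x)) = 0"
        unfolding prod.case
        by (rule integral_by_parts_test)
          (use t D continuous_on_slice(1)[OF u t] C1c_partial(2)[OF \<phi>] C1c_continuous[OF \<phi>, of UNIV] in
            \<open>auto intro!: C1c_outside[OF \<phi>] continuous_on_compose2[OF C1c_continuous[OF \<phi>, of UNIV]] continuous_intros simp: box_prod\<close>)
    qed
    finally show "integral (cbox (0, 0) (T, 1)) ?w = 0" by simp
  qed
qed (use u v in \<open>auto simp: unit_rectangle_cbox Basis_prod_def\<close>)

lemma has_weak_deriv_time:
  fixes u v :: "real \<Rightarrow> real \<Rightarrow> real"
  assumes T: "0 < T" and u: "continuous_on ({0..T} \<times> {0..1}) (\<lambda>(t, x). u t x)"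
    and v: "continuous_on ({0..T} \<times> {0..1}) (\<lambda>(t, x). v t x)"
    and D: "\<And>t x. t \<in> {0<..<T} \<Longrightarrow> x \<in> {0..1} \<Longrightarrow> ((\<lambda>s. u s x) has_real_derivative v t x) (at t)"
  shows "has_weak_deriv ({0<..<T} \<times> {0<..<1}) (1, 0) (\<lambda>(t, x). u t x) (\<lambda>(t, x). v t x)"
  unfolding unit_rectangle_box
proof (subst has_weak_deriv_box_iff)
  show "\<forall>\<phi>\<in>C1c (box (0, 0) (T, 1)). integral (cbox (0, 0) (T, 1)) (\<lambda>z. (case z of (t, x) \<Rightarrow> u t x) *
     frechet_derivative \<phi> (at z) (1, 0) + (case z of (t, x) \<Rightarrow> v t x) * \<phi> z) = 0"
  proof
    fix \<phi> :: "real \<times> real \<Rightarrow> real" assume \<phi>: "\<phi> \<in> C1c (box (0, 0) (T, 1))"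
    let ?w = "\<lambda>z. (case z of (t, x) \<Rightarrow> u t x) * frechet_derivative \<phi> (at z) (1, 0) + (case z of (t, x) \<Rightarrow> v t x) * \<phi> z"
    have wc: "continuous_on (cbox (0, 0) (T, 1)) ?w"
      using u v unfolding unit_rectangle_cbox
      by (intro continuous_intros C1c_continuous[OF \<phi>] C1c_continuous_deriv[OF \<phi>]) (auto simp: Basis_prod_def)
    then have wc': "continuous_on (cbox (0, 0) (T, 1)) (\<lambda>(t, x). ?w (t, x))" by (simp add: case_prod_beta)
    have "integral (cbox (0, 0) (T, 1)) ?w = integral {0..1} (\<lambda>x. integral {0..T} (\<lambda>t. ?w (t, x)))"
      using integral_prod_continuous[OF wc] integral_swap_continuous[OF wc'] by simp
    also have "\<dots> = integral {0..1} (\<lambda>x::real. 0)"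
    proof (rule Henstock_Kurzweil_Integration.integral_cong)
      fix x :: real assume x: "x \<in> {0..1}"
      show "integral {0..T} (\<lambda>t. ?w (t, x)) = 0"
        unfolding prod.case
        by (rule integral_by_parts_test)
          (use x T D continuous_on_slice(2)[OF u x] C1c_partial(1)[OF \<phi>] in
            \<open>auto intro!: C1c_outside[OF \<phi>] continuous_on_compose2[OF C1c_continuous[OF \<phi>, of UNIV]] continuous_intros simp: box_prod\<close>)
    qed
    finally show "integral (cbox (0, 0) (T, 1)) ?w = 0" by simp
  qed
qed (use u v in \<open>auto simp: unit_rectangle_cbox Basis_prod_def\<close>)

lemma C1c_tensor:
  fixes a b :: "real \<Rightarrow> real"
  assumes a: "a \<in> C1c A" and b: "b \<in> C1c B"
  shows "(\<lambda>z. a (fst z) * b (snd z)) \<in> C1c (A \<times> B)"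
    and "frechet_derivative (\<lambda>z. a (fst z) * b (snd z)) (at (t, x)) (1, 0) = frechet_derivative a (at t) 1 * b x"
proof -
  have C: "C1 (\<lambda>z::real \<times> real. a (z \<bullet> (1, 0)))" "C1 (\<lambda>z::real \<times> real. b (z \<bullet> (0, 1)))"
    using C1c_real[OF a] C1c_real[OF b]
    by (auto intro!: C1_compose_real[of _ a "\<lambda>t. frechet_derivative a (at t) 1"]
        C1_compose_real[of _ b "\<lambda>t. frechet_derivative b (at t) 1"] C1_inner)
  have C1: "C1 (\<lambda>z. a (fst z) * b (snd z))"
    using C1_mult[OF C] by (simp add: inner_prod_def)
  moreover have sub: "closure {z. a (fst z) * b (snd z) \<noteq> 0} \<subseteq> closure {t. a t \<noteq> 0} \<times> closure {x. b x \<noteq> 0}"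
    using closure_subset[of "{t. a t \<noteq> 0}"] closure_subset[of "{x. b x \<noteq> 0}"]
    by (intro closure_minimal closed_Times) auto
  moreover have "compact (closure {t. a t \<noteq> 0} \<times> closure {x. b x \<noteq> 0})"
    using a b by (intro compact_Times) (auto simp: C1c_def)
  then have "compact (closure {z. a (fst z) * b (snd z) \<noteq> 0})"
    unfolding compact_eq_bounded_closed using bounded_subset[OF _ sub] by blast
  ultimately show m: "(\<lambda>z. a (fst z) * b (snd z)) \<in> C1c (A \<times> B)"
    using a b unfolding C1c_def C1_def by auto
  have "((\<lambda>s. a s * b x) has_real_derivative frechet_derivative a (at t) 1 * b x) (at t)"
    by (auto intro!: derivative_eq_intros C1c_real(1)[OF a])
  with C1c_partial(1)[OF m, of x t]
  show "frechet_derivative (\<lambda>z. a (fst z) * b (snd z)) (at (t, x)) (1, 0) = frechet_derivative a (at t) 1 * b x"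
    by (intro DERIV_unique[of "\<lambda>s. a s * b x" _ t]) auto
qed

text \<open>Conversely, products \<open>a t * b x\<close> as test functions separate the variables. For fixed
  \<open>a\<close> the integral over time is a continuous function of \<open>x\<close> that annihilates all \<open>b\<close>, hence
  vanishes for every \<open>x\<close>; as \<open>a\<close> is arbitrary, \<open>h\<close> is a weak derivative of \<open>u\<close> along every single
  line.\<close>

lemma weak_time_deriv_imp_AC:
  fixes u h :: "real \<Rightarrow> real \<Rightarrow> real"
  assumes T: "0 < T" and u: "continuous_on ({0..T} \<times> {0..1}) (\<lambda>(t, x). u t x)"
    and h: "continuous_on ({0..T} \<times> {0..1}) (\<lambda>(t, x). h t x)"
    and wd: "has_weak_deriv ({0<..<T} \<times> {0<..<1}) (1, 0) (\<lambda>(t, x). u t x) (\<lambda>(t, x). h t x)"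
    and x: "x \<in> {0..1}"
  shows "AC_on 0 T (\<lambda>t. u t x) (\<lambda>t. h t x)"
proof -
  have "has_weak_deriv (box 0 T) 1 (\<lambda>t. u t x) (\<lambda>t. h t x)"
  proof (subst has_weak_deriv_box_iff)
    show "\<forall>a\<in>C1c (box 0 T). integral (cbox 0 T) (\<lambda>t. u t x * frechet_derivative a (at t) 1 + h t x * a t) = 0"
    proof
      fix a :: "real \<Rightarrow> real" assume a: "a \<in> C1c (box 0 T)"
      let ?H = "\<lambda>x. integral {0..T} (\<lambda>t. u t x * frechet_derivative a (at t) 1 + h t x * a t)"
      have wc: "continuous_on ({0..T} \<times> {0..1}) (\<lambda>(t, x). u t x * frechet_derivative a (at t) 1 + h t x * a t)"
      proof -
        have a1: "continuous_on UNIV (\<lambda>t. frechet_derivative a (at t) 1)" "continuous_on UNIV a"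
          using C1c_continuous_deriv[OF a] C1c_continuous[OF a] by auto
        have "continuous_on ({0..T} \<times> {0..1}) (\<lambda>z. (\<lambda>(t, x). u t x) z * frechet_derivative a (at (fst z)) 1 + (\<lambda>(t, x). h t x) z * a (fst z))"
          by (intro continuous_on_add continuous_on_mult u h continuous_on_compose2[OF a1(1)] continuous_on_compose2[OF a1(2)] continuous_intros) auto
        then show ?thesis by (simp add: case_prod_beta)
      qed
      have Hc: "continuous_on {0..1} ?H"
      proof -
        have "continuous_on ({0..1} \<times> cbox 0 T) (\<lambda>(x, t). u t x * frechet_derivative a (at t) 1 + h t x * a t)"
        proof -
          have "continuous_on ({0..1} \<times> {0..T}) (\<lambda>z. (\<lambda>(t, x). u t x * frechet_derivative a (at t) 1 + h t x * a t) (snd z, fst z))"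
            by (rule continuous_on_compose2[OF wc]) (auto intro!: continuous_intros)
          then show ?thesis by (simp add: case_prod_beta)
        qed
        from integral_continuous_on_param[OF this] show ?thesis by simp
      qed
      have "AE x in lebesgue_on (box 0 1). ?H x = 0"
      proof (rule fundamental_lemma)
        show "integrable (lebesgue_on (box 0 1)) ?H" using lebesgue_on_box_integral(1)[of 0 1 ?H] Hc by simp
        fix b :: "real \<Rightarrow> real" assume b: "b \<in> C1c (box 0 1)"
        let ?\<phi> = "\<lambda>z. a (fst z) * b (snd z)"
        have \<phi>: "?\<phi> \<in> C1c (box (0, 0) (T, 1))" using C1c_tensor(1)[OF a b] by (simp add: box_prod)
        have bc: "continuous_on UNIV b" by (rule C1c_continuous[OF b])
        let ?w = "\<lambda>z. (case z of (t, x) \<Rightarrow> u t x) * frechet_derivative ?\<phi> (at z) (1, 0) + (case z of (t, x) \<Rightarrow> h t x) * ?\<phi> z"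
        have w0: "integral (cbox (0, 0) (T, 1)) ?w = 0"
          using wd \<phi> has_weak_deriv_box_iff[of "(0, 0)" "(T, 1)" "\<lambda>(t, x). u t x" "\<lambda>(t, x). h t x" "(1, 0)"] u h
          unfolding unit_rectangle_box unit_rectangle_cbox by (auto simp: Basis_prod_def)
        have weq: "?w (t, x) = (u t x * frechet_derivative a (at t) 1 + h t x * a t) * b x" for t x
          using C1c_tensor(2)[OF a b] by (simp add: algebra_simps)
        have wc2: "continuous_on (cbox (0, 0) (T, 1)) (\<lambda>(t, x). (u t x * frechet_derivative a (at t) 1 + h t x * a t) * b x)"
        proof -
          have "continuous_on ({0..T} \<times> {0..1}) (\<lambda>z. (\<lambda>(t, x). u t x * frechet_derivative a (at t) 1 + h t x * a t) z * b (snd z))"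
            by (intro continuous_on_mult wc continuous_on_compose2[OF bc] continuous_intros) auto
          then show ?thesis by (simp add: case_prod_beta unit_rectangle_cbox)
        qed
        have "?w = (\<lambda>(t, x). (u t x * frechet_derivative a (at t) 1 + h t x * a t) * b x)"
          using weq by (auto simp: fun_eq_iff)
        then have "0 = integral (cbox (0, 0) (T, 1)) (\<lambda>(t, x). (u t x * frechet_derivative a (at t) 1 + h t x * a t) * b x)"
          using w0 by simp
        also have "\<dots> = integral {0..1} (\<lambda>x. integral {0..T} (\<lambda>t. (u t x * frechet_derivative a (at t) 1 + h t x * a t) * b x))"
          using integral_prod_continuous[OF wc2] integral_swap_continuous[OF wc2] by simp
        also have "\<dots> = integral {0..1} (\<lambda>x. ?H x * b x)" by simp
        also have "\<dots> = (\<integral>x. ?H x * b x \<partial>lebesgue_on (box 0 1))"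
        proof -
          have "continuous_on (cbox 0 1) (\<lambda>x. ?H x * b x)"
            using Hc by (intro continuous_intros) (auto intro: continuous_on_subset[OF bc])
          from lebesgue_on_box_integral(2)[OF this] show ?thesis by simp
        qed
        finally show "(\<integral>x. ?H x * b x \<partial>lebesgue_on (box 0 1)) = 0" by simp
      qed
      from continuous_AE_zero_imp_zero[OF _ this, of x] x Hc show "integral (cbox 0 T) (\<lambda>t. u t x * frechet_derivative a (at t) 1 + h t x * a t) = 0"
        by simp
    qed
  qed (use continuous_on_slice(2)[OF u x] continuous_on_slice(2)[OF h x] in auto)
  then have "has_weak_deriv {0<..<T} 1 (\<lambda>t. u t x) (\<lambda>t. h t x)" by (simp only: box_real)
  then show ?thesis
    using T continuous_on_slice(2)[OF u x] by (intro has_weak_deriv_continuous_imp_AC) auto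
qed

lemma has_weak_deriv_cong_AE_deriv:
  fixes f :: "'a::euclidean_space \<Rightarrow> real"
  assumes f: "has_weak_deriv \<Omega> i f g" and ae: "AE x in lebesgue_on \<Omega>. g x = g' x"
    and m: "g' \<in> borel_measurable (lebesgue_on \<Omega>)"
  shows "has_weak_deriv \<Omega> i f g'"
  unfolding has_weak_deriv_def
proof (intro conjI ballI)
  show "integrable (lebesgue_on \<Omega>) f" using f by (simp add: has_weak_deriv_def)
  show "integrable (lebesgue_on \<Omega>) g'"
    using f m ae by (auto simp: has_weak_deriv_def intro: integrable_cong_AE_imp[of _ g])
  fix \<phi> :: "'a \<Rightarrow> real" assume \<phi>: "\<phi> \<in> C1c \<Omega>"
  have "(\<integral>x. g' x * \<phi> x \<partial>lebesgue_on \<Omega>) = (\<integral>x. g x * \<phi> x \<partial>lebesgue_on \<Omega>)"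
    using f m ae C1c_imp_measurable[OF \<phi>]
    by (intro integral_cong_AE borel_measurable_times) (auto simp: has_weak_deriv_def elim: eventually_mono)
  then show "(\<integral>x. f x * frechet_derivative \<phi> (at x) i \<partial>lebesgue_on \<Omega>) = - (\<integral>x. g' x * \<phi> x \<partial>lebesgue_on \<Omega>)"
    using f \<phi> by (simp add: has_weak_deriv_def)
qed

section \<open>Regularity of H2-valued continuous functions\<close>

lemma jointly_continuousI:
  fixes f :: "real \<Rightarrow> real \<Rightarrow> real"
  assumes c: "\<And>t. t \<in> A \<Longrightarrow> continuous_on B (f t)"
    and unif: "\<And>t. t \<in> A \<Longrightarrow> \<exists>k. (k \<longlongrightarrow> 0) (at t within A) \<and> (\<forall>s\<in>A. \<forall>x\<in>B. \<bar>f s x - f t x\<bar> \<le> k s)"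
  shows "continuous_on (A \<times> B) (\<lambda>(t, x). f t x)"
  unfolding continuous_on_sequentially
proof (intro allI ballI impI)
  fix X :: "nat \<Rightarrow> real \<times> real" and z
  assume z: "z \<in> A \<times> B" and X: "(\<forall>n. X n \<in> A \<times> B) \<and> X \<longlonglongrightarrow> z"
  obtain t x where zt: "z = (t, x)" "t \<in> A" "x \<in> B" using z by auto
  obtain k0 where k0: "(k0 \<longlongrightarrow> 0) (at t within A)" "\<And>s x. s \<in> A \<Longrightarrow> x \<in> B \<Longrightarrow> \<bar>f s x - f t x\<bar> \<le> k0 s"
    using unif[OF zt(2)] by blast
  define k where "k s = (if s = t then 0 else k0 s)" for s
  have k: "(k \<longlongrightarrow> k t) (at t within A)"
  proof -
    have "\<forall>\<^sub>F s in at t within A. k s = k0 s" by (auto simp: k_def eventually_at_filter)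
    then show ?thesis using k0(1) by (subst tendsto_cong) (auto simp: k_def)
  qed
  have kt: "k t = 0" by (simp add: k_def)
  have kb: "\<bar>f s x - f t x\<bar> \<le> k s" if "s \<in> A" "x \<in> B" for s x
    using k0(2)[OF that] by (auto simp: k_def)
  have XA: "fst (X n) \<in> A" "snd (X n) \<in> B" for n using X mem_Times_iff[of "X n" A B] by blast+
  have Xl: "(\<lambda>n. fst (X n)) \<longlonglongrightarrow> t" "(\<lambda>n. snd (X n)) \<longlonglongrightarrow> x"
    using tendsto_fst[of X z sequentially] tendsto_snd[of X z sequentially] X zt(1) by simp_all
  have "continuous (at t within A) k" using k by (simp add: continuous_within)
  then have "(\<lambda>n. k (fst (X n))) \<longlonglongrightarrow> k t"
    using XA Xl unfolding continuous_within_sequentially by (auto simp: o_def)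
  moreover have "(\<lambda>n. f t (snd (X n))) \<longlonglongrightarrow> f t x"
    using c[OF zt(2)] XA Xl zt unfolding continuous_on_sequentially by (auto simp: o_def)
  then have "(\<lambda>n. \<bar>f t (snd (X n)) - f t x\<bar>) \<longlonglongrightarrow> 0"
    by (intro tendsto_rabs_zero LIM_zero)
  ultimately have "(\<lambda>n. k (fst (X n)) + \<bar>f t (snd (X n)) - f t x\<bar>) \<longlonglongrightarrow> k t + 0"
    by (rule tendsto_add)
  then have "(\<lambda>n. k (fst (X n)) + \<bar>f t (snd (X n)) - f t x\<bar>) \<longlonglongrightarrow> 0"
    by (simp add: kt)
  moreover have "norm (f (fst (X n)) (snd (X n)) - f t x) \<le> k (fst (X n)) + \<bar>f t (snd (X n)) - f t x\<bar>" for n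
    using kb[OF XA, of n n] by simp
  ultimately have "(\<lambda>n. f (fst (X n)) (snd (X n)) - f t x) \<longlonglongrightarrow> 0"
    by (rule Lim_null_comparison[OF always_eventually[OF allI], rotated])
  then show "((\<lambda>(t, x). f t x) \<circ> X) \<longlonglongrightarrow> (case z of (t, x) \<Rightarrow> f t x)"
    by (simp add: zt o_def case_prod_beta LIM_zero_iff)
qed

text \<open>By the Sobolev embedding the \<open>H\<^sup>2\<close> norm dominates the supremum norms of the function and
  of its first derivative.\<close>

lemma C0_H2_regular:
  assumes f: "f \<in> C0_H2 T" and c: "\<And>t. t \<in> {0..T} \<Longrightarrow> continuous_on {0..1} (f t)"
  obtains v where "continuous_on ({0..T} \<times> {0..1}) (\<lambda>(t, x). f t x)" "continuous_on ({0..T} \<times> {0..1}) (\<lambda>(t, x). v t x)"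
    "\<And>t x. t \<in> {0..T} \<Longrightarrow> x \<in> {0..1} \<Longrightarrow> (f t has_real_derivative v t x) (at x within {0..1})"
proof -
  have "\<forall>t\<in>{0..T}. \<exists>p q. H2_triple 0 1 (f t) p q"
  proof
    fix t assume t: "t \<in> {0..T}"
    then have "f t \<in> H2 {0<..<1}" using f by (auto simp: C0_H2_def)
    then show "\<exists>p q. H2_triple 0 1 (f t) p q"
      by (rule H2_imp_H2_triple[OF _ c[OF t] zero_less_one]) blast
  qed
  then obtain v w where tr: "\<And>t. t \<in> {0..T} \<Longrightarrow> H2_triple 0 1 (f t) (v t) (w t)" by metis
  have lim: "((\<lambda>s. 2 * H2_norm {0<..<1} (\<lambda>x. f s x - f t x)) \<longlongrightarrow> 0) (at t within {0..T})" if "t \<in> {0..T}" for t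
  proof -
    have "((\<lambda>s. H2_norm {0<..<1} (\<lambda>x. f s x - f t x)) \<longlongrightarrow> 0) (at t within {0..T})"
      using f that by (auto simp: C0_H2_def)
    from tendsto_mult_left[OF this, of 2] show ?thesis by simp
  qed
  have b: "\<bar>f s x - f t x\<bar> \<le> 2 * H2_norm {0<..<1} (\<lambda>x. f s x - f t x)"
    "\<bar>v s x - v t x\<bar> \<le> 2 * H2_norm {0<..<1} (\<lambda>x. f s x - f t x)"
    if "s \<in> {0..T}" "t \<in> {0..T}" "x \<in> {0..1}" for s t x
    using H2_triple_sup_bound[OF H2_triple_diff[OF tr[OF that(1)] tr[OF that(2)]], of x] that
    by (auto simp: real_sqrt_four)
  show ?thesis
  proof (rule that[of v])
    show "continuous_on ({0..T} \<times> {0..1}) (\<lambda>(t, x). f t x)"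
      by (rule jointly_continuousI[OF c]) (use lim b in blast)+
    show "continuous_on ({0..T} \<times> {0..1}) (\<lambda>(t, x). v t x)"
    proof (rule jointly_continuousI)
      show "continuous_on {0..1} (v t)" if "t \<in> {0..T}" for t
        using tr[OF that] AC_on_continuous by (auto simp: H2_triple_def)
    qed (use lim b in blast)
    show "(f t has_real_derivative v t x) (at x within {0..1})" if "t \<in> {0..T}" "x \<in> {0..1}" for t x
      using tr[OF that(1)] that(2) by (simp add: H2_triple_def)
  qed
qed

text \<open>The chain rule in two variables. Derivatives within the rectangle cover characteristics
  that touch its boundary.\<close>

lemma has_real_derivative_along_path:
  fixes f ft fx :: "real \<Rightarrow> real \<Rightarrow> real" and X :: "real \<Rightarrow> real"
  assumes fx: "\<And>t x. t \<in> {a..b} \<Longrightarrow> x \<in> {0..1} \<Longrightarrow> (f t has_real_derivative fx t x) (at x within {0..1})"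
    and ft: "\<And>t x. t \<in> {a..b} \<Longrightarrow> x \<in> {0..1} \<Longrightarrow> ((\<lambda>s. f s x) has_real_derivative ft t x) (at t within {a..b})"
    and fxc: "continuous_on ({a..b} \<times> {0..1}) (\<lambda>(t, x). fx t x)"
    and X: "(X has_real_derivative X') (at t within {a..b})" and t: "t \<in> {a..b}"
    and X_in: "\<And>t. t \<in> {a..b} \<Longrightarrow> X t \<in> {0..1}"
  shows "((\<lambda>t. f t (X t)) has_real_derivative (ft t (X t) + fx t (X t) * X')) (at t within {a..b})"
proof -
  have "((\<lambda>(t, x). f t x) has_derivative (\<lambda>(dt, dx). ft t (X t) * dt + blinfun_scaleR_right (fx t (X t)) dx)) (at (t, X t) within {a..b} \<times> {0..1})"
  proof (rule has_derivative_partialsI)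
    show "((\<lambda>s. f s (X t)) has_derivative (*) (ft t (X t))) (at t within {a..b})"
      using ft[OF t X_in[OF t]] by (simp add: has_field_derivative_def)
    show "(f t has_derivative blinfun_apply (blinfun_scaleR_right (fx t x))) (at x within {0..1})"
      if "t \<in> {a..b}" "x \<in> {0..1}" for t x
    proof -
      have "(*\<^sub>R) (fx t x) = (*) (fx t x)" by (simp add: fun_eq_iff)
      then show ?thesis
        using fx[OF that] by (simp add: has_field_derivative_def blinfun_scaleR_right.rep_eq)
    qed
    have "continuous_on ({a..b} \<times> {0..1}) (\<lambda>z. (blinfun_scaleR_right (case z of (t, x) \<Rightarrow> fx t x)) :: real \<Rightarrow>\<^sub>L real)"
      by (intro bounded_linear.continuous_on[OF bounded_linear_blinfun_scaleR_right] fxc)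
    then show "continuous (at (t, X t) within {a..b} \<times> {0..1}) (\<lambda>(t, x). blinfun_scaleR_right (fx t x) :: real \<Rightarrow>\<^sub>L real)"
      using t X_in[OF t] by (auto simp: continuous_on_eq_continuous_within case_prod_unfold)
  qed (use t X_in in auto)
  then have D: "((\<lambda>(t, x). f t x) has_derivative (\<lambda>(dt, dx). ft t (X t) * dt + fx t (X t) * dx)) (at (t, X t) within {a..b} \<times> {0..1})"
    by (simp add: blinfun_scaleR_right.rep_eq)
  have P: "((\<lambda>s. (s, X s)) has_derivative (\<lambda>h. (h, X' * h))) (at t within {a..b})"
    using X by (auto intro!: derivative_eq_intros simp: has_field_derivative_def)
  have "((\<lambda>s. (\<lambda>(t, x). f t x) (s, X s)) has_derivative (\<lambda>h. (\<lambda>(dt, dx). ft t (X t) * dt + fx t (X t) * dx) (h, X' * h))) (at t within {a..b})"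
    by (rule has_derivative_in_compose[OF P has_derivative_subset[OF D]]) (use X_in in auto)
  moreover have "(\<lambda>h. (\<lambda>(dt, dx). ft t (X t) * dt + fx t (X t) * dx) (h, X' * h)) = (*) (ft t (X t) + fx t (X t) * X')"
    by (auto simp: algebra_simps)
  ultimately show ?thesis by (simp add: has_field_derivative_def)
qed

section \<open>Travelling profiles\<close>

lemma AC_on_affine:
  assumes pq: "\<And>c d. AC_on c d p q" and a: "0 < a"
  shows "AC_on 0 1 (\<lambda>x. p (a * x + b)) (\<lambda>x. a * q (a * x + b))"
proof -
  have img: "(\<lambda>x. a * x + b) ` {0..x} = {b..a * x + b}" if "0 \<le> x" for x
    using that a image_affinity_atLeastAtMost[of a b 0 x] by auto
  have *: "(\<lambda>x. a * q (a * x + b)) absolutely_integrable_on {0..x} \<and>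
     integral {0..x} (\<lambda>x. a * q (a * x + b)) = integral {b..a * x + b} q" if "0 \<le> x" for x
  proof -
    have "(\<lambda>x. \<bar>a\<bar> * q (a * x + b)) absolutely_integrable_on {0..x} \<and>
       integral {0..x} (\<lambda>x. \<bar>a\<bar> * q (a * x + b)) = integral {b..a * x + b} q \<longleftrightarrow>
       q absolutely_integrable_on ((\<lambda>x. a * x + b) ` {0..x}) \<and> integral ((\<lambda>x. a * x + b) ` {0..x}) q = integral {b..a * x + b} q"
      by (rule has_absolute_integral_change_of_variables_1')
        (use a in \<open>auto intro!: derivative_eq_intros inj_onI\<close>)
    then show ?thesis using img[OF that] AC_on_abs_integrable[OF pq] a by simp
  qed
  show ?thesis
    unfolding AC_on_def
  proof (intro conjI ballI)
    show "(\<lambda>x. a * q (a * x + b)) absolutely_integrable_on {0..1}" using *[of 1] by simp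
    fix x :: real assume x: "x \<in> {0..1}"
    have "p (a * x + b) - p b = integral {b..a * x + b} q"
      by (rule AC_on_diff[OF pq[of b "a * x + b"]]) (use x a in auto)
    then show "p (a * x + b) = p (a * 0 + b) + integral {0..x} (\<lambda>x. a * q (a * x + b))"
      using *[of x] x by simp
  qed
qed

lemma square_integrable_affine:
  fixes q :: "real \<Rightarrow> real"
  assumes "(\<lambda>y. (q y)\<^sup>2) integrable_on UNIV" and "0 < a"
  shows "(\<lambda>x. (q (a * x + b))\<^sup>2) integrable_on {0..1}"
    and "integral {0..1} (\<lambda>x. (q (a * x + b))\<^sup>2) \<le> integral UNIV (\<lambda>y. (q y)\<^sup>2) / a"
proof -
  have q2: "(\<lambda>y. (q y)\<^sup>2) absolutely_integrable_on UNIV"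
    using assms(1) by (rule nonnegative_absolutely_integrable_1) auto
  have i: "(\<lambda>x. (q (a * x + b))\<^sup>2) integrable_on UNIV"
    using integral_affine(1)[OF q2 assms(2)] by (rule set_lebesgue_integral_eq_integral)
  then show i01: "(\<lambda>x. (q (a * x + b))\<^sup>2) integrable_on {0..1}"
    by (rule integrable_on_subinterval) simp
  have "integral {0..1} (\<lambda>x. (q (a * x + b))\<^sup>2) \<le> integral UNIV (\<lambda>x. (q (a * x + b))\<^sup>2)"
    using i i01 by (intro integral_subset_le) auto
  then show "integral {0..1} (\<lambda>x. (q (a * x + b))\<^sup>2) \<le> integral UNIV (\<lambda>y. (q y)\<^sup>2) / a"
    using integral_affine(2)[OF q2 assms(2)] by simp
qed

locale H2_profile =
  fixes \<phi> p q :: "real \<Rightarrow> real"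
  assumes D: "\<And>y. (\<phi> has_real_derivative p y) (at y)" and AC: "\<And>x y. AC_on x y p q"
    and q_meas: "q \<in> borel_measurable lebesgue" and q_sq: "(\<lambda>y. (q y)\<^sup>2) integrable_on UNIV"
begin

lemma continuous_p: "continuous_on S p"
proof -
  have "isCont p x" for x
    using AC_on_continuous[OF AC, of "x - 1" "x + 1"]
    by (rule continuous_on_interior) (simp add: interior_atLeastAtMost_real)
  then show ?thesis by (simp add: continuous_at_imp_continuous_on)
qed

lemma continuous_\<phi>: "continuous_on S \<phi>"
  using D by (meson DERIV_isCont continuous_at_imp_continuous_on)

lemma affine_triple:
  assumes "0 < a"
  shows "H2_triple 0 1 (\<lambda>x. \<phi> (a * x - b)) (\<lambda>x. a * p (a * x - b)) (\<lambda>x. a\<^sup>2 * q (a * x - b))"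
  unfolding H2_triple_def
proof (intro conjI ballI)
  show "((\<lambda>x. \<phi> (a * x - b)) has_real_derivative a * p (a * x - b)) (at x within {0..1})" for x
  proof -
    have "((\<lambda>x. a * x - b) has_real_derivative a) (at x within {0..1})"
      by (auto intro!: derivative_eq_intros)
    from DERIV_chain2[OF D this] show ?thesis by (simp add: mult.commute)
  qed
  show "AC_on 0 1 (\<lambda>x. a * p (a * x - b)) (\<lambda>x. a\<^sup>2 * q (a * x - b))"
    using AC_on_cmult[OF AC_on_affine[OF AC assms, of "- b"], of a] by (simp add: power2_eq_square mult.assoc)
  show "(\<lambda>x. (a\<^sup>2 * q (a * x - b))\<^sup>2) integrable_on {0..1}"
    using integrable_on_mult_right[OF square_integrable_affine(1)[OF q_sq assms, of "- b"], of "(a\<^sup>2)\<^sup>2"]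
    by (simp add: power_mult_distrib)
qed

lemma H2_norm_affine_le:
  assumes a: "0 < a" and c1: "\<And>x. x \<in> {0..1} \<Longrightarrow> \<bar>\<phi> (a * x - b) - c\<bar> \<le> A"
    and c2: "\<And>x. x \<in> {0..1} \<Longrightarrow> \<bar>p (a * x - b)\<bar> \<le> P" and Q: "integral UNIV (\<lambda>y. (q y)\<^sup>2) \<le> Q"
  shows "H2_norm {0<..<1} (\<lambda>x. \<phi> (a * x - b) - c) \<le> sqrt (A\<^sup>2 + (a * P)\<^sup>2 + a ^ 3 * Q)"
proof -
  have t: "H2_triple 0 1 (\<lambda>x. \<phi> (a * x - b) - c) (\<lambda>x. a * p (a * x - b)) (\<lambda>x. a\<^sup>2 * q (a * x - b))"
    using H2_triple_diff[OF affine_triple[OF a] H2_triple_const[of 0 1 c]] by simp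
  note sq = H2_triple_integrable_sq[OF t]
  have *: "integral {0..1} w \<le> C" if "w integrable_on {0..1}" "\<And>x. x \<in> {0..1} \<Longrightarrow> w x \<le> C" for w :: "real \<Rightarrow> real" and C
    using integral_le[OF that(1) integrable_const_ivl, of C] that(2) by simp
  have 1: "integral {0..1} (\<lambda>x. (\<phi> (a * x - b) - c)\<^sup>2) \<le> A\<^sup>2"
    using c1 by (intro * sq abs_le_square_iff[THEN iffD1]) force
  have 2: "integral {0..1} (\<lambda>x. (a * p (a * x - b))\<^sup>2) \<le> (a * P)\<^sup>2"
  proof (intro * sq)
    fix x :: real assume "x \<in> {0..1}"
    then have "\<bar>a * p (a * x - b)\<bar> \<le> \<bar>a * P\<bar>" using c2[of x] a by (auto simp: abs_mult)
    then show "(a * p (a * x - b))\<^sup>2 \<le> (a * P)\<^sup>2" by (rule abs_le_square_iff[THEN iffD1])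
  qed
  have "integral {0..1} (\<lambda>x. (a\<^sup>2 * q (a * x - b))\<^sup>2) = (a\<^sup>2)\<^sup>2 * integral {0..1} (\<lambda>x. (q (a * x + - b))\<^sup>2)"
    by (simp add: power_mult_distrib)
  also have "\<dots> \<le> (a\<^sup>2)\<^sup>2 * (integral UNIV (\<lambda>y. (q y)\<^sup>2) / a)"
    by (intro mult_left_mono square_integrable_affine(2)[OF q_sq a]) simp
  also have "\<dots> = a ^ 3 * integral UNIV (\<lambda>y. (q y)\<^sup>2)"
    using a by (simp add: field_simps eval_nat_numeral)
  also have "\<dots> \<le> a ^ 3 * Q" using a Q by (intro mult_left_mono) auto
  finally show ?thesis
    unfolding H2_triple_imp_H2(2)[OF t zero_less_one] using 1 2 by simp
qed

text \<open>Split off the continuous dependence of the factor \<open>a\<^sup>2\<close>; the rest is \<open>L\<^sup>2\<close> continuity of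
  affine substitutions.\<close>

lemma second_derivative_L2_continuous:
  assumes a: "\<And>n. a n > 0" "a0 > 0" "a \<longlonglongrightarrow> a0" and b: "b \<longlonglongrightarrow> b0"
  shows "(\<lambda>n::nat. integral {0..1} (\<lambda>x. ((a n)\<^sup>2 * q (a n * x - b n) - a0\<^sup>2 * q (a0 * x - b0))\<^sup>2)) \<longlonglongrightarrow> 0"
proof -
  have b': "(\<lambda>n. - b n) \<longlonglongrightarrow> - b0" by (intro tendsto_intros b)
  let ?e = "\<lambda>n x. (q (a n * x - b n) - q (a0 * x - b0))\<^sup>2"
  let ?d = "\<lambda>n x. ((a n)\<^sup>2 * q (a n * x - b n) - a0\<^sup>2 * q (a0 * x - b0))\<^sup>2"
  have eU: "?e n integrable_on UNIV" for n
    using L2_affine_continuous(1)[OF q_meas q_sq a b', of n] by simp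
  have elim: "(\<lambda>n. integral UNIV (?e n)) \<longlonglongrightarrow> 0"
    using L2_affine_continuous(2)[OF q_meas q_sq a b'] by simp
  have e01: "?e n integrable_on {0..1}" for n
    by (rule integrable_on_subinterval[OF eU]) simp
  have k: "(\<lambda>x. (q (a0 * x - b0))\<^sup>2) integrable_on {0..1}"
    using square_integrable_affine(1)[OF q_sq a(2), of "- b0"] by simp
  have d01: "?d n integrable_on {0..1}" for n
    using H2_triple_integrable_sq(3)[OF H2_triple_diff[OF affine_triple[OF a(1)] affine_triple[OF a(2)]]] by simp
  let ?I = "integral {0..1} (\<lambda>x. (q (a0 * x - b0))\<^sup>2)"
  have le: "integral {0..1} (?d n) \<le> 2 * (((a n)\<^sup>2)\<^sup>2 * integral UNIV (?e n) + ((a n)\<^sup>2 - a0\<^sup>2)\<^sup>2 * ?I)" for n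
  proof -
    have "integral {0..1} (?d n) \<le> integral {0..1} (\<lambda>x. 2 * (((a n)\<^sup>2)\<^sup>2 * ?e n x + ((a n)\<^sup>2 - a0\<^sup>2)\<^sup>2 * (q (a0 * x - b0))\<^sup>2))"
    proof (rule integral_le[OF d01])
      show "?d n x \<le> 2 * (((a n)\<^sup>2)\<^sup>2 * ?e n x + ((a n)\<^sup>2 - a0\<^sup>2)\<^sup>2 * (q (a0 * x - b0))\<^sup>2)" for x
        using square_diff_le[of "(a n)\<^sup>2 * (q (a n * x - b n) - q (a0 * x - b0))" "(a0\<^sup>2 - (a n)\<^sup>2) * q (a0 * x - b0)"]
        by (simp add: power_mult_distrib power2_commute[of "a0\<^sup>2"]) (simp add: algebra_simps)
    qed (intro integrable_on_mult_right integrable_add e01 k)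
    also have "\<dots> = 2 * (((a n)\<^sup>2)\<^sup>2 * integral {0..1} (?e n) + ((a n)\<^sup>2 - a0\<^sup>2)\<^sup>2 * ?I)"
    proof -
      have "((\<lambda>x. 2 * (((a n)\<^sup>2)\<^sup>2 * ?e n x + ((a n)\<^sup>2 - a0\<^sup>2)\<^sup>2 * (q (a0 * x - b0))\<^sup>2)) has_integral
         2 * (((a n)\<^sup>2)\<^sup>2 * integral {0..1} (?e n) + ((a n)\<^sup>2 - a0\<^sup>2)\<^sup>2 * ?I)) {0..1}"
        by (intro has_integral_mult_right has_integral_add integrable_integral e01 k)
      then show ?thesis by (rule integral_unique)
    qed
    also have "\<dots> \<le> 2 * (((a n)\<^sup>2)\<^sup>2 * integral UNIV (?e n) + ((a n)\<^sup>2 - a0\<^sup>2)\<^sup>2 * ?I)"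
      by (intro mult_left_mono add_mono integral_subset_le e01 eU k) auto
    finally show ?thesis .
  qed
  have "(\<lambda>n. 2 * (((a n)\<^sup>2)\<^sup>2 * integral UNIV (?e n) + ((a n)\<^sup>2 - a0\<^sup>2)\<^sup>2 * ?I)) \<longlonglongrightarrow>
     2 * ((a0\<^sup>2)\<^sup>2 * 0 + (a0\<^sup>2 - a0\<^sup>2)\<^sup>2 * ?I)"
    by (intro tendsto_intros elim a)
  then have lim: "(\<lambda>n. 2 * (((a n)\<^sup>2)\<^sup>2 * integral UNIV (?e n) + ((a n)\<^sup>2 - a0\<^sup>2)\<^sup>2 * ?I)) \<longlonglongrightarrow> 0" by simp
  have "norm (integral {0..1} (?d n)) \<le> 2 * (((a n)\<^sup>2)\<^sup>2 * integral UNIV (?e n) + ((a n)\<^sup>2 - a0\<^sup>2)\<^sup>2 * ?I)" for n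
  proof -
    have "0 \<le> integral {0..1} (?d n)" by (intro Henstock_Kurzweil_Integration.integral_nonneg d01) auto
    then show ?thesis using le[of n] by simp
  qed
  then show ?thesis by (rule Lim_null_comparison[OF always_eventually[OF allI] lim])
qed

text \<open>The function and its first derivative vary continuously as functions of both variables,
  and the second derivative varies continuously in \<open>L\<^sup>2\<close>.\<close>

lemma travelling_profile_C0_H2:
  assumes l: "continuous_on {0..T} l" "\<And>t. t \<in> {0..T} \<Longrightarrow> 0 < l t" and M: "continuous_on {0..T} M"
  shows "(\<lambda>t x. \<phi> (l t * x - M t)) \<in> C0_H2 T"
  unfolding C0_H2_def
proof (intro CollectI ballI conjI)
  fix t assume t: "t \<in> {0..T}"
  note tr = affine_triple[OF l(2)]
  show "(\<lambda>x. \<phi> (l t * x - M t)) \<in> H2 {0<..<1}"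
    by (rule H2_triple_imp_H2(1)[OF tr[OF t] zero_less_one])
  have param: "(\<lambda>n. integral {0..1} (\<lambda>x. (W (X n) x - W t x)\<^sup>2)) \<longlonglongrightarrow> 0"
    if W: "continuous_on ({0..T} \<times> {0..1}) (\<lambda>(s, x). W s x)" and X: "\<And>n. X n \<in> {0..T}" "X \<longlonglongrightarrow> t" for W :: "real \<Rightarrow> real \<Rightarrow> real" and X :: "nat \<Rightarrow> real"
  proof -
    have W1: "continuous_on ({0..T} \<times> cbox 0 1) (\<lambda>(s, x). (W s x - W t x)\<^sup>2)"
    proof -
      have "continuous_on ({0..T} \<times> {0..1}) (\<lambda>z. ((\<lambda>(s, x). W s x) z - (\<lambda>(s, x). W s x) (t, snd z))\<^sup>2)"
        unfolding prod.case
        by (intro continuous_on_power continuous_on_diff W continuous_on_compose2[OF continuous_on_slice(1)[OF W t, unfolded prod.case]] continuous_intros) auto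
      then show ?thesis by (simp add: case_prod_unfold)
    qed
    from integral_continuous_on_param[OF this]
    have "continuous_on {0..T} (\<lambda>s. integral {0..1} (\<lambda>x. (W s x - W t x)\<^sup>2))" by simp
    then have "(\<lambda>n. integral {0..1} (\<lambda>x. (W (X n) x - W t x)\<^sup>2)) \<longlonglongrightarrow> integral {0..1} (\<lambda>x. (W t x - W t x)\<^sup>2)"
      by (rule continuous_on_tendsto_compose) (use X t in auto)
    then show ?thesis by simp
  qed
  have c: "continuous_on ({0..T} \<times> {0..1}) (\<lambda>(s, x). l s * x - M s)" "continuous_on ({0..T} \<times> {0..1::real}) (\<lambda>(s, x). l s)"
    unfolding case_prod_unfold
    by (intro continuous_intros continuous_on_compose2[OF l(1)] continuous_on_compose2[OF M]; auto)+
  have W1: "continuous_on ({0..T} \<times> {0..1}) (\<lambda>(s, x). \<phi> (l s * x - M s))"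
    using continuous_on_compose2[OF continuous_\<phi>[of UNIV] c(1)] by (simp add: case_prod_unfold)
  have W2: "continuous_on ({0..T} \<times> {0..1}) (\<lambda>(s, x). l s * p (l s * x - M s))"
    using continuous_on_mult[OF c(2) continuous_on_compose2[OF continuous_p[of UNIV] c(1)]] by (simp add: case_prod_unfold)
  show "((\<lambda>s. H2_norm {0<..<1} (\<lambda>x. \<phi> (l s * x - M s) - \<phi> (l t * x - M t))) \<longlongrightarrow> 0) (at t within {0..T})"
    unfolding tendsto_at_iff_sequentially
  proof (intro allI impI)
    fix X :: "nat \<Rightarrow> real" assume "\<forall>i. X i \<in> {0..T} - {t}" and Xt: "X \<longlonglongrightarrow> t"
    then have X: "X n \<in> {0..T}" for n by auto
    have lX: "(\<lambda>n. l (X n)) \<longlonglongrightarrow> l t" "(\<lambda>n. M (X n)) \<longlonglongrightarrow> M t"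
      using l(1) M X Xt t unfolding continuous_on_sequentially by (auto simp: o_def)
    have "(\<lambda>n. sqrt (integral {0..1} (\<lambda>x. (\<phi> (l (X n) * x - M (X n)) - \<phi> (l t * x - M t))\<^sup>2) +
        integral {0..1} (\<lambda>x. (l (X n) * p (l (X n) * x - M (X n)) - l t * p (l t * x - M t))\<^sup>2) +
        integral {0..1} (\<lambda>x. ((l (X n))\<^sup>2 * q (l (X n) * x - M (X n)) - (l t)\<^sup>2 * q (l t * x - M t))\<^sup>2))) \<longlonglongrightarrow> sqrt (0 + 0 + 0)"
      by (intro tendsto_intros param[OF W1 X Xt] param[OF W2 X Xt] second_derivative_L2_continuous lX l(2) X t)
    then show "((\<lambda>s. H2_norm {0<..<1} (\<lambda>x. \<phi> (l s * x - M s) - \<phi> (l t * x - M t))) \<circ> X) \<longlonglongrightarrow> 0"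
      by (simp add: o_def H2_triple_imp_H2(2)[OF H2_triple_diff[OF tr[OF X] tr[OF t]] zero_less_one])
  qed
qed

lemma p_bound:
  assumes "integral UNIV (\<lambda>y. (q y)\<^sup>2) \<le> Q" and y: "\<bar>y\<bar> \<le> R"
  shows "\<bar>p y\<bar> \<le> \<bar>p 0\<bar> + sqrt (R * Q)"
proof -
  have *: "\<bar>p v - p u\<bar> \<le> sqrt (R * Q)" if "u \<le> v" "v - u \<le> R" for u v
  proof (cases "u = v")
    case True
    have "0 \<le> Q" using assms(1) Henstock_Kurzweil_Integration.integral_nonneg[OF q_sq] by force
    then show ?thesis using True that by simp
  next
    case False
    then have uv: "u < v" using that by simp
    have qa: "q absolutely_integrable_on {u..v}" by (rule AC_on_abs_integrable[OF AC])
    have q2: "(\<lambda>y. (q y)\<^sup>2) integrable_on {u..v}" by (rule integrable_on_subinterval[OF q_sq]) simp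
    have i0: "0 \<le> integral {u..v} (\<lambda>y. (q y)\<^sup>2)" using q2 by (rule Henstock_Kurzweil_Integration.integral_nonneg) simp
    have "p v - p u = integral {u..v} q" using that by (intro AC_on_diff[OF AC[of u v]]) auto
    also have "\<bar>\<dots>\<bar> \<le> integral {u..v} (\<lambda>y. \<bar>q y\<bar>)"
      using qa integral_norm_bound_integral[of q "{u..v}" "\<lambda>y. \<bar>q y\<bar>"] by (auto simp: absolutely_integrable_on_def)
    also have "\<dots> \<le> sqrt (R * Q)"
    proof (rule real_le_rsqrt)
      have "(integral {u..v} (\<lambda>y. \<bar>q y\<bar>))\<^sup>2 \<le> (v - u) * integral {u..v} (\<lambda>y. (q y)\<^sup>2)"
        by (rule integral_square_le[OF qa q2 uv])
      also have "\<dots> \<le> R * Q"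
      proof (rule mult_mono)
        have "integral {u..v} (\<lambda>y. (q y)\<^sup>2) \<le> integral UNIV (\<lambda>y. (q y)\<^sup>2)"
          by (intro integral_subset_le q2 q_sq) auto
        then show "integral {u..v} (\<lambda>y. (q y)\<^sup>2) \<le> Q" using assms(1) by simp
      qed (use that uv i0 in auto)
      finally show "(integral {u..v} (\<lambda>y. \<bar>q y\<bar>))\<^sup>2 \<le> R * Q" .
    qed
    finally show ?thesis .
  qed
  show ?thesis using *[of 0 y] *[of y 0] y by (cases "0 \<le> y") auto
qed

lemma \<phi>_lipschitz:
  assumes P: "\<And>y. y \<in> {c..d} \<Longrightarrow> \<bar>p y\<bar> \<le> P" and "x \<in> {c..d}" "y \<in> {c..d}"
  shows "\<bar>\<phi> x - \<phi> y\<bar> \<le> P * \<bar>x - y\<bar>"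
  using field_differentiable_bound[of "{c..d}" \<phi> p P x y] assms D
  by (auto intro: has_field_derivative_at_within)

end

section \<open>The flow rate and the trajectory of the interface\<close>

locale extrusion =
  fixes L \<zeta> \<rho> V S B K :: real
  assumes L: "0 < L" and \<zeta>: "0 < \<zeta>" and \<rho>: "0 < \<rho>" and V: "0 < V" and S: "0 < S" and B: "0 < B" and K: "0 < K"
begin

abbreviation "FF \<equiv> F L \<rho> V S B K"

text \<open>With this quantity \<open>F\<close> takes the form \<open>V n / S * (1 - \<beta> l / (1 - f))\<close>, in which
  the linear dependence on \<open>n\<close> and the Lipschitz dependence on \<open>l\<close> and \<open>f\<close> are visible.\<close>

definition \<beta> where "\<beta> l = B * \<rho> / (B * \<rho> + K * (L - l))"

lemma denominator_ge: "l \<le> L \<Longrightarrow> B * \<rho> \<le> B * \<rho> + K * (L - l)" and B\<rho>: "0 < B * \<rho>"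
  using B \<rho> K by auto

lemma F_eq:
  assumes "l \<le> L" "f < 1"
  shows "FF l n f = V * n / S * (1 - \<beta> l / (1 - f))"
proof -
  define D where "D = B * \<rho> + K * (L - l)"
  have D: "D > 0" using denominator_ge[OF assms(1)] B\<rho> by (simp add: D_def)
  have "FF l n f = (K * \<rho> * V * n * (L - l) / D - \<rho> * V * n * f) / (\<rho> * S * (1 - f))"
    by (simp add: F_def F_d_def D_def)
  also have "K * \<rho> * V * n * (L - l) / D = \<rho> * V * n * (1 - \<beta> l)"
    using D by (simp add: \<beta>_def D_def[symmetric]) (simp add: field_simps D_def)
  also have "\<rho> * V * n * (1 - \<beta> l) - \<rho> * V * n * f = \<rho> * (V * n * (1 - \<beta> l - f))" by (simp add: algebra_simps)
  finally have "FF l n f = V * n * (1 - \<beta> l - f) / (S * (1 - f))" using \<rho> by (simp add: mult.assoc)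
  then show ?thesis using S assms(2) by (simp add: field_simps)
qed

lemma \<beta>_bounds: "l \<le> L \<Longrightarrow> 0 < \<beta> l" "l \<le> L \<Longrightarrow> \<beta> l \<le> 1"
  using denominator_ge[of l] B\<rho> by (auto simp: \<beta>_def)

lemma \<beta>_lipschitz:
  assumes "l \<le> L" "l' \<le> L"
  shows "\<bar>\<beta> l - \<beta> l'\<bar> \<le> K / (B * \<rho>) * \<bar>l - l'\<bar>"
proof -
  define D D' where "D = B * \<rho> + K * (L - l)" and "D' = B * \<rho> + K * (L - l')"
  have D: "B * \<rho> \<le> D" "B * \<rho> \<le> D'" using denominator_ge assms by (auto simp: D_def D'_def)
  then have D0: "0 < D" "0 < D'" using B\<rho> by auto
  have "\<beta> l - \<beta> l' = B * \<rho> * (D' - D) / (D * D')"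
  proof -
    have "\<beta> l = B * \<rho> / D" "\<beta> l' = B * \<rho> / D'" by (simp_all add: \<beta>_def D_def D'_def)
    then show ?thesis using D0 by (simp add: field_simps)
  qed
  also have "D' - D = K * (l - l')" by (simp add: D_def D'_def algebra_simps)
  finally have "\<bar>\<beta> l - \<beta> l'\<bar> = B * \<rho> * (K * \<bar>l - l'\<bar>) / (D * D')"
    using D0 B \<rho> K by (simp add: abs_mult)
  also have "\<dots> \<le> B * \<rho> * (K * \<bar>l - l'\<bar>) / (B * \<rho> * (B * \<rho>))"
    using D D0 B \<rho> K by (intro divide_left_mono mult_mono mult_pos_pos mult_nonneg_nonneg) auto
  also have "\<dots> = K / (B * \<rho>) * \<bar>l - l'\<bar>" using B\<rho> by simp
  finally show ?thesis .
qed

lemma \<beta>_continuous: "continuous_on {..L} \<beta>"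
  unfolding \<beta>_def using denominator_ge B\<rho> by (intro continuous_intros) (force simp: less_imp_neq[symmetric])

lemma F_lipschitz:
  assumes l: "l \<le> L" "l' \<le> L" and f: "f \<le> 1 - \<delta>" "f' \<le> 1 - \<delta>" and \<delta>: "0 < \<delta>" and n: "0 \<le> n"
  shows "\<bar>FF l n f - FF l' n f'\<bar> \<le> V * n / S * (K / (B * \<rho>) / \<delta> * \<bar>l - l'\<bar> + \<bar>f - f'\<bar> / \<delta>\<^sup>2)"
proof -
  have lt: "f < 1" "f' < 1" using f \<delta> by auto
  have "\<beta> l' / (1 - f') - \<beta> l / (1 - f) = (\<beta> l' - \<beta> l) / (1 - f) + \<beta> l' * ((f' - f) / ((1 - f) * (1 - f')))"
    using lt by (simp add: divide_simps) (simp add: algebra_simps)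
  also have "\<bar>\<dots>\<bar> \<le> \<bar>\<beta> l' - \<beta> l\<bar> / (1 - f) + \<beta> l' * (\<bar>f' - f\<bar> / ((1 - f) * (1 - f')))"
    using lt \<beta>_bounds(1)[OF l(2)] by (intro order_trans[OF abs_triangle_ineq]) (simp add: abs_mult)
  also have "\<dots> \<le> (K / (B * \<rho>) * \<bar>l - l'\<bar>) / \<delta> + 1 * (\<bar>f' - f\<bar> / (\<delta> * \<delta>))"
    using \<beta>_lipschitz[OF l] \<beta>_bounds[OF l(2)] f \<delta> lt B \<rho> K
    by (intro add_mono mult_mono frac_le divide_nonneg_nonneg mult_nonneg_nonneg) (auto simp: abs_minus_commute)
  finally have *: "\<bar>\<beta> l' / (1 - f') - \<beta> l / (1 - f)\<bar> \<le> K / (B * \<rho>) / \<delta> * \<bar>l - l'\<bar> + \<bar>f - f'\<bar> / \<delta>\<^sup>2"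
    by (simp add: power2_eq_square abs_minus_commute)
  have "FF l n f - FF l' n f' = V * n / S * (\<beta> l' / (1 - f') - \<beta> l / (1 - f))"
    unfolding F_eq[OF l(1) lt(1)] F_eq[OF l(2) lt(2)] by (simp add: algebra_simps)
  then have "\<bar>FF l n f - FF l' n f'\<bar> = V * n / S * \<bar>\<beta> l' / (1 - f') - \<beta> l / (1 - f)\<bar>"
    using V S n by (simp add: abs_mult)
  also have "\<dots> \<le> V * n / S * (K / (B * \<rho>) / \<delta> * \<bar>l - l'\<bar> + \<bar>f - f'\<bar> / \<delta>\<^sup>2)"
    using * V S n by (intro mult_left_mono) auto
  finally show ?thesis .
qed

lemma F_continuous:
  fixes l n f :: "'a::topological_space \<Rightarrow> real"
  assumes "continuous_on A l" "continuous_on A n" "continuous_on A f"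
    and "\<And>x. x \<in> A \<Longrightarrow> l x \<le> L" "\<And>x. x \<in> A \<Longrightarrow> f x < 1"
  shows "continuous_on A (\<lambda>x. FF (l x) (n x) (f x))"
proof -
  have "continuous_on A (\<lambda>x. V * n x / S * (1 - \<beta> (l x) / (1 - f x)))"
    using assms S by (intro continuous_intros continuous_on_compose2[OF \<beta>_continuous]) force+
  then show ?thesis
    by (rule continuous_on_eq) (use F_eq assms in auto)
qed

text \<open>As \<open>F\<close> is linear in \<open>n\<close>, it vanishes at \<open>(le, fe)\<close> for every value of \<open>n\<close>. Therefore the
  variation of \<open>N\<close> does not drive the trajectory away from the equilibrium.\<close>

lemma F_equilibrium:
  assumes "FF le Ne fe = 0" "le < L" "fe < 1" "0 < Ne"
  shows "FF le n fe = 0"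
proof -
  have "V * Ne / S * (1 - \<beta> le / (1 - fe)) = 0" using F_eq[of le fe Ne] assms by simp
  then show ?thesis using F_eq[of le fe n] assms V S by auto
qed

end

text \<open>Here \<open>M\<close> stands for the primitive of \<open>\<zeta> N\<close>, and the arguments \<open>l x - M\<close> of the profile
  lie in \<open>[- m, L]\<close>.\<close>

locale extrusion_profile = extrusion + H2_profile +
  fixes N M :: "real \<Rightarrow> real" and T m Nm :: real
  assumes T: "0 < T" and Nc: "continuous_on {0..T} N" and N: "\<And>t. t \<in> {0..T} \<Longrightarrow> 0 \<le> N t \<and> N t \<le> Nm"
    and Mc: "continuous_on {0..T} M" and M: "\<And>t. t \<in> {0..T} \<Longrightarrow> 0 \<le> M t \<and> M t \<le> m"
begin

text \<open>After truncating \<open>l\<close> to \<open>[le - r, le + r]\<close> the right-hand side is Lipschitz continuous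
  for all values of \<open>l\<close>, so that a global solution exists. Since \<open>F\<close> vanishes at the
  equilibrium, Gronwall's inequality bounds \<open>\<bar>l t - le\<bar>\<close> by the left-hand side of \<open>small\<close>,
  and the truncation is never active.\<close>

lemma trajectory_exists:
  assumes eq: "FF le Ne fe = 0" "0 < Ne" "fe < 1" "0 < le - r" "le + r < L" "0 \<le> r"
    and \<delta>: "0 < \<delta>" and \<eta>: "fe + \<eta> \<le> 1 - \<delta>"
    and \<phi>: "\<And>y. y \<in> {-m..L} \<Longrightarrow> \<bar>\<phi> y - fe\<bar> \<le> \<eta>"
    and p: "\<And>y. y \<in> {-m..L} \<Longrightarrow> \<bar>p y\<bar> \<le> P"
    and small: "(\<bar>l0 - le\<bar> + V * Nm / S * (\<eta> / \<delta>\<^sup>2) * T) * exp (V * Nm / S * (K / (B * \<rho>) / \<delta>) * T) \<le> r"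
  obtains l where "l 0 = l0"
    "\<And>t. t \<in> {0..T} \<Longrightarrow> (l has_real_derivative FF (l t) (N t) (\<phi> (l t - M t))) (at t within {0..T})"
    "\<And>t. t \<in> {0..T} \<Longrightarrow> \<bar>l t - le\<bar> \<le> r"
proof -
  define c where "c u = max (le - r) (min (le + r) u)" for u
  have c: "le - r \<le> c u" "c u \<le> le + r" for u using eq by (auto simp: c_def)
  have c1: "\<bar>c u - c v\<bar> \<le> \<bar>u - v\<bar>" "\<bar>c u - le\<bar> \<le> \<bar>u - le\<bar>" for u v using eq by (auto simp: c_def)
  have c_id: "c u = u" if "\<bar>u - le\<bar> \<le> r" for u using that by (auto simp: c_def)
  have cL: "c u \<le> L" for u using c[of u] eq by auto
  have rng: "c u - M t \<in> {-m..L}" if "t \<in> {0..T}" for t u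
    using c[of u] M[OF that] eq by auto
  have m0: "0 \<le> m" using M[of 0] T by auto
  have Nm: "0 \<le> Nm" using N[of 0] T by auto
  have \<eta>0: "0 \<le> \<eta>" using \<phi>[of 0] L m0 by auto
  have P0: "0 \<le> P" using p[of 0] L m0 by auto
  have f_le: "\<phi> (c u - M t) \<le> 1 - \<delta>" if "t \<in> {0..T}" for t u
    using \<phi>[OF rng[OF that, of u]] \<eta> by auto
  let ?K1 = "V * Nm / S * (K / (B * \<rho>) / \<delta>)" and ?K2 = "V * Nm / S * (1 / \<delta>\<^sup>2)"
  have K1: "0 \<le> ?K1" and K2: "0 \<le> ?K2" using V S Nm K B\<rho> \<delta> by auto
  define G where "G t u = FF (c u) (N t) (\<phi> (c u - M t))" for t u
  have Flip: "\<bar>FF l (N t) f - FF l' (N t) f'\<bar> \<le> ?K1 * \<bar>l - l'\<bar> + ?K2 * \<bar>f - f'\<bar>"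
    if "t \<in> {0..T}" "l \<le> L" "l' \<le> L" "f \<le> 1 - \<delta>" "f' \<le> 1 - \<delta>" for t l l' f f'
  proof -
    have "\<bar>FF l (N t) f - FF l' (N t) f'\<bar> \<le> V * N t / S * (K / (B * \<rho>) / \<delta> * \<bar>l - l'\<bar> + \<bar>f - f'\<bar> / \<delta>\<^sup>2)"
      using that N \<delta> by (intro F_lipschitz) auto
    also have "\<dots> \<le> V * Nm / S * (K / (B * \<rho>) / \<delta> * \<bar>l - l'\<bar> + \<bar>f - f'\<bar> / \<delta>\<^sup>2)"
      using N[OF that(1)] V S K B\<rho> \<delta> by (intro mult_right_mono divide_right_mono mult_left_mono add_nonneg_nonneg mult_nonneg_nonneg) auto
    finally show ?thesis by (simp add: algebra_simps)
  qed
  have "\<exists>l. l 0 = l0 \<and> (\<forall>t\<in>{0..T}. (l has_real_derivative G t (l t)) (at t within {0..T}))"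
  proof (rule picard_lindelof[OF T, of "?K1 + ?K2 * P" G l0])
    show "0 \<le> ?K1 + ?K2 * P" using K1 mult_nonneg_nonneg[OF K2 P0] by linarith
    have cc: "continuous_on UNIV c" unfolding c_def by (intro continuous_intros)
    have "continuous_on ({0..T} \<times> UNIV) (\<lambda>z. FF (c (snd z)) (N (fst z)) (\<phi> (c (snd z) - M (fst z))))"
    proof (rule F_continuous)
      show "continuous_on ({0..T} \<times> UNIV) (\<lambda>z. N (fst z))"
        by (rule continuous_on_compose2[OF Nc]) (auto intro!: continuous_intros)
      show "continuous_on ({0..T} \<times> UNIV) (\<lambda>z. c (snd z))"
        by (rule continuous_on_compose2[OF cc]) (auto intro!: continuous_intros)
      then show "continuous_on ({0..T} \<times> UNIV) (\<lambda>z. \<phi> (c (snd z) - M (fst z)))"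
        by (intro continuous_on_compose2[OF continuous_\<phi>[of UNIV]] continuous_on_diff continuous_on_compose2[OF Mc])
          (auto intro!: continuous_intros)
      show "\<phi> (c (snd z) - M (fst z)) < 1" if "z \<in> {0..T} \<times> UNIV" for z
        using f_le[of "fst z" "snd z"] that \<delta> by auto
    qed (use cL in auto)
    then show "continuous_on ({0..T} \<times> UNIV) (\<lambda>(t, u). G t u)"
      by (simp add: G_def case_prod_unfold)
    show "\<bar>G t u - G t v\<bar> \<le> (?K1 + ?K2 * P) * \<bar>u - v\<bar>" if t: "t \<in> {0..T}" for t u v
    proof -
      have "\<bar>G t u - G t v\<bar> \<le> ?K1 * \<bar>c u - c v\<bar> + ?K2 * \<bar>\<phi> (c u - M t) - \<phi> (c v - M t)\<bar>"
        unfolding G_def by (intro Flip t cL f_le)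
      also have "\<dots> \<le> ?K1 * \<bar>u - v\<bar> + ?K2 * (P * \<bar>u - v\<bar>)"
      proof (intro add_mono mult_left_mono K1 K2 c1)
        have "\<bar>\<phi> (c u - M t) - \<phi> (c v - M t)\<bar> \<le> P * \<bar>(c u - M t) - (c v - M t)\<bar>"
          by (rule \<phi>_lipschitz[OF p rng[OF t] rng[OF t]])
        also have "\<dots> \<le> P * \<bar>u - v\<bar>" using c1(1)[of u v] P0 by (intro mult_left_mono) auto
        finally show "\<bar>\<phi> (c u - M t) - \<phi> (c v - M t)\<bar> \<le> P * \<bar>u - v\<bar>" .
      qed
      also have "\<dots> = (?K1 + ?K2 * P) * \<bar>u - v\<bar>" by (simp add: algebra_simps)
      finally show ?thesis .
    qed
  qed auto
  then obtain l where l0: "l 0 = l0" and lD: "\<And>t. t \<in> {0..T} \<Longrightarrow> (l has_real_derivative G t (l t)) (at t within {0..T})"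
    by blast
  have lc: "continuous_on {0..T} l" using lD by (meson DERIV_continuous continuous_on_eq_continuous_within)
  have bound: "\<bar>l t - le\<bar> \<le> r" if t: "t \<in> {0..T}" for t
  proof -
    let ?A = "\<bar>l0 - le\<bar> + ?K2 * \<eta> * T"
    have "\<bar>l t - le\<bar> \<le> ?A * exp (?K1 * t)"
    proof (rule gronwall[where u = "\<lambda>t. \<bar>l t - le\<bar>" and T = T])
      show "continuous_on {0..T} (\<lambda>t. \<bar>l t - le\<bar>)" by (intro continuous_intros lc)
      fix t assume t: "t \<in> {0..T}"
      have "((\<lambda>s. G s (l s)) has_integral (l t - l 0)) {0..t}"
        using t by (intro fundamental_theorem_of_calculus)
          (auto simp: has_real_derivative_iff_has_vector_derivative[symmetric] intro: DERIV_subset[OF lD])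
      then have Gi: "(\<lambda>s. G s (l s)) integrable_on {0..t}" "integral {0..t} (\<lambda>s. G s (l s)) = l t - l0"
        using l0 by (auto simp: integral_unique)
      have li: "((\<lambda>s. ?K1 * \<bar>l s - le\<bar> + ?K2 * \<eta>) has_integral (?K1 * integral {0..t} (\<lambda>s. \<bar>l s - le\<bar>) + ?K2 * \<eta> * t)) {0..t}"
        using t has_integral_const_real[of "?K2 * \<eta>" 0 t]
        by (intro has_integral_add has_integral_mult_right integrable_integral integrable_continuous_real continuous_intros)
          (auto intro: continuous_on_subset[OF lc] simp: mult.commute)
      have "norm (integral {0..t} (\<lambda>s. G s (l s))) \<le> integral {0..t} (\<lambda>s. ?K1 * \<bar>l s - le\<bar> + ?K2 * \<eta>)"
      proof (rule Henstock_Kurzweil_Integration.integral_norm_bound_integral[OF Gi(1)])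
        fix s assume "s \<in> {0..t}"
        then have s: "s \<in> {0..T}" using t by auto
        have "\<bar>FF (c (l s)) (N s) (\<phi> (c (l s) - M s)) - FF le (N s) fe\<bar> \<le> ?K1 * \<bar>c (l s) - le\<bar> + ?K2 * \<bar>\<phi> (c (l s) - M s) - fe\<bar>"
          using eq \<eta> \<eta>0 by (intro Flip s cL f_le) auto
        also have "\<dots> \<le> ?K1 * \<bar>l s - le\<bar> + ?K2 * \<eta>"
          by (intro add_mono mult_left_mono K1 K2 c1 \<phi> rng s)
        finally show "norm (G s (l s)) \<le> ?K1 * \<bar>l s - le\<bar> + ?K2 * \<eta>"
          using F_equilibrium[of le Ne fe "N s"] eq by (simp add: G_def)
      qed (use li in blast)
      then have "\<bar>l t - l0\<bar> \<le> ?K1 * integral {0..t} (\<lambda>s. \<bar>l s - le\<bar>) + ?K2 * \<eta> * t"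
        using Gi(2) integral_unique[OF li] by simp
      moreover have "?K2 * \<eta> * t \<le> ?K2 * \<eta> * T"
        using t by (intro mult_left_mono mult_nonneg_nonneg[OF K2 \<eta>0]) auto
      ultimately show "\<bar>l t - le\<bar> \<le> ?A + ?K1 * integral {0..t} (\<lambda>s. \<bar>l s - le\<bar>)" by linarith
    qed (use K1 t in auto)
    also have "\<dots> \<le> ?A * exp (?K1 * T)"
    proof (rule mult_left_mono)
      show "exp (?K1 * t) \<le> exp (?K1 * T)" using t mult_left_mono[OF _ K1, of t T] by simp
      show "0 \<le> ?A" using mult_nonneg_nonneg[OF mult_nonneg_nonneg[OF K2 \<eta>0]] T by simp
    qed
    also have "\<dots> \<le> r" using small by simp
    finally show ?thesis .
  qed
  show ?thesis
    by (rule that[of l]) (use l0 lD bound c_id in \<open>auto simp: G_def\<close>)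
qed

end

section \<open>Norms of the data\<close>

lemma Linf_AE_bound:
  assumes f: "f \<in> Linf {0<..<T}" and T: "0 < (T::real)"
  shows "AE x in lebesgue_on {0<..<T}. \<bar>f x\<bar> \<le> Linf_norm {0<..<T} f" and "0 \<le> Linf_norm {0<..<T} f"
proof -
  let ?M = "lebesgue_on {0<..<T}" and ?e = "esssup (lebesgue_on {0<..<T}) (\<lambda>x. ereal \<bar>f x\<bar>)"
  have ae: "AE x in ?M. ereal \<bar>f x\<bar> \<le> ?e" by (rule esssup_AE)
  have fin: "?e < \<infinity>" using f by (simp add: Linf_def)
  have nn: "0 \<le> ?e"
  proof (rule ccontr)
    assume "\<not> 0 \<le> ?e"
    have "AE x in ?M. False"
    proof (rule eventually_mono[OF ae])
      fix x assume *: "ereal \<bar>f x\<bar> \<le> ?e"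
      have "0 \<le> ereal \<bar>f x\<bar>" by simp
      then have "0 \<le> ?e" using * by (rule order_trans)
      then show False using \<open>\<not> 0 \<le> ?e\<close> by simp
    qed
    then have "AE x in lebesgue_on {0<..<T}. (1::real) = 0" by simp
    then have "AE x in lebesgue_on (box 0 T). (1::real) = 0" unfolding box_real .
    from continuous_AE_zero_imp_zero[OF continuous_on_const this, of 0] T show False by simp
  qed
  have e: "?e = ereal (Linf_norm {0<..<T} f)"
    using fin nn by (cases ?e) (auto simp: Linf_norm_def)
  show "AE x in ?M. \<bar>f x\<bar> \<le> Linf_norm {0<..<T} f" using ae unfolding e by simp
  show "0 \<le> Linf_norm {0<..<T} f" using nn unfolding e by simp
qed

lemma bounded_imp_Linf:
  assumes "f \<in> borel_measurable (lebesgue_on I)" "AE x in lebesgue_on I. \<bar>f x\<bar> \<le> c"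
  shows "f \<in> Linf I"
proof -
  have "(\<lambda>x. ereal \<bar>f x\<bar>) \<in> borel_measurable (lebesgue_on I)"
    using assms(1) by measurable
  then have "esssup (lebesgue_on I) (\<lambda>x. ereal \<bar>f x\<bar>) \<le> ereal c"
    by (rule esssup_I) (use assms(2) in simp)
  then have "esssup (lebesgue_on I) (\<lambda>x. ereal \<bar>f x\<bar>) < \<infinity>" by (rule le_less_trans) simp
  then show ?thesis using assms(1) by (simp add: Linf_def)
qed

lemma continuous_imp_Linf:
  assumes "continuous_on {a..b} f"
  shows "f \<in> Linf {a<..<b}"
proof -
  have "compact (f ` {a..b})" using assms by (intro compact_continuous_image) auto
  then obtain c where c: "\<And>x. x \<in> {a..b} \<Longrightarrow> norm (f x) \<le> c"
    by (meson compact_imp_bounded bounded_iff imageI)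
  have "integrable (lebesgue_on {a<..<b}) f"
    by (simp add: integrable_lebesgue_on_Ioo_iff absolutely_integrable_continuous_real assms)
  then show ?thesis
    by (intro bounded_imp_Linf[of _ _ c] borel_measurable_integrable AE_I2) (use c in auto)
qed

lemma AC_on_imp_W1inf:
  assumes "AC_on 0 T f f'" "continuous_on {0..T} f'" "0 < T"
  shows "f \<in> W1inf {0<..<T}"
  unfolding W1inf_def
  using AC_on_imp_weak_deriv[OF assms(1,3)] continuous_imp_Linf AC_on_continuous[OF assms(1)] assms(2) by blast

text \<open>The derivative is truncated at \<open>e\<close>, which changes it on a null set only, so that its
  bound holds everywhere.\<close>

lemma W1inf_norm_close:
  assumes N: "N \<in> W1inf {0<..<T}" "continuous_on {0..T} N" and T: "0 < T"
    and le: "W1inf_norm {0<..<T} (\<lambda>t. N t - c) \<le> e"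
  obtains N' where "AC_on 0 T N N'" "\<And>t. \<bar>N' t\<bar> \<le> e" "\<And>t. t \<in> {0..T} \<Longrightarrow> \<bar>N t - c\<bar> \<le> e"
    and "0 \<le> W1inf_norm {0<..<T} (\<lambda>t. N t - c)"
proof -
  let ?M = "lebesgue_on {0<..<T}"
  obtain N1 where N1: "N1 \<in> Linf {0<..<T}" "has_weak_deriv {0<..<T} 1 N N1" using N by (auto simp: W1inf_def)
  have "AC_on 0 T (\<lambda>t. N t - c) (\<lambda>t. N1 t - 0)"
    by (intro AC_on_minus AC_on_const has_weak_deriv_continuous_imp_AC N1(2) N(2) T)
  then have wd: "has_weak_deriv {0<..<T} 1 (\<lambda>t. N t - c) N1" using AC_on_imp_weak_deriv T by simp
  define w where "w = weak_deriv {0<..<T} (\<lambda>t. N t - c)"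
  have w: "has_weak_deriv {0<..<T} 1 (\<lambda>t. N t - c) w" unfolding w_def by (rule has_weak_deriv_weak_deriv[OF wd])
  have wN1: "AE t in ?M. w t = N1 t" unfolding w_def by (rule weak_deriv_AE_eq[OF wd])
  have wm: "w \<in> borel_measurable ?M" using w by (auto simp: has_weak_deriv_def)
  have "AE t in ?M. \<bar>w t\<bar> \<le> Linf_norm {0<..<T} N1"
    using wN1 Linf_AE_bound(1)[OF N1(1) T] by eventually_elim simp
  then have wL: "w \<in> Linf {0<..<T}" by (rule bounded_imp_Linf[OF wm])
  have NL: "(\<lambda>t. N t - c) \<in> Linf {0<..<T}"
    by (intro continuous_imp_Linf continuous_intros N)
  note b = Linf_AE_bound[OF wL T] and bN = Linf_AE_bound[OF NL T]
  have sum: "W1inf_norm {0<..<T} (\<lambda>t. N t - c) = Linf_norm {0<..<T} (\<lambda>t. N t - c) + Linf_norm {0<..<T} w"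
    by (simp add: W1inf_norm_def w_def)
  have we: "AE t in ?M. \<bar>w t\<bar> \<le> e" using b(1) by eventually_elim (use sum le bN(2) in linarith)
  have Ne: "AE t in ?M. max 0 (\<bar>N t - c\<bar> - e) = 0" using bN(1) by eventually_elim (use sum le b(2) in auto)
  have e0: "0 \<le> e" using sum le b(2) bN(2) by linarith
  define N' where "N' t = max (- e) (min e (w t))" for t
  have ac: "AC_on 0 T (\<lambda>t. N t - c) w"
    by (intro has_weak_deriv_continuous_imp_AC w T continuous_intros N)
  have wm': "w \<in> borel_measurable (lebesgue_on {0..T})"
    by (rule absolutely_integrable_imp_borel_measurable[OF AC_on_abs_integrable[OF ac]]) simp
  have "AC_on 0 T (\<lambda>t. N t - c + c) (\<lambda>t. w t + 0)"
    by (intro AC_on_add ac AC_on_const)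
  then have "AC_on 0 T N w" by simp
  then have "AC_on 0 T N N'"
  proof (rule AC_on_cong_AE)
    show "AE t in ?M. w t = N' t" using we by eventually_elim (auto simp: N'_def)
    show "N' absolutely_integrable_on {0..T}"
    proof (rule measurable_bounded_by_integrable_imp_absolutely_integrable)
      show "N' \<in> borel_measurable (lebesgue_on {0..T})"
        unfolding N'_def[abs_def] using wm' by measurable
      show "(\<lambda>_. e) integrable_on {0..T}" by (rule integrable_const_ivl)
      show "norm (N' x) \<le> e" for x using e0 by (auto simp: N'_def)
    qed auto
  qed
  moreover have "\<bar>N' t\<bar> \<le> e" for t using e0 by (auto simp: N'_def)
  moreover have "\<bar>N t - c\<bar> \<le> e" if "t \<in> {0..T}" for t
  proof -
    have "max 0 (\<bar>N t - c\<bar> - e) = 0"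
      by (rule continuous_AE_eq_imp_eq[OF _ continuous_on_const T Ne that]) (intro continuous_intros N)
    then show ?thesis by linarith
  qed
  ultimately show ?thesis using that sum b(2) bN(2) by simp
qed

text \<open>Two continuous functions that agree almost everywhere agree, so that every choice of a
  continuous representative has the same value.\<close>

lemma cont_rep_H2:
  assumes t: "H2_triple a b f p q" and ab: "a < b"
  shows "cont_rep a b (weak_deriv {a<..<b} f) a = p a"
proof -
  have ae: "AE x in lebesgue_on {a<..<b}. weak_deriv {a<..<b} f x = p x"
    by (rule weak_deriv_AE_eq[OF AC_on_imp_weak_deriv[OF H2_triple_AC1[OF t] ab]])
  have pc: "continuous_on {a..b} p" using t AC_on_continuous by (auto simp: H2_triple_def)
  let ?P = "\<lambda>v. continuous_on {a..b} v \<and> (AE x in lebesgue_on {a<..<b}. v x = weak_deriv {a<..<b} f x)"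
  have "?P p" using pc ae by (auto elim: eventually_mono)
  then have v: "?P (cont_rep a b (weak_deriv {a<..<b} f))"
    unfolding cont_rep_def by (rule someI[of ?P])
  then have "AE x in lebesgue_on {a<..<b}. cont_rep a b (weak_deriv {a<..<b} f) x = p x"
    using ae by (auto elim: eventually_elim2)
  then show ?thesis using v pc ab by (intro continuous_AE_eq_imp_eq[of a b]) auto
qed

lemma H2_close:
  assumes f: "f \<in> H2 {0<..<b}" "continuous_on {0..b} f" and b: "0 < b" and le: "H2_norm {0<..<b} (\<lambda>x. f x - c) \<le> e"
  obtains p q where "H2_triple 0 b f p q" "integral {0..b} (\<lambda>x. (p x)\<^sup>2) \<le> e\<^sup>2" "integral {0..b} (\<lambda>x. (q x)\<^sup>2) \<le> e\<^sup>2"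
    "\<And>x. x \<in> {0..b} \<Longrightarrow> \<bar>f x - c\<bar> \<le> sqrt (2 / b + 2 * b) * e" "\<And>x. x \<in> {0..b} \<Longrightarrow> \<bar>p x\<bar> \<le> sqrt (2 / b + 2 * b) * e"
    "0 \<le> H2_norm {0<..<b} (\<lambda>x. f x - c)"
proof -
  obtain p q where t: "H2_triple 0 b f p q" using H2_imp_H2_triple[OF f b] .
  have t': "H2_triple 0 b (\<lambda>x. f x - c) p q" using H2_triple_diff[OF t H2_triple_const[of 0 b c]] by simp
  note sq = H2_triple_integrable_sq[OF t']
  have nn: "0 \<le> integral {0..b} (\<lambda>x. (f x - c)\<^sup>2)" "0 \<le> integral {0..b} (\<lambda>x. (p x)\<^sup>2)" "0 \<le> integral {0..b} (\<lambda>x. (q x)\<^sup>2)"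
    using sq by (auto intro: Henstock_Kurzweil_Integration.integral_nonneg)
  have n: "H2_norm {0<..<b} (\<lambda>x. f x - c) = sqrt (integral {0..b} (\<lambda>x. (f x - c)\<^sup>2) + integral {0..b} (\<lambda>x. (p x)\<^sup>2) + integral {0..b} (\<lambda>x. (q x)\<^sup>2))"
    by (rule H2_triple_imp_H2(2)[OF t' b])
  then have n0: "0 \<le> H2_norm {0<..<b} (\<lambda>x. f x - c)" using nn by simp
  then have "(H2_norm {0<..<b} (\<lambda>x. f x - c))\<^sup>2 \<le> e\<^sup>2" using le by (intro power_mono)
  then have s: "integral {0..b} (\<lambda>x. (f x - c)\<^sup>2) + integral {0..b} (\<lambda>x. (p x)\<^sup>2) + integral {0..b} (\<lambda>x. (q x)\<^sup>2) \<le> e\<^sup>2"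
    unfolding n using nn by simp
  have "sqrt (2 / b + 2 * b) * H2_norm {0<..<b} (\<lambda>x. f x - c) \<le> sqrt (2 / b + 2 * b) * e"
    using le b by (intro mult_left_mono) auto
  then show ?thesis
    using that[OF t] s nn n0 H2_triple_sup_bound[OF t' b] by (smt (verit) diff_zero)
qed

section \<open>Solutions are classical and unique\<close>

context extrusion
begin

abbreviation "sol \<equiv> is_solution L \<zeta> \<rho> V S B K"
abbreviation "speed \<equiv> \<alpha>\<^sub>p L \<zeta> \<rho> V S B K"

text \<open>The weak \<open>x\<close> derivative of a solution is the continuous function \<open>v\<close>. The equation then
  identifies the weak time derivative with the continuous function \<open>- \<alpha> v\<close>, so that the
  solution is continuously differentiable and satisfies both equations everywhere.\<close>

lemma solution_classical:
  assumes sol: "sol T l0 fp0 N g l f" and T: "0 < T" and N: "continuous_on {0..T} N"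
  obtains v where "continuous_on ({0..T} \<times> {0..1}) (\<lambda>(t, x). f t x)" "continuous_on ({0..T} \<times> {0..1}) (\<lambda>(t, x). v t x)"
    "\<And>t x. t \<in> {0..T} \<Longrightarrow> x \<in> {0..1} \<Longrightarrow> (f t has_real_derivative v t x) (at x within {0..1})"
    "\<And>t x. t \<in> {0..T} \<Longrightarrow> x \<in> {0..1} \<Longrightarrow>
       ((\<lambda>s. f s x) has_real_derivative - (speed x (N t) (l t) (f t 1) * v t x)) (at t within {0..T})"
    "\<And>t. t \<in> {0..T} \<Longrightarrow> (l has_real_derivative FF (l t) (N t) (f t 1)) (at t within {0..T})"
    "continuous_on {0..T} (\<lambda>t. FF (l t) (N t) (f t 1))"
proof -
  have lc: "continuous_on {0..T} l" and fc: "\<And>t. t \<in> {0..T} \<Longrightarrow> continuous_on {0..1} (f t)" and fH: "f \<in> C0_H2 T"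
    and rng: "\<And>t. t \<in> {0..T} \<Longrightarrow> 0 < l t \<and> l t < L \<and> 0 < f t 1 \<and> f t 1 < 1"
    using sol by (auto simp: is_solution_def)
  obtain v where f: "continuous_on ({0..T} \<times> {0..1}) (\<lambda>(t, x). f t x)" and v: "continuous_on ({0..T} \<times> {0..1}) (\<lambda>(t, x). v t x)"
    and fx: "\<And>t x. t \<in> {0..T} \<Longrightarrow> x \<in> {0..1} \<Longrightarrow> (f t has_real_derivative v t x) (at x within {0..1})"
    using C0_H2_regular[OF fH fc] by blast
  have f1: "continuous_on {0..T} (\<lambda>t. f t 1)" using continuous_on_slice(2)[OF f, of 1] by simp
  have Fc: "continuous_on {0..T} (\<lambda>t. FF (l t) (N t) (f t 1))"
    by (rule F_continuous) (use lc N f1 rng in \<open>auto intro: less_imp_le\<close>)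
  have lD: "(l has_real_derivative FF (l t) (N t) (f t 1)) (at t within {0..T})" if "t \<in> {0..T}" for t
  proof -
    obtain l1 where "has_weak_deriv {0<..<T} 1 l l1" using sol by (auto simp: is_solution_def W1inf_def)
    from has_weak_deriv_continuous_imp_AC[OF has_weak_deriv_weak_deriv[OF this] T lc]
    have "AC_on 0 T l (weak_deriv {0<..<T} l)" .
    then have "AC_on 0 T l (\<lambda>t. FF (l t) (N t) (f t 1))"
      by (rule AC_on_cong_AE) (use sol Fc in \<open>auto simp: is_solution_def intro: absolutely_integrable_continuous_real\<close>)
    from AC_on_continuous_imp_DERIV[OF this Fc that] show ?thesis .
  qed
  define h where "h t x = - (speed x (N t) (l t) (f t 1) * v t x)" for t x
  have hc: "continuous_on ({0..T} \<times> {0..1}) (\<lambda>(t, x). h t x)"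
  proof -
    have c: "continuous_on ({0..T} \<times> {0..1::real}) (\<lambda>z. w (fst z))" if "continuous_on {0..T} w" for w :: "real \<Rightarrow> real"
      by (rule continuous_on_compose2[OF that]) (auto intro!: continuous_intros)
    have "continuous_on ({0..T} \<times> {0..1}) (\<lambda>z. - ((1 / l (fst z) * (\<zeta> * N (fst z) - snd z * FF (l (fst z)) (N (fst z)) (f (fst z) 1))) * (\<lambda>(t, x). v t x) z))"
      using rng by (intro continuous_on_minus continuous_on_mult continuous_on_diff continuous_on_divide continuous_on_const
          continuous_on_snd continuous_on_id c[OF lc] c[OF N] c[OF Fc] v) (auto simp: less_imp_neq[symmetric])
    then show ?thesis by (simp add: h_def \<alpha>\<^sub>p_def case_prod_unfold)
  qed
  obtain ft gx where ft: "has_weak_deriv ({0<..<T} \<times> {0<..<1}) (1, 0) (\<lambda>(t, x). f t x) ft"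
    and gx: "has_weak_deriv ({0<..<T} \<times> {0<..<1}) (0, 1) (\<lambda>(t, x). f t x) gx"
    and pde: "AE (t, x) in lebesgue_on ({0<..<T} \<times> {0<..<1}). ft (t, x) + speed x (N t) (l t) (f t 1) * gx (t, x) = 0"
    using sol by (auto simp: is_solution_def)
  have "has_weak_deriv ({0<..<T} \<times> {0<..<1}) (0, 1) (\<lambda>(t, x). f t x) (\<lambda>(t, x). v t x)"
  proof (rule has_weak_deriv_space[OF T f v])
    show "(f t has_real_derivative v t x) (at x)" if "t \<in> {0..T}" "x \<in> {0<..<1}" for t x
      using fx[OF that(1), of x] that(2) by (auto simp: at_within_Icc_at)
  qed
  from weak_deriv_unique[OF gx[unfolded unit_rectangle_box] this[unfolded unit_rectangle_box]]
  have gv: "AE z in lebesgue_on ({0<..<T} \<times> {0<..<1}). gx z = (case z of (t, x) \<Rightarrow> v t x)"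
    unfolding unit_rectangle_box .
  have fth: "AE z in lebesgue_on ({0<..<T} \<times> {0<..<1}). ft z = (case z of (t, x) \<Rightarrow> h t x)"
    using pde gv by eventually_elim (auto simp: h_def)
  have hm: "(\<lambda>(t, x). h t x) \<in> borel_measurable (lebesgue_on ({0<..<T} \<times> {0<..<1}))"
    using lebesgue_on_box_integral(1)[OF hc[unfolded unit_rectangle_cbox]] unfolding unit_rectangle_box by auto
  have wt: "has_weak_deriv ({0<..<T} \<times> {0<..<1}) (1, 0) (\<lambda>(t, x). f t x) (\<lambda>(t, x). h t x)"
    by (rule has_weak_deriv_cong_AE_deriv[OF ft fth hm])
  have fD: "((\<lambda>s. f s x) has_real_derivative h t x) (at t within {0..T})" if "t \<in> {0..T}" "x \<in> {0..1}" for t x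
    using AC_on_continuous_imp_DERIV[OF weak_time_deriv_imp_AC[OF T f hc wt that(2)] _ that(1)]
      continuous_on_slice(2)[OF hc that(2)] by simp
  show ?thesis
    by (rule that[of v]) (use f v fx fD lD Fc in \<open>auto simp: h_def\<close>)
qed

end

text \<open>The right-hand sides are compared along the two given solutions only, because \<open>F\<close> is
  Lipschitz continuous only away from its pole.\<close>

lemma ODE_unique:
  fixes u w a b :: "real \<Rightarrow> real"
  assumes u: "\<And>t. t \<in> {0..T} \<Longrightarrow> (u has_real_derivative a t) (at t within {0..T})"
    and w: "\<And>t. t \<in> {0..T} \<Longrightarrow> (w has_real_derivative b t) (at t within {0..T})"
    and "u 0 = w 0" and lip: "\<And>t. t \<in> {0..T} \<Longrightarrow> \<bar>a t - b t\<bar> \<le> k * \<bar>u t - w t\<bar>" and k: "0 \<le> k" and t: "t \<in> {0..T}"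
  shows "u t = w t"
proof -
  have c: "continuous_on {0..T} u" "continuous_on {0..T} w"
    using u w by (meson DERIV_continuous continuous_on_eq_continuous_within)+
  have "\<bar>u t - w t\<bar> \<le> 0 * exp (k * t)"
  proof (rule gronwall[where u = "\<lambda>t. \<bar>u t - w t\<bar>" and T = T])
    show "continuous_on {0..T} (\<lambda>t. \<bar>u t - w t\<bar>)" by (intro continuous_intros c)
    fix t assume t: "t \<in> {0..T}"
    have i: "((\<lambda>s. a s - b s) has_integral ((u t - w t) - (u 0 - w 0))) {0..t}"
    proof (rule fundamental_theorem_of_calculus)
      show "((\<lambda>t. u t - w t) has_vector_derivative a s - b s) (at s within {0..t})" if "s \<in> {0..t}" for s
        unfolding has_real_derivative_iff_has_vector_derivative[symmetric]
        using that t by (intro DERIV_diff DERIV_subset[OF u] DERIV_subset[OF w]) auto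
    qed (use t in auto)
    then have "norm (integral {0..t} (\<lambda>s. a s - b s)) \<le> integral {0..t} (\<lambda>s. k * \<bar>u s - w s\<bar>)"
    proof (intro Henstock_Kurzweil_Integration.integral_norm_bound_integral)
      show "(\<lambda>s. k * \<bar>u s - w s\<bar>) integrable_on {0..t}"
        using t by (intro integrable_continuous_real continuous_intros continuous_on_subset[OF c(1)] continuous_on_subset[OF c(2)]) auto
      show "norm (a s - b s) \<le> k * \<bar>u s - w s\<bar>" if "s \<in> {0..t}" for s
        using lip[of s] that t by auto
    qed blast
    then show "\<bar>u t - w t\<bar> \<le> 0 + k * integral {0..t} (\<lambda>t. \<bar>u t - w t\<bar>)"
      using integral_unique[OF i] assms(3) by simp
  qed (use k t in auto)
  then show ?thesis by simp
qed

context extrusion_profile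
begin

definition "data_profile l0 fp0 g \<longleftrightarrow> (\<forall>t\<in>{0..T}. (M has_real_derivative \<zeta> * N t) (at t within {0..T})) \<and> M 0 = 0 \<and>
   (\<forall>x\<in>{0..1}. \<phi> (l0 * x) = fp0 x) \<and> (\<forall>t\<in>{0..T}. \<phi> (- M t) = g t) \<and> 0 < l0 \<and>
   continuous_on {0..1} fp0 \<and> continuous_on {0..T} g"

lemma solution_boundary_values:
  assumes sol: "sol T l0 fp0 N g l f" and dp: "data_profile l0 fp0 g"
    and f: "continuous_on ({0..T} \<times> {0..1}) (\<lambda>(t, x). f t x)"
  shows "x \<in> {0..1} \<Longrightarrow> f 0 x = fp0 x" and "t \<in> {0..T} \<Longrightarrow> f t 0 = g t"
proof -
  have 1: "AE x in lebesgue_on {0<..<1}. f 0 x = fp0 x"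
    using sol by (intro AE_I2) (auto simp: is_solution_def)
  have 2: "AE t in lebesgue_on {0<..<T}. f t 0 = g t"
    using sol by (intro AE_I2) (auto simp: is_solution_def)
  show "f 0 x = fp0 x" if "x \<in> {0..1}"
    by (rule continuous_AE_eq_imp_eq[OF _ _ zero_less_one 1 that])
      (use continuous_on_slice(1)[OF f, of 0] dp T in \<open>auto simp: data_profile_def\<close>)
  show "f t 0 = g t" if "t \<in> {0..T}"
    by (rule continuous_AE_eq_imp_eq[OF _ _ T 2 that])
      (use continuous_on_slice(2)[OF f, of 0] dp in \<open>auto simp: data_profile_def\<close>)
qed

text \<open>Through \<open>(t, x)\<close> passes the characteristic \<open>X s = (y + M s) / l s\<close> with
  \<open>y = l t * x - M t\<close>. The assumption \<open>inflow\<close> says that \<open>M - l\<close> increases, which keeps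
  \<open>X \<le> 1\<close> when going back in time. It therefore leaves the strip either at time \<open>0\<close>, if \<open>y \<ge> 0\<close>,
  or at \<open>x = 0\<close>, at the time \<open>a\<close> with \<open>M a = - y\<close>. The solution is constant along \<open>X\<close>, and the
  profile has the value \<open>\<phi> y\<close> at either end.\<close>

lemma solution_representation:
  assumes sol: "sol T l0 fp0 N g l f" and dp: "data_profile l0 fp0 g" and t0: "t0 \<le> T"
    and inflow: "\<And>s. 0 < s \<Longrightarrow> s < t0 \<Longrightarrow> FF (l s) (N s) (f s 1) \<le> \<zeta> * N s"
    and t: "t \<in> {0..t0}" and x: "x \<in> {0..1}"
  shows "f t x = \<phi> (l t * x - M t)"
proof -
  obtain v where f: "continuous_on ({0..T} \<times> {0..1}) (\<lambda>(t, x). f t x)" and v: "continuous_on ({0..T} \<times> {0..1}) (\<lambda>(t, x). v t x)"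
    and fx: "\<And>t x. t \<in> {0..T} \<Longrightarrow> x \<in> {0..1} \<Longrightarrow> (f t has_real_derivative v t x) (at x within {0..1})"
    and ft: "\<And>t x. t \<in> {0..T} \<Longrightarrow> x \<in> {0..1} \<Longrightarrow>
       ((\<lambda>s. f s x) has_real_derivative - (speed x (N t) (l t) (f t 1) * v t x)) (at t within {0..T})"
    and lD: "\<And>t. t \<in> {0..T} \<Longrightarrow> (l has_real_derivative FF (l t) (N t) (f t 1)) (at t within {0..T})"
    and Fc: "continuous_on {0..T} (\<lambda>t. FF (l t) (N t) (f t 1))"
    by (rule solution_classical[OF sol T Nc]) (rule that; blast)
  have lpos: "0 < l s" if "s \<in> {0..T}" for s using sol that by (auto simp: is_solution_def)
  have lc: "continuous_on {0..T} l" using sol by (simp add: is_solution_def)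
  have l0: "l 0 = l0" using sol by (simp add: is_solution_def)
  have MD: "(M has_real_derivative \<zeta> * N s) (at s within {0..T})" if "s \<in> {0..T}" for s
    using dp that by (simp add: data_profile_def)
  have M0: "M 0 = 0" using dp by (simp add: data_profile_def)
  have tT: "t \<in> {0..T}" using t t0 by auto
  have M_mono: "M s \<le> M s'" if "0 \<le> s" "s \<le> s'" "s' \<le> T" for s s'
  proof (rule DERIV_nonneg_imp_increasing_open[OF that(2)])
    fix x assume "s < x" "x < s'"
    then show "\<exists>y. (M has_real_derivative y) (at x) \<and> 0 \<le> y"
      using MD[of x] N[of x] that \<zeta> by (auto simp: at_within_Icc_at)
  qed (use that in \<open>auto intro: continuous_on_subset[OF Mc]\<close>)
  define y where "y = l t * x - M t"
  have right: "y + M s \<le> l s" if s: "0 \<le> s" "s \<le> t" for s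
  proof -
    have "M s - l s \<le> M t - l t"
    proof (rule DERIV_nonneg_imp_increasing_open[OF s(2)])
      fix r assume r: "s < r" "r < t"
      then have "((\<lambda>s. M s - l s) has_real_derivative \<zeta> * N r - FF (l r) (N r) (f r 1)) (at r within {0..T})"
        using s tT by (intro DERIV_diff MD lD) auto
      then show "\<exists>y. ((\<lambda>s. M s - l s) has_real_derivative y) (at r) \<and> 0 \<le> y"
        using inflow[of r] r s t tT by (auto simp: at_within_Icc_at)
    qed (use s tT in \<open>auto intro!: continuous_intros continuous_on_subset[OF Mc] continuous_on_subset[OF lc]\<close>)
    moreover have "l t * x \<le> l t" using x lpos[OF tT] by (simp add: mult_left_le)
    ultimately show ?thesis by (simp add: y_def)
  qed
  define X where "X s = (y + M s) / l s" for s
  have Xt: "X t = x" using lpos[OF tT] by (simp add: X_def y_def)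
  have const: "f t x = f a (X a)" if a: "0 \<le> a" "a \<le> t" and left: "0 \<le> y + M a" for a
  proof -
    have sub: "{a..t} \<subseteq> {0..T}" using a tT by auto
    have X_in: "X s \<in> {0..1}" if "s \<in> {a..t}" for s
    proof -
      have "0 \<le> y + M s" using left M_mono[of a s] that a tT by auto
      then show ?thesis using right[of s] lpos[of s] that a tT by (auto simp: X_def divide_le_eq)
    qed
    have D: "((\<lambda>s. f s (X s)) has_real_derivative 0) (at s within {a..t})" if s: "s \<in> {a..t}" for s
    proof -
      have sT: "s \<in> {0..T}" using s sub by auto
      have "(X has_real_derivative (\<zeta> * N s * l s - (y + M s) * FF (l s) (N s) (f s 1)) / (l s * l s)) (at s within {0..T})"
        unfolding X_def using lpos[OF sT] MD[OF sT] lD[OF sT]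
        by (auto intro!: derivative_eq_intros)
      also have "(\<zeta> * N s * l s - (y + M s) * FF (l s) (N s) (f s 1)) / (l s * l s) = speed (X s) (N s) (l s) (f s 1)"
        using lpos[OF sT] by (simp add: X_def \<alpha>\<^sub>p_def field_simps)
      finally have XD: "(X has_real_derivative speed (X s) (N s) (l s) (f s 1)) (at s within {a..t})"
        by (rule DERIV_subset[OF _ sub])
      have "((\<lambda>s. f s (X s)) has_real_derivative - (speed (X s) (N s) (l s) (f s 1) * v s (X s)) + v s (X s) * speed (X s) (N s) (l s) (f s 1)) (at s within {a..t})"
      proof (rule has_real_derivative_along_path[where ft = "\<lambda>s x. - (speed x (N s) (l s) (f s 1) * v s x)" and fx = v])
        fix r x :: real assume r: "r \<in> {a..t}" and x: "x \<in> {0..1}"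
        have rT: "r \<in> {0..T}" using r sub by auto
        show "(f r has_real_derivative v r x) (at x within {0..1})" by (rule fx[OF rT x])
        show "((\<lambda>s. f s x) has_real_derivative - (speed x (N r) (l r) (f r 1) * v r x)) (at r within {a..t})"
          by (rule DERIV_subset[OF ft[OF rT x] sub])
      qed (use sub X_in XD s in \<open>auto intro: continuous_on_subset[OF v]\<close>)
      then show ?thesis by (simp add: mult.commute)
    qed
    have "f t (X t) = f a (X a)"
      by (rule constant_difference_if_DERIV_eq[OF D, where h = "\<lambda>_. f a (X a)"]) (use a in auto)
    then show ?thesis using Xt by simp
  qed
  note bv = solution_boundary_values[OF sol dp f]
  show ?thesis
  proof (cases "0 \<le> y")
    case True
    have "X 0 = y / l0" by (simp add: X_def M0 l0)
    moreover have "y / l0 \<in> {0..1}" using right[of 0] True t lpos[of 0] T by (auto simp: M0 l0 divide_le_eq)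
    ultimately have "f t x = fp0 (y / l0)"
      using const[of 0] True t M0 bv(1) by auto
    also have "\<dots> = \<phi> (l0 * (y / l0))"
      using dp \<open>y / l0 \<in> {0..1}\<close> unfolding data_profile_def by metis
    also have "l0 * (y / l0) = y" using dp by (simp add: data_profile_def)
    finally show ?thesis by (simp add: y_def)
  next
    case False
    have "- y \<le> M t" using x lpos[OF tT] by (simp add: y_def)
    then have "\<exists>a\<ge>0. a \<le> t \<and> M a = - y"
      by (intro IVT') (use False M0 tT in \<open>auto intro: continuous_on_subset[OF Mc]\<close>)
    then obtain a where a: "0 \<le> a" "a \<le> t" "M a = - y" by blast
    have aT: "a \<in> {0..T}" using a tT by auto
    have "f t x = f a 0" using const[OF a(1,2)] a(3) by (simp add: X_def)
    also have "\<dots> = g a" by (rule bv(2)[OF aT])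
    also have "\<dots> = \<phi> (- M a)" using dp aT by (simp add: data_profile_def)
    finally show ?thesis using a by (simp add: y_def)
  qed
qed

text \<open>An arbitrary solution might have inflow at \<open>x = 1\<close>, where no boundary value is
  prescribed. Up to the first time \<open>t1\<close> at which \<open>\<zeta> N \<le> l'\<close> the representation applies, hence
  \<open>l\<close> solves the same scalar equation as \<open>w\<close> and agrees with it; but then \<open>l' < \<zeta> N\<close> at \<open>t1\<close> as
  well, since this holds for \<open>w\<close>. So there is no such time.\<close>

lemma solution_unique:
  assumes sol: "sol T l0 fp0 N g l f" and dp: "data_profile l0 fp0 g"
    and w0: "w 0 = l0"
    and w: "\<And>t. t \<in> {0..T} \<Longrightarrow> (w has_real_derivative FF (w t) (N t) (\<phi> (w t - M t))) (at t within {0..T})"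
    and wr: "\<And>t. t \<in> {0..T} \<Longrightarrow> 0 < w t \<and> w t \<le> L" and w1: "\<And>t. t \<in> {0..T} \<Longrightarrow> \<phi> (w t - M t) \<le> 1 - \<delta>" and \<delta>: "0 < \<delta>"
    and inflow: "\<And>t. t \<in> {0..T} \<Longrightarrow> FF (w t) (N t) (\<phi> (w t - M t)) < \<zeta> * N t"
    and p: "\<And>y. y \<in> {-m..L} \<Longrightarrow> \<bar>p y\<bar> \<le> P"
    and t: "t \<in> {0..T}"
  shows "l t = w t" and "x \<in> {0..1} \<Longrightarrow> f t x = \<phi> (w t * x - M t)"
proof -
  obtain v where f: "continuous_on ({0..T} \<times> {0..1}) (\<lambda>(t, x). f t x)" and "continuous_on ({0..T} \<times> {0..1}) (\<lambda>(t, x). v t x)"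
    and "\<And>t x. t \<in> {0..T} \<Longrightarrow> x \<in> {0..1} \<Longrightarrow> (f t has_real_derivative v t x) (at x within {0..1})"
    and "\<And>t x. t \<in> {0..T} \<Longrightarrow> x \<in> {0..1} \<Longrightarrow>
       ((\<lambda>s. f s x) has_real_derivative - (speed x (N t) (l t) (f t 1) * v t x)) (at t within {0..T})"
    and lD: "\<And>t. t \<in> {0..T} \<Longrightarrow> (l has_real_derivative FF (l t) (N t) (f t 1)) (at t within {0..T})"
    and Fc: "continuous_on {0..T} (\<lambda>t. FF (l t) (N t) (f t 1))"
    by (rule solution_classical[OF sol T Nc]) (rule that; blast)
  have rng: "0 < l t \<and> l t < L \<and> f t 1 < 1" if "t \<in> {0..T}" for t using sol that by (auto simp: is_solution_def)
  have l0: "l 0 = l0" using sol by (simp add: is_solution_def)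
  have f1: "continuous_on {0..T} (\<lambda>t. f t 1)" using continuous_on_slice(2)[OF f, of 1] by simp
  obtain \<tau> where "\<tau> \<in> {0..T}" "\<And>t. t \<in> {0..T} \<Longrightarrow> f t 1 \<le> f \<tau> 1"
    using continuous_attains_sup[OF _ _ f1] T by auto
  \<comment> \<open>By compactness the values of \<open>f\<close> at \<open>x = 1\<close> stay away from the pole \<open>f = 1\<close> of \<open>F\<close>.\<close>
  then obtain \<delta>' where \<delta>': "0 < \<delta>'" "\<delta>' \<le> \<delta>" "\<And>t. t \<in> {0..T} \<Longrightarrow> f t 1 \<le> 1 - \<delta>'"
    using rng[of \<tau>] \<delta> by (intro that[of "min \<delta> (1 - f \<tau> 1)"]) force+
  have Nm: "0 \<le> Nm" using N[of 0] T by auto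
  have m0: "0 \<le> m" using M[of 0] T by auto
  have P0: "0 \<le> P" using p[of 0] L m0 by auto
  have agree: "l t = w t" if t0: "t0 \<in> {0..T}" and rep: "\<And>t. t \<in> {0..t0} \<Longrightarrow> f t 1 = \<phi> (l t - M t)" and t: "t \<in> {0..t0}" for t0 t
  proof (rule ODE_unique[of t0 l "\<lambda>t. FF (l t) (N t) (f t 1)" w "\<lambda>t. FF (w t) (N t) (\<phi> (w t - M t))"])
    let ?k = "V * Nm / S * (K / (B * \<rho>) / \<delta>' + P / \<delta>'\<^sup>2)"
    show "0 \<le> ?k" using V S Nm K B\<rho> \<delta>' P0 by auto
    show "(l has_real_derivative FF (l s) (N s) (f s 1)) (at s within {0..t0})" if "s \<in> {0..t0}" for s
      using that t0 by (intro DERIV_subset[OF lD]) auto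
    show "(w has_real_derivative FF (w s) (N s) (\<phi> (w s - M s))) (at s within {0..t0})" if "s \<in> {0..t0}" for s
      using that t0 by (intro DERIV_subset[OF w]) auto
    fix s assume s: "s \<in> {0..t0}"
    then have sT: "s \<in> {0..T}" using t0 by auto
    have mem: "l s - M s \<in> {-m..L}" "w s - M s \<in> {-m..L}" using rng[OF sT] wr[OF sT] M[OF sT] by auto
    have "\<bar>FF (l s) (N s) (f s 1) - FF (w s) (N s) (\<phi> (w s - M s))\<bar> \<le>
       V * N s / S * (K / (B * \<rho>) / \<delta>' * \<bar>l s - w s\<bar> + \<bar>f s 1 - \<phi> (w s - M s)\<bar> / \<delta>'\<^sup>2)"
      using rng[OF sT] wr[OF sT] w1[OF sT] \<delta>' N[OF sT] sT by (intro F_lipschitz) force+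
    also have "\<dots> \<le> V * Nm / S * (K / (B * \<rho>) / \<delta>' * \<bar>l s - w s\<bar> + P * \<bar>l s - w s\<bar> / \<delta>'\<^sup>2)"
    proof (intro mult_mono add_mono divide_right_mono mult_left_mono order_refl)
      have "\<bar>\<phi> (l s - M s) - \<phi> (w s - M s)\<bar> \<le> P * \<bar>(l s - M s) - (w s - M s)\<bar>"
        by (rule \<phi>_lipschitz[OF p mem])
      then show "\<bar>f s 1 - \<phi> (w s - M s)\<bar> \<le> P * \<bar>l s - w s\<bar>" using rep[OF s] by simp
    qed (use N[OF sT] V S Nm K B\<rho> \<delta>' in auto)
    also have "\<dots> = ?k * \<bar>l s - w s\<bar>" by (simp add: algebra_simps add_divide_distrib)
    finally show "\<bar>FF (l s) (N s) (f s 1) - FF (w s) (N s) (\<phi> (w s - M s))\<bar> \<le> ?k * \<bar>l s - w s\<bar>" .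
  qed (use l0 w0 t in auto)
  have rep: "f t x = \<phi> (l t * x - M t)" if "t0 \<in> {0..T}" "\<And>s. 0 < s \<Longrightarrow> s < t0 \<Longrightarrow> FF (l s) (N s) (f s 1) \<le> \<zeta> * N s"
     "t \<in> {0..t0}" "x \<in> {0..1}" for t0 t x
    by (rule solution_representation[OF sol dp _ that(2)]) (use that in auto)
  let ?Z = "{t \<in> {0..T}. \<zeta> * N t - FF (l t) (N t) (f t 1) \<le> 0}"
  have "?Z = {}"
  proof (rule ccontr)
    assume ne: "?Z \<noteq> {}"
    have "closed ?Z"
      by (intro continuous_on_closed_Collect_le continuous_intros Nc Fc)
    moreover have "bounded ?Z" by (rule bounded_subset[of "{0..T}"]) auto
    ultimately have "compact ?Z" by (simp add: compact_eq_bounded_closed)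
    from compact_attains_inf[OF this ne] obtain t1 where t1: "t1 \<in> ?Z" "\<And>t. t \<in> ?Z \<Longrightarrow> t1 \<le> t" by blast
    have pos: "FF (l s) (N s) (f s 1) \<le> \<zeta> * N s" if "0 < s" "s < t1" for s
      using t1(2)[of s] t1(1) that by force
    have r: "f t 1 = \<phi> (l t - M t)" if "t \<in> {0..t1}" for t
      using rep[of t1 t 1] pos t1(1) that by auto
    have "l t1 = w t1" using agree[of t1 t1] r t1(1) by auto
    then show False using inflow[of t1] r[of t1] t1(1) by auto
  qed
  then have pos: "FF (l s) (N s) (f s 1) \<le> \<zeta> * N s" if "s \<in> {0..T}" for s using that by force
  have R: "f t x = \<phi> (l t * x - M t)" if "t \<in> {0..T}" "x \<in> {0..1}" for t x
    using rep[of T t x] pos T that by auto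
  show lw: "l t = w t" using agree[of T t] R[of _ 1] T t by auto
  show "f t x = \<phi> (w t * x - M t)" if "x \<in> {0..1}" using R[OF t that] lw by simp
qed

text \<open>A travelling profile satisfies the transport equation identically, by the chain rule:
  \<open>l x - M\<close> has time derivative \<open>x l' - \<zeta> N = - l \<alpha>\<close>.\<close>

lemma travelling_profile_solution:
  assumes dp: "data_profile l0 fp0 g" and l0: "l 0 = l0"
    and lD: "\<And>t. t \<in> {0..T} \<Longrightarrow> (l has_real_derivative FF (l t) (N t) (\<phi> (l t - M t))) (at t within {0..T})"
    and lr: "\<And>t. t \<in> {0..T} \<Longrightarrow> 0 < l t \<and> l t < L" and r1: "\<And>t. t \<in> {0..T} \<Longrightarrow> 0 < \<phi> (l t - M t) \<and> \<phi> (l t - M t) < 1"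
  shows "sol T l0 fp0 N g l (\<lambda>t x. \<phi> (l t * x - M t))"
proof -
  have lc: "continuous_on {0..T} l" using lD by (meson DERIV_continuous continuous_on_eq_continuous_within)
  have Fc: "continuous_on {0..T} (\<lambda>t. FF (l t) (N t) (\<phi> (l t - M t)))"
  proof (rule F_continuous[OF lc Nc])
    show "continuous_on {0..T} (\<lambda>t. \<phi> (l t - M t))"
      by (rule continuous_on_compose2[OF continuous_\<phi>[of UNIV] continuous_on_diff[OF lc Mc]]) simp
    show "l t \<le> L" "\<phi> (l t - M t) < 1" if "t \<in> {0..T}" for t
      using lr[OF that] r1[OF that] by auto
  qed
  have lAC: "AC_on 0 T l (\<lambda>t. FF (l t) (N t) (\<phi> (l t - M t)))" by (rule AC_onI_C1[OF lD Fc])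
  have c: "continuous_on ({0..T} \<times> {0..1}) (\<lambda>(s, x). l s * x - M s)" "continuous_on ({0..T} \<times> {0..1::real}) (\<lambda>(s, x). l s)"
    "continuous_on ({0..T} \<times> {0..1::real}) (\<lambda>(s, x). x * FF (l s) (N s) (\<phi> (l s - M s)) - \<zeta> * N s)"
    unfolding case_prod_unfold
    by (intro continuous_on_diff continuous_on_mult continuous_on_const continuous_on_snd continuous_on_id
         continuous_on_compose2[OF lc] continuous_on_compose2[OF Mc] continuous_on_compose2[OF Nc] continuous_on_compose2[OF Fc] continuous_on_fst; auto)+
  have u: "continuous_on ({0..T} \<times> {0..1}) (\<lambda>(t, x). \<phi> (l t * x - M t))"
    using continuous_on_compose2[OF continuous_\<phi>[of UNIV] c(1)] by (simp add: case_prod_unfold)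
  have pc: "continuous_on ({0..T} \<times> {0..1}) (\<lambda>(t, x). p (l t * x - M t))"
    using continuous_on_compose2[OF continuous_p[of UNIV] c(1)] by (simp add: case_prod_unfold)
  have ux: "continuous_on ({0..T} \<times> {0..1}) (\<lambda>(t, x). p (l t * x - M t) * l t)"
    using continuous_on_mult[OF pc c(2)] by (simp add: case_prod_unfold)
  have ut: "continuous_on ({0..T} \<times> {0..1}) (\<lambda>(t, x). p (l t * x - M t) * (x * FF (l t) (N t) (\<phi> (l t - M t)) - \<zeta> * N t))"
    using continuous_on_mult[OF pc c(3)] by (simp add: case_prod_unfold)
  have wx: "has_weak_deriv ({0<..<T} \<times> {0<..<1}) (0, 1) (\<lambda>(t, x). \<phi> (l t * x - M t)) (\<lambda>(t, x). p (l t * x - M t) * l t)"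
  proof (rule has_weak_deriv_space[OF T u ux])
    fix t x :: real
    have "((\<lambda>x. l t * x - M t) has_real_derivative l t) (at x)" by (auto intro!: derivative_eq_intros)
    from DERIV_chain2[OF D this] show "((\<lambda>x. \<phi> (l t * x - M t)) has_real_derivative p (l t * x - M t) * l t) (at x)" .
  qed
  have wt: "has_weak_deriv ({0<..<T} \<times> {0<..<1}) (1, 0) (\<lambda>(t, x). \<phi> (l t * x - M t))
     (\<lambda>(t, x). p (l t * x - M t) * (x * FF (l t) (N t) (\<phi> (l t - M t)) - \<zeta> * N t))"
  proof (rule has_weak_deriv_time[OF T u ut])
    fix t x :: real assume t: "t \<in> {0<..<T}"
    have "(l has_real_derivative FF (l t) (N t) (\<phi> (l t - M t))) (at t)" "(M has_real_derivative \<zeta> * N t) (at t)"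
    proof -
      have "t \<in> {0..T}" using t by simp
      then have "(M has_real_derivative \<zeta> * N t) (at t within {0..T})" using dp by (simp add: data_profile_def)
      then show "(l has_real_derivative FF (l t) (N t) (\<phi> (l t - M t))) (at t)" "(M has_real_derivative \<zeta> * N t) (at t)"
        using lD[of t] t by (auto simp: at_within_Icc_at)
    qed
    then have "((\<lambda>s. l s * x - M s) has_real_derivative x * FF (l t) (N t) (\<phi> (l t - M t)) - \<zeta> * N t) (at t)"
      by (auto intro!: derivative_eq_intros)
    from DERIV_chain2[OF D this]
    show "((\<lambda>s. \<phi> (l s * x - M s)) has_real_derivative p (l t * x - M t) * (x * FF (l t) (N t) (\<phi> (l t - M t)) - \<zeta> * N t)) (at t)" .
  qed
  show ?thesis
    unfolding is_solution_def
  proof (intro conjI ballI exI)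
    show "l \<in> W1inf {0<..<T}" by (rule AC_on_imp_W1inf[OF lAC Fc T])
    show "(\<lambda>t x. \<phi> (l t * x - M t)) \<in> C0_H2 T" by (rule travelling_profile_C0_H2) (use lc lr Mc in auto)
    show "continuous_on {0..1} (\<lambda>x. \<phi> (l t * x - M t))" for t
      by (intro continuous_on_compose2[OF continuous_\<phi>[of UNIV]] continuous_intros) auto
    show "AE t in lebesgue_on {0<..<T}. weak_deriv {0<..<T} l t = FF (l t) (N t) (\<phi> (l t * 1 - M t))"
      using weak_deriv_AE_eq[OF AC_on_imp_weak_deriv[OF lAC T]] by simp
    show "AE (t, x) in lebesgue_on ({0<..<T} \<times> {0<..<1}).
       (\<lambda>(t, x). p (l t * x - M t) * (x * FF (l t) (N t) (\<phi> (l t - M t)) - \<zeta> * N t)) (t, x) +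
       speed x (N t) (l t) (\<phi> (l t * 1 - M t)) * (\<lambda>(t, x). p (l t * x - M t) * l t) (t, x) = 0"
    proof (rule AE_I2, clarsimp)
      fix t x :: real assume "0 < t" "t < T"
      then have "0 < l t" using lr by auto
      then show "p (l t * x - M t) * (x * FF (l t) (N t) (\<phi> (l t - M t)) - \<zeta> * N t) +
         speed x (N t) (l t) (\<phi> (l t - M t)) * (p (l t * x - M t) * l t) = 0"
        by (simp add: \<alpha>\<^sub>p_def field_simps)
    qed
  qed (use lc lr r1 l0 dp T wx wt in \<open>auto simp: data_profile_def\<close>)
qed

end

section \<open>Well-posedness near the equilibrium\<close>

context extrusion
begin

text \<open>The constants bound, in this order, the length of the relevant part of the profile (\<open>R\<close>),
  the square of the \<open>L\<^sup>2\<close> norm of its second derivative (\<open>CQ\<close>), its first derivative (\<open>A1\<close>), its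
  distance to \<open>fe\<close> (\<open>A2\<close>), the partial Lipschitz constants of \<open>F\<close> (\<open>K1\<close>, \<open>K2\<close>), the distance of the
  trajectory to \<open>le\<close> (\<open>A3\<close>) and the speed of the trajectory (\<open>A4\<close>), all except \<open>R\<close>, \<open>K1\<close>, \<open>K2\<close> up to the
  factor \<open>\<epsilon>\<close>, or \<open>\<epsilon>\<^sup>2\<close> for \<open>CQ\<close>. The conditions \<open>small\<close> keep trajectory and profile inside the
  domain of \<open>F\<close> and the flow at \<open>x = 1\<close> outgoing.\<close>

lemma well_posed_near_equilibrium:
  fixes T le Ne fe \<epsilon> :: real
  defines "Nm \<equiv> 3 / 2 * Ne" and "n0 \<equiv> Ne / 2" and "\<delta> \<equiv> (1 - fe) / 2"
  defines "R \<equiv> L + \<zeta> * Nm * T"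
  defines "CQ \<equiv> 8 / le ^ 3 + 4 / (\<zeta> * n0) ^ 3"
  defines "A1 \<equiv> 4 / le + sqrt (R * CQ)"
  defines "A2 \<equiv> 2 + R * A1"
  defines "K1 \<equiv> V * Nm / S * (K / (B * \<rho>) / \<delta>)" and "K2 \<equiv> V * Nm / S * (1 / \<delta>\<^sup>2)"
  defines "A3 \<equiv> (1 + K2 * A2 * T) * exp (K1 * T)"
  defines "A4 \<equiv> K1 * A3 + K2 * A2"
  assumes T: "0 < T" and eq: "FF le Ne fe = 0" "0 < fe" "fe < 1" "0 < le" "le < L" "0 < Ne"
    and \<epsilon>: "0 < \<epsilon>" "\<epsilon> \<le> Ne / 2" "\<epsilon> \<le> le / 2"
    and small: "A3 * \<epsilon> \<le> le / 2" "A3 * \<epsilon> \<le> (L - le) / 2" "A2 * \<epsilon> \<le> \<delta>" "A2 * \<epsilon> \<le> fe / 2" "A4 * \<epsilon> \<le> \<zeta> * n0 / 2"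
    and l0: "0 < l0"
    and fp0: "fp0 \<in> H2 {0<..<1}" "continuous_on {0..1} fp0"
    and N: "N \<in> W1inf {0<..<T}" "continuous_on {0..T} N"
    and g: "g \<in> H2 {0<..<T}" "(\<forall>t\<in>{0..T}. 0 < N t) \<longrightarrow> continuous_on {0..T} g"
    and comp: "g 0 = fp0 0"
      "cont_rep 0 1 (weak_deriv {0<..<1} fp0) 0 + l0 / (\<zeta> * N 0) * cont_rep 0 T (weak_deriv {0<..<T} g) 0 = 0"
    and close: "H2_norm {0<..<1} (\<lambda>x. fp0 x - fe) \<le> \<epsilon>" "H2_norm {0<..<T} (\<lambda>t. g t - fe) \<le> \<epsilon>"
      "W1inf_norm {0<..<T} (\<lambda>t. N t - Ne) \<le> \<epsilon>" "\<bar>l0 - le\<bar> \<le> \<epsilon>"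
  shows "\<exists>l f. sol T l0 fp0 N g l f
     \<and> (\<forall>l' f'. sol T l0 fp0 N g l' f' \<longrightarrow> (\<forall>t\<in>{0..T}. l' t = l t \<and> (\<forall>x\<in>{0..1}. f' t x = f t x)))
     \<and> C0_H2_norm T (\<lambda>t x. f t x - fe) \<le> sqrt (A2\<^sup>2 + (L * A1)\<^sup>2 + L ^ 3 * CQ) * \<epsilon>"
proof -
  obtain N' where N': "AC_on 0 T N N'" "\<And>t. \<bar>N' t\<bar> \<le> \<epsilon>" and N_close: "\<And>t. t \<in> {0..T} \<Longrightarrow> \<bar>N t - Ne\<bar> \<le> \<epsilon>"
    using W1inf_norm_close[OF N T close(3)] by metis
  have n0: "0 < n0" "\<epsilon> \<le> n0" using eq \<epsilon> by (auto simp: n0_def)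
  have N_lo: "n0 \<le> N t" and N_up: "N t \<le> Nm" if "t \<in> {0..T}" for t
    using N_close[OF that] \<epsilon> by (auto simp: n0_def Nm_def)
  have gc: "continuous_on {0..T} g" using g(2) N_lo n0 by force
  obtain p0 q0 where f0: "H2_triple 0 1 fp0 p0 q0" "integral {0..1} (\<lambda>x. (q0 x)\<^sup>2) \<le> \<epsilon>\<^sup>2"
    "\<bar>fp0 0 - fe\<bar> \<le> 2 * \<epsilon>" "\<bar>p0 0\<bar> \<le> 2 * \<epsilon>"
  proof (rule H2_close[OF fp0 zero_less_one close(1)])
    fix p q assume "H2_triple 0 1 fp0 p q" "integral {0..1} (\<lambda>x. (q x)\<^sup>2) \<le> \<epsilon>\<^sup>2"
      "\<And>x. x \<in> {0..1} \<Longrightarrow> \<bar>fp0 x - fe\<bar> \<le> sqrt (2 / 1 + 2 * 1) * \<epsilon>" "\<And>x. x \<in> {0..1} \<Longrightarrow> \<bar>p x\<bar> \<le> sqrt (2 / 1 + 2 * 1) * \<epsilon>"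
    then show ?thesis using that[of p q] by (auto simp: real_sqrt_four)
  qed
  obtain g1 g2 where gt: "H2_triple 0 T g g1 g2" "integral {0..T} (\<lambda>x. (g1 x)\<^sup>2) \<le> \<epsilon>\<^sup>2" "integral {0..T} (\<lambda>x. (g2 x)\<^sup>2) \<le> \<epsilon>\<^sup>2"
    by (rule H2_close[OF g(1) gc T close(2)])
  have comp1: "p0 0 + l0 / (\<zeta> * N 0) * g1 0 = 0"
    using comp(2) cont_rep_H2[OF f0(1) zero_less_one] cont_rep_H2[OF gt(1) T] by simp
  have l0_lo: "le / 2 \<le> l0" using close(4) \<epsilon> by auto
  let ?M = "\<lambda>t. integral {0..t} (\<lambda>s. \<zeta> * N s)"
  obtain \<phi> p q where \<phi>D: "\<And>y. (\<phi> has_real_derivative p y) (at y)" and pAC: "\<And>x y. AC_on x y p q"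
    and qm: "q \<in> borel_measurable lebesgue" and q2: "(\<lambda>y. (q y)\<^sup>2) integrable_on UNIV"
    and \<phi>f: "\<And>x. x \<in> {0..1} \<Longrightarrow> \<phi> (l0 * x) = fp0 x" and \<phi>g: "\<And>t. t \<in> {0..T} \<Longrightarrow> \<phi> (- ?M t) = g t"
    and p_0: "p 0 = p0 0 / l0"
    and qQ: "integral UNIV (\<lambda>y. (q y)\<^sup>2) \<le> integral {0..1} (\<lambda>x. (q0 x)\<^sup>2) / l0 ^ 3 +
        2 / (\<zeta> * n0) ^ 3 * (integral {0..T} (\<lambda>t. (g2 t)\<^sup>2) + (\<epsilon> / n0)\<^sup>2 * integral {0..T} (\<lambda>t. (g1 t)\<^sup>2))"
    by (rule profile_exists[OF T l0 \<zeta> n0(1) N'(1) N_lo N'(2) f0(1) gt(1) comp(1) comp1]) (assumption, (rule that; (assumption | blast)))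
  have M0: "?M 0 = 0" using integral_refl[of 0 "\<lambda>s. \<zeta> * N s"] unfolding box_real .
  have MD: "(?M has_real_derivative \<zeta> * N t) (at t within {0..T})" if "t \<in> {0..T}" for t
    by (rule integral_has_real_derivative_within) (use that in \<open>auto intro!: continuous_intros N\<close>)
  have Mb: "0 \<le> ?M t \<and> ?M t \<le> \<zeta> * Nm * T" if t: "t \<in> {0..T}" for t
  proof
    have i: "(\<lambda>s. \<zeta> * N s) integrable_on {0..t}"
      using t by (intro integrable_continuous_real continuous_intros continuous_on_subset[OF N(2)]) auto
    show "0 \<le> ?M t"
      using \<zeta> n0 N_lo t by (intro Henstock_Kurzweil_Integration.integral_nonneg i mult_nonneg_nonneg) force+
    have "?M t \<le> integral {0..t} (\<lambda>s. \<zeta> * Nm)"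
      using \<zeta> N_up t by (intro integral_le i mult_left_mono) auto
    also have "\<dots> = t * (\<zeta> * Nm)" using t by simp
    also have "\<dots> \<le> T * (\<zeta> * Nm)" using t \<zeta> eq by (intro mult_right_mono) (auto simp: Nm_def)
    finally show "?M t \<le> \<zeta> * Nm * T" by (simp add: mult_ac)
  qed
  interpret P: extrusion_profile L \<zeta> \<rho> V S B K \<phi> p q N ?M T "\<zeta> * Nm * T" Nm
  proof unfold_locales
    show "continuous_on {0..T} ?M"
      using MD by (meson DERIV_continuous continuous_on_eq_continuous_within)
    show "0 \<le> N t \<and> N t \<le> Nm" if "t \<in> {0..T}" for t using N_lo[OF that] N_up[OF that] n0 by simp
  qed (use \<phi>D pAC qm q2 T N Mb in auto)
  let ?m = "\<zeta> * Nm * T"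
  have m0: "0 \<le> ?m" using \<zeta> T eq by (simp add: Nm_def)
  have R: "0 < R" using L m0 by (simp add: R_def)
  have CQ: "0 < CQ" unfolding CQ_def using eq \<zeta> n0 by (intro add_pos_pos divide_pos_pos zero_less_power mult_pos_pos) auto
  have A1: "0 < A1" unfolding A1_def using eq R CQ by (intro add_pos_nonneg) auto
  have A2: "0 < A2" unfolding A2_def using R A1 by (intro add_pos_pos mult_pos_pos) auto
  have \<delta>: "0 < \<delta>" using eq by (simp add: \<delta>_def)
  have Nm: "0 < Nm" using eq by (simp add: Nm_def)
  have K1: "0 < K1" unfolding K1_def using V S K B \<rho> \<delta> Nm by (intro mult_pos_pos divide_pos_pos) auto
  have K2: "0 < K2" unfolding K2_def using V S \<delta> Nm by (intro mult_pos_pos divide_pos_pos zero_less_power) auto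
  have Q: "integral UNIV (\<lambda>y. (q y)\<^sup>2) \<le> CQ * \<epsilon>\<^sup>2"
  proof -
    have "integral {0..1} (\<lambda>x. (q0 x)\<^sup>2) / l0 ^ 3 \<le> \<epsilon>\<^sup>2 / (le / 2) ^ 3"
      using f0(2) l0_lo eq l0 by (intro frac_le power_mono) auto
    moreover have "2 / (\<zeta> * n0) ^ 3 * (integral {0..T} (\<lambda>t. (g2 t)\<^sup>2) + (\<epsilon> / n0)\<^sup>2 * integral {0..T} (\<lambda>t. (g1 t)\<^sup>2)) \<le>
        2 / (\<zeta> * n0) ^ 3 * (\<epsilon>\<^sup>2 + 1 * \<epsilon>\<^sup>2)"
    proof (intro mult_left_mono add_mono mult_mono gt)
      show "(\<epsilon> / n0)\<^sup>2 \<le> 1" using n0 \<epsilon> by (intro power_le_one) (auto simp: divide_le_eq)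
      show "0 \<le> integral {0..T} (\<lambda>t. (g1 t)\<^sup>2)"
        using H2_triple_integrable_sq(2)[OF gt(1)] by (rule Henstock_Kurzweil_Integration.integral_nonneg) simp
    qed (use \<zeta> n0 in auto)
    moreover have "\<epsilon>\<^sup>2 / (le / 2) ^ 3 + 2 / (\<zeta> * n0) ^ 3 * (\<epsilon>\<^sup>2 + 1 * \<epsilon>\<^sup>2) = CQ * \<epsilon>\<^sup>2"
      by (simp add: CQ_def power_divide field_simps)
    ultimately show ?thesis using qQ by linarith
  qed
  have p_le: "\<bar>p y\<bar> \<le> A1 * \<epsilon>" if y: "y \<in> {- ?m..L}" for y
  proof -
    have "\<bar>y\<bar> \<le> R" using y m0 L by (auto simp: R_def)
    then have "\<bar>p y\<bar> \<le> \<bar>p 0\<bar> + sqrt (R * (CQ * \<epsilon>\<^sup>2))" by (rule P.p_bound[OF Q])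
    also have "sqrt (R * (CQ * \<epsilon>\<^sup>2)) = sqrt (R * CQ) * \<epsilon>" using \<epsilon> by (simp add: real_sqrt_mult)
    also have "\<bar>p 0\<bar> \<le> 2 * \<epsilon> / (le / 2)"
      unfolding p_0 abs_divide using f0(4) l0_lo l0 eq by (intro frac_le) auto
    finally show ?thesis by (simp add: A1_def algebra_simps)
  qed
  have \<phi>_le: "\<bar>\<phi> y - fe\<bar> \<le> A2 * \<epsilon>" if y: "y \<in> {- ?m..L}" for y
  proof -
    have "\<bar>\<phi> y - \<phi> 0\<bar> \<le> A1 * \<epsilon> * \<bar>y - 0\<bar>"
      by (rule P.\<phi>_lipschitz[OF p_le y]) (use m0 L in auto)
    also have "\<dots> \<le> A1 * \<epsilon> * R" using y m0 L A1 \<epsilon> by (intro mult_left_mono) (auto simp: R_def)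
    finally have "\<bar>\<phi> y - \<phi> 0\<bar> \<le> A1 * \<epsilon> * R" .
    moreover have "\<bar>\<phi> 0 - fe\<bar> \<le> 2 * \<epsilon>" using \<phi>f[of 0] f0(3) by simp
    ultimately show ?thesis by (simp add: A2_def algebra_simps)
  qed
  have A3: "0 < A3" unfolding A3_def using K2 A2 T by (intro mult_pos_pos add_pos_pos) auto
  obtain l where l_0: "l 0 = l0"
    and lD: "\<And>t. t \<in> {0..T} \<Longrightarrow> (l has_real_derivative FF (l t) (N t) (\<phi> (l t - ?M t))) (at t within {0..T})"
    and l_close: "\<And>t. t \<in> {0..T} \<Longrightarrow> \<bar>l t - le\<bar> \<le> A3 * \<epsilon>"
  proof (rule P.trajectory_exists[where r = "A3 * \<epsilon>" and \<eta> = "A2 * \<epsilon>" and P = "A1 * \<epsilon>" and ?l0.0 = l0, OF eq(1,6,3) _ _ _ \<delta>])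
    show "0 < le - A3 * \<epsilon>" "le + A3 * \<epsilon> < L" using small eq by auto
    show "0 \<le> A3 * \<epsilon>" using A3 \<epsilon> by simp
    show "fe + A2 * \<epsilon> \<le> 1 - \<delta>" using small(3) by (simp add: \<delta>_def field_simps)
    show "(\<bar>l0 - le\<bar> + V * Nm / S * (A2 * \<epsilon> / \<delta>\<^sup>2) * T) * exp (V * Nm / S * (K / (B * \<rho>) / \<delta>) * T) \<le> A3 * \<epsilon>"
    proof -
      have "(\<bar>l0 - le\<bar> + V * Nm / S * (A2 * \<epsilon> / \<delta>\<^sup>2) * T) * exp (K1 * T) \<le> (\<epsilon> + K2 * A2 * T * \<epsilon>) * exp (K1 * T)"
        using close(4) by (intro mult_right_mono) (auto simp: K2_def mult_ac)
      also have "\<dots> = A3 * \<epsilon>" by (simp add: A3_def algebra_simps)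
      finally show ?thesis by (simp add: K1_def)
    qed
  qed (use \<phi>_le p_le in auto)
  have lr: "0 < l t \<and> l t < L" if "t \<in> {0..T}" for t
    using l_close[OF that] small(1,2) eq by (auto simp: abs_le_iff)
  have mem: "l t * x - ?M t \<in> {- ?m..L}" if t: "t \<in> {0..T}" and x: "x \<in> {0..1}" for t x
  proof -
    have "0 \<le> l t * x" "l t * x \<le> l t" using lr[OF t] x by (auto simp: mult_left_le)
    then have "- ?m \<le> l t * x - ?M t" "l t * x - ?M t \<le> L"
      using conjunct2[OF lr[OF t]] conjunct1[OF Mb[OF t]] conjunct2[OF Mb[OF t]] by linarith+
    then show ?thesis by (simp only: atLeastAtMost_iff)
  qed
  have mem1: "l t - ?M t \<in> {- ?m..L}" if "t \<in> {0..T}" for t using mem[OF that, of 1] by simp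
  have r1: "0 < \<phi> (l t - ?M t) \<and> \<phi> (l t - ?M t) \<le> 1 - \<delta>" if "t \<in> {0..T}" for t
    using \<phi>_le[OF mem1[OF that]] small(3,4) eq by (auto simp: \<delta>_def abs_le_iff field_simps)
  have inflow: "FF (l t) (N t) (\<phi> (l t - ?M t)) < \<zeta> * N t" if t: "t \<in> {0..T}" for t
  proof -
    have "\<bar>FF (l t) (N t) (\<phi> (l t - ?M t)) - FF le (N t) fe\<bar> \<le>
        V * N t / S * (K / (B * \<rho>) / \<delta> * \<bar>l t - le\<bar> + \<bar>\<phi> (l t - ?M t) - fe\<bar> / \<delta>\<^sup>2)"
      using lr[OF t] r1[OF t] eq \<delta> N_lo[OF t] n0 by (intro F_lipschitz) (auto simp: \<delta>_def field_simps)
    also have "\<dots> \<le> V * Nm / S * (K / (B * \<rho>) / \<delta> * (A3 * \<epsilon>) + A2 * \<epsilon> / \<delta>\<^sup>2)"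
      using N_up[OF t] N_lo[OF t] n0 V S K B \<rho> \<delta> A3 A2 \<epsilon> Nm l_close[OF t] \<phi>_le[OF mem1[OF t]]
      by (intro mult_mono add_mono divide_right_mono mult_left_mono add_nonneg_nonneg mult_nonneg_nonneg divide_nonneg_nonneg) auto
    also have "\<dots> = A4 * \<epsilon>" by (simp add: A4_def K1_def K2_def algebra_simps)
    also have "\<dots> < \<zeta> * n0" using small(5) mult_pos_pos[OF \<zeta> n0(1)] by linarith
    also have "\<dots> \<le> \<zeta> * N t" using \<zeta> N_lo[OF t] by simp
    finally show ?thesis using F_equilibrium[of le Ne fe "N t"] eq by simp
  qed
  have dp: "P.data_profile l0 fp0 g"
    unfolding P.data_profile_def by (intro conjI ballI MD M0 \<phi>f \<phi>g l0 fp0(2) gc)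
  let ?f = "\<lambda>t x. \<phi> (l t * x - ?M t)"
  have "sol T l0 fp0 N g l ?f"
    by (rule P.travelling_profile_solution[OF dp l_0 lD lr]) (use r1 \<delta> in force)+
  moreover have "l' t = l t \<and> (\<forall>x\<in>{0..1}. f' t x = ?f t x)" if "sol T l0 fp0 N g l' f'" "t \<in> {0..T}" for l' f' t
  proof -
    have "0 < l t \<and> l t \<le> L" "\<phi> (l t - ?M t) \<le> 1 - \<delta>" if "t \<in> {0..T}" for t
      using lr[OF that] r1[OF that] by linarith+
    from P.solution_unique[OF that(1) dp l_0 lD this \<delta> inflow p_le that(2)] show ?thesis by blast
  qed
  moreover have "C0_H2_norm T (\<lambda>t x. ?f t x - fe) \<le> sqrt (A2\<^sup>2 + (L * A1)\<^sup>2 + L ^ 3 * CQ) * \<epsilon>"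
    unfolding C0_H2_norm_def
  proof (rule cSUP_least)
    fix t assume t: "t \<in> {0..T}"
    have "H2_norm {0<..<1} (\<lambda>x. ?f t x - fe) \<le> sqrt ((A2 * \<epsilon>)\<^sup>2 + (l t * (A1 * \<epsilon>))\<^sup>2 + l t ^ 3 * (CQ * \<epsilon>\<^sup>2))"
      by (rule P.H2_norm_affine_le[OF _ \<phi>_le[OF mem] p_le[OF mem] Q]) (use lr t in auto)
    also have "\<dots> \<le> sqrt ((A2 * \<epsilon>)\<^sup>2 + (L * (A1 * \<epsilon>))\<^sup>2 + L ^ 3 * (CQ * \<epsilon>\<^sup>2))"
      using lr[OF t] A1 A2 CQ \<epsilon> by (intro real_sqrt_le_mono add_mono power_mono mult_right_mono) auto
    also have "(A2 * \<epsilon>)\<^sup>2 + (L * (A1 * \<epsilon>))\<^sup>2 + L ^ 3 * (CQ * \<epsilon>\<^sup>2) = (A2\<^sup>2 + (L * A1)\<^sup>2 + L ^ 3 * CQ) * \<epsilon>\<^sup>2"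
      by (simp add: power_mult_distrib algebra_simps)
    also have "sqrt \<dots> = sqrt (A2\<^sup>2 + (L * A1)\<^sup>2 + L ^ 3 * CQ) * \<epsilon>" using \<epsilon> by (simp add: real_sqrt_mult)
    finally show "H2_norm {0<..<1} (\<lambda>x. ?f t x - fe) \<le> sqrt (A2\<^sup>2 + (L * A1)\<^sup>2 + L ^ 3 * CQ) * \<epsilon>" .
  qed (use T in auto)
  ultimately show ?thesis by blast
qed

end

theorem theorem4p2:
  fixes L \<zeta> \<rho>\<^sub>o V\<^sub>e\<^sub>f\<^sub>f S\<^sub>e\<^sub>f\<^sub>f B K\<^sub>d T l\<^sub>e N\<^sub>e f\<^sub>p\<^sub>e :: real
  assumes "0 < L" and "0 < \<zeta>" and "0 < \<rho>\<^sub>o" and "0 < V\<^sub>e\<^sub>f\<^sub>f" and "0 < S\<^sub>e\<^sub>f\<^sub>f" and "0 < B" and "0 < K\<^sub>d"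
    and "0 < T"
    and "F L \<rho>\<^sub>o V\<^sub>e\<^sub>f\<^sub>f S\<^sub>e\<^sub>f\<^sub>f B K\<^sub>d l\<^sub>e N\<^sub>e f\<^sub>p\<^sub>e = 0"
    and "0 < f\<^sub>p\<^sub>e" and "f\<^sub>p\<^sub>e < 1" and "0 < l\<^sub>e" and "l\<^sub>e < L" and "0 < N\<^sub>e"
  shows "\<exists>\<epsilon>\<^sub>0>0. \<exists>C::real. \<forall>\<epsilon>. 0 < \<epsilon> \<and> \<epsilon> \<le> \<epsilon>\<^sub>0 \<longrightarrow>
    (\<forall>(l0::real) (fp0::real \<Rightarrow> real) (Fin::real \<Rightarrow> real) (N::real \<Rightarrow> real) (g::real \<Rightarrow> real).
       g = (\<lambda>t. Fin t / (\<rho>\<^sub>o * V\<^sub>e\<^sub>f\<^sub>f * N t)) \<longrightarrow>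
       0 < l0 \<and> l0 < L \<longrightarrow>
       fp0 \<in> H2 {0<..<1} \<and> continuous_on {0..1} fp0 \<longrightarrow>
       Fin \<in> W1inf {0<..<T} \<and> continuous_on {0..T} Fin \<longrightarrow>
       N \<in> W1inf {0<..<T} \<and> continuous_on {0..T} N \<longrightarrow>
       g \<in> H2 {0<..<T} \<longrightarrow>
       g 0 = fp0 0 \<longrightarrow>
       cont_rep 0 1 (weak_deriv {0<..<1} fp0) 0
         + l0 / (\<zeta> * N 0) * cont_rep 0 T (weak_deriv {0<..<T} g) 0 = 0 \<longrightarrow>
       H2_norm {0<..<1} (\<lambda>x. fp0 x - f\<^sub>p\<^sub>e) + H2_norm {0<..<T} (\<lambda>t. g t - f\<^sub>p\<^sub>e)
         + W1inf_norm {0<..<T} (\<lambda>t. N t - N\<^sub>e) + \<bar>l0 - l\<^sub>e\<bar> \<le> \<epsilon> \<longrightarrow>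
       (\<exists>l f\<^sub>p. is_solution L \<zeta> \<rho>\<^sub>o V\<^sub>e\<^sub>f\<^sub>f S\<^sub>e\<^sub>f\<^sub>f B K\<^sub>d T l0 fp0 N g l f\<^sub>p
          \<and> (\<forall>l' f\<^sub>p'. is_solution L \<zeta> \<rho>\<^sub>o V\<^sub>e\<^sub>f\<^sub>f S\<^sub>e\<^sub>f\<^sub>f B K\<^sub>d T l0 fp0 N g l' f\<^sub>p' \<longrightarrow>
               (\<forall>t\<in>{0..T}. l' t = l t \<and> (\<forall>x\<in>{0..1}. f\<^sub>p' t x = f\<^sub>p t x)))
          \<and> C0_H2_norm T (\<lambda>t x. f\<^sub>p t x - f\<^sub>p\<^sub>e) \<le> C * \<epsilon>))"
proof -
  interpret extrusion L \<zeta> \<rho>\<^sub>o V\<^sub>e\<^sub>f\<^sub>f S\<^sub>e\<^sub>f\<^sub>f B K\<^sub>d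
    by unfold_locales (use assms in auto)
  define Nm n0 \<delta> where "Nm = 3 / 2 * N\<^sub>e" and "n0 = N\<^sub>e / 2" and "\<delta> = (1 - f\<^sub>p\<^sub>e) / 2"
  define R where "R = L + \<zeta> * Nm * T"
  define CQ where "CQ = 8 / l\<^sub>e ^ 3 + 4 / (\<zeta> * n0) ^ 3"
  define A1 where "A1 = 4 / l\<^sub>e + sqrt (R * CQ)"
  define A2 where "A2 = 2 + R * A1"
  define K1 K2 where "K1 = V\<^sub>e\<^sub>f\<^sub>f * Nm / S\<^sub>e\<^sub>f\<^sub>f * (K\<^sub>d / (B * \<rho>\<^sub>o) / \<delta>)" and "K2 = V\<^sub>e\<^sub>f\<^sub>f * Nm / S\<^sub>e\<^sub>f\<^sub>f * (1 / \<delta>\<^sup>2)"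
  define A3 where "A3 = (1 + K2 * A2 * T) * exp (K1 * T)"
  define A4 where "A4 = K1 * A3 + K2 * A2"
  note defs = A4_def A3_def K2_def K1_def A2_def A1_def CQ_def R_def \<delta>_def n0_def Nm_def
  have pos: "0 < Nm" "0 < n0" "0 < \<delta>" using assms by (auto simp: Nm_def n0_def \<delta>_def)
  have R: "0 < R" unfolding R_def using assms pos by (intro add_pos_pos mult_pos_pos) auto
  have CQ: "0 < CQ" unfolding CQ_def using assms pos by (intro add_pos_pos divide_pos_pos zero_less_power mult_pos_pos) auto
  have A1: "0 < A1" unfolding A1_def using assms R CQ by (intro add_pos_nonneg) auto
  have A2: "0 < A2" unfolding A2_def using R A1 by (intro add_pos_pos mult_pos_pos) auto
  have K12: "0 < K1" "0 < K2" unfolding K1_def K2_def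
    using assms pos by (intro mult_pos_pos divide_pos_pos zero_less_power; auto)+
  have A3: "0 < A3" unfolding A3_def using K12 A2 assms by (intro mult_pos_pos add_pos_pos) auto
  have A4: "0 < A4" unfolding A4_def using K12 A2 A3 by (intro add_pos_pos mult_pos_pos) auto
  define E where "E = {N\<^sub>e / 2, l\<^sub>e / 2, l\<^sub>e / 2 / A3, (L - l\<^sub>e) / 2 / A3, \<delta> / A2, f\<^sub>p\<^sub>e / 2 / A2, \<zeta> * n0 / 2 / A4}"
  define \<epsilon>\<^sub>0 where "\<epsilon>\<^sub>0 = Min E"
  have \<epsilon>\<^sub>0_pos: "0 < \<epsilon>\<^sub>0"
    unfolding \<epsilon>\<^sub>0_def using assms pos A2 A3 A4 by (subst Min_gr_iff) (auto simp: E_def)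
  have small: "\<epsilon> \<le> N\<^sub>e / 2" "\<epsilon> \<le> l\<^sub>e / 2" "A3 * \<epsilon> \<le> l\<^sub>e / 2" "A3 * \<epsilon> \<le> (L - l\<^sub>e) / 2" "A2 * \<epsilon> \<le> \<delta>"
      "A2 * \<epsilon> \<le> f\<^sub>p\<^sub>e / 2" "A4 * \<epsilon> \<le> \<zeta> * n0 / 2" if "\<epsilon> \<le> \<epsilon>\<^sub>0" for \<epsilon>
  proof -
    have "\<epsilon> \<le> N\<^sub>e / 2" "\<epsilon> \<le> l\<^sub>e / 2" "\<epsilon> \<le> l\<^sub>e / 2 / A3" "\<epsilon> \<le> (L - l\<^sub>e) / 2 / A3" "\<epsilon> \<le> \<delta> / A2"
      "\<epsilon> \<le> f\<^sub>p\<^sub>e / 2 / A2" "\<epsilon> \<le> \<zeta> * n0 / 2 / A4"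
      by (rule order_trans[OF that[unfolded \<epsilon>\<^sub>0_def] Min_le]; simp add: E_def)+
    then show "\<epsilon> \<le> N\<^sub>e / 2" "\<epsilon> \<le> l\<^sub>e / 2" "A3 * \<epsilon> \<le> l\<^sub>e / 2" "A3 * \<epsilon> \<le> (L - l\<^sub>e) / 2" "A2 * \<epsilon> \<le> \<delta>"
      "A2 * \<epsilon> \<le> f\<^sub>p\<^sub>e / 2" "A4 * \<epsilon> \<le> \<zeta> * n0 / 2"
      using A2 A3 A4 by (simp_all add: pos_le_divide_eq mult_ac)
  qed
  show ?thesis
  proof (rule exI[of _ \<epsilon>\<^sub>0], rule conjI[OF \<epsilon>\<^sub>0_pos], rule exI[of _ "sqrt (A2\<^sup>2 + (L * A1)\<^sup>2 + L ^ 3 * CQ)"],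
      intro allI impI)
    fix \<epsilon> l0 :: real and fp0 Fin N g :: "real \<Rightarrow> real"
    assume a: "0 < \<epsilon> \<and> \<epsilon> \<le> \<epsilon>\<^sub>0" "g = (\<lambda>t. Fin t / (\<rho>\<^sub>o * V\<^sub>e\<^sub>f\<^sub>f * N t))" "0 < l0 \<and> l0 < L"
      "fp0 \<in> H2 {0<..<1} \<and> continuous_on {0..1} fp0" "Fin \<in> W1inf {0<..<T} \<and> continuous_on {0..T} Fin"
      "N \<in> W1inf {0<..<T} \<and> continuous_on {0..T} N" "g \<in> H2 {0<..<T}" "g 0 = fp0 0"
      "cont_rep 0 1 (weak_deriv {0<..<1} fp0) 0 + l0 / (\<zeta> * N 0) * cont_rep 0 T (weak_deriv {0<..<T} g) 0 = 0"
      "H2_norm {0<..<1} (\<lambda>x. fp0 x - f\<^sub>p\<^sub>e) + H2_norm {0<..<T} (\<lambda>t. g t - f\<^sub>p\<^sub>e)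
         + W1inf_norm {0<..<T} (\<lambda>t. N t - N\<^sub>e) + \<bar>l0 - l\<^sub>e\<bar> \<le> \<epsilon>"
    show "\<exists>l f\<^sub>p. is_solution L \<zeta> \<rho>\<^sub>o V\<^sub>e\<^sub>f\<^sub>f S\<^sub>e\<^sub>f\<^sub>f B K\<^sub>d T l0 fp0 N g l f\<^sub>p
      \<and> (\<forall>l' f\<^sub>p'. is_solution L \<zeta> \<rho>\<^sub>o V\<^sub>e\<^sub>f\<^sub>f S\<^sub>e\<^sub>f\<^sub>f B K\<^sub>d T l0 fp0 N g l' f\<^sub>p' \<longrightarrow>
           (\<forall>t\<in>{0..T}. l' t = l t \<and> (\<forall>x\<in>{0..1}. f\<^sub>p' t x = f\<^sub>p t x)))
      \<and> C0_H2_norm T (\<lambda>t x. f\<^sub>p t x - f\<^sub>p\<^sub>e) \<le> sqrt (A2\<^sup>2 + (L * A1)\<^sup>2 + L ^ 3 * CQ) * \<epsilon>"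
    proof -
      have N: "N \<in> W1inf {0<..<T}" "continuous_on {0..T} N" using a by auto
      have nonneg: "0 \<le> H2_norm I h" for I h
        unfolding H2_norm_def by (intro real_sqrt_ge_zero add_nonneg_nonneg Bochner_Integration.integral_nonneg) auto
      have "0 \<le> W1inf_norm {0<..<T} (\<lambda>t. N t - N\<^sub>e)"
        using W1inf_norm_close[OF N \<open>0 < T\<close> order_refl] by blast
      then have close: "H2_norm {0<..<1} (\<lambda>x. fp0 x - f\<^sub>p\<^sub>e) \<le> \<epsilon>" "H2_norm {0<..<T} (\<lambda>t. g t - f\<^sub>p\<^sub>e) \<le> \<epsilon>"
        "W1inf_norm {0<..<T} (\<lambda>t. N t - N\<^sub>e) \<le> \<epsilon>" "\<bar>l0 - l\<^sub>e\<bar> \<le> \<epsilon>"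
        using a(10) nonneg[of "{0<..<1}" "\<lambda>x. fp0 x - f\<^sub>p\<^sub>e"] nonneg[of "{0<..<T}" "\<lambda>t. g t - f\<^sub>p\<^sub>e"] by linarith+
      have gc: "(\<forall>t\<in>{0..T}. 0 < N t) \<longrightarrow> continuous_on {0..T} g"
        unfolding a(2) using assms by (intro impI continuous_intros N conjunct2[OF a(5)]) force
      show ?thesis
        by (rule well_posed_near_equilibrium[of T l\<^sub>e N\<^sub>e f\<^sub>p\<^sub>e \<epsilon> l0 fp0 N g, folded Nm_def n0_def \<delta>_def, folded R_def CQ_def,
            folded A1_def, folded A2_def K1_def K2_def, folded A3_def, folded A4_def,
            OF assms(8-14) conjunct1[OF a(1)] small[OF conjunct2[OF a(1)], folded n0_def] conjunct1[OF a(3)]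
              conjunct1[OF a(4)] conjunct2[OF a(4)] N a(7) gc a(8,9) close])
    qed
  qed
qed

end
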